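(* Let $G\in\mathcal F_6$. If $G$ admits a skew partition, then $G$ admits a balanced skew partition.
   Context: Graphs are finite and simple; Berge: all holes (induced cycles of length $\ge4$) and antiholes (induced subgraphs whose complement is a hole) are even. Paths are induced subgraphs that are paths; antipaths induced subgraphs whose complement is a path. A prism consists of two vertex-disjoint triangles $\{a_1,a_2,a_3\},\{b_1,b_2,b_3\}$ and paths $P_i$ from $a_i$ to $b_i$ with the only edges between $V(P_i),V(P_j)$ ($i\ne j$) being $a_ia_j,b_ib_j$; long if some $P_i$ has length $>1$. The double diamond: vertices $a_1..a_4,b_1..b_4$, every two $a_i$ adjacent except $a_3a_4$, every two $b_i$ adjacent except $b_3b_4$, $a_ib_i$ edges, no other edges. $\mathcal F_5$: Berge graphs $G$ such that for every bipartite subdivision $H$ of $K_4$ neither $G$ nor $\overline G$ has an induced subgraph isomorphic to $L(H)$, and neither $G$ nor $\overline G$ has an induced long prism. $\mathcal F_6$: graphs in $\mathcal F_5$ with no induced subgraph isomorphic to the double diamond. Skew partition: partition $(A,B)$ of $V(G)$ with $G|A$ disconnected and $\overline G|B$ disconnected; balanced if there is no odd path between nonadjacent vertices of $B$ with interior in $A$ and no odd antipath between adjacent vertices of $A$ with interior in $B$. *)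

theory Defs
  imports Main
begin

record 'a graph =
  verts :: "'a set"
  adj :: "'a \<Rightarrow> 'a \<Rightarrow> bool"

definition graph :: "'a graph \<Rightarrow> bool" where
  "graph G \<longleftrightarrow> finite (verts G) \<and>
     (\<forall>u v. adj G u v \<longrightarrow> u \<in> verts G \<and> v \<in> verts G \<and> u \<noteq> v \<and> adj G v u)"

definition compl :: "'a graph \<Rightarrow> 'a graph" where
  "compl G = \<lparr> verts = verts G,
     adj = (\<lambda>u v. u \<in> verts G \<and> v \<in> verts G \<and> u \<noteq> v \<and> \<not> adj G u v) \<rparr>"

definition contains_induced :: "'a graph \<Rightarrow> 'b graph \<Rightarrow> bool" where
  "contains_induced G H \<longleftrightarrow> (\<exists>f. inj_on f (verts H) \<and> f ` verts H \<subseteq> verts G \<and>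
     (\<forall>u\<in>verts H. \<forall>v\<in>verts H. adj G (f u) (f v) \<longleftrightarrow> adj H u v))"

text \<open>Induced path given by its vertex sequence; its length is the number of edges.\<close>
definition is_path :: "'a graph \<Rightarrow> 'a list \<Rightarrow> bool" where
  "is_path G P \<longleftrightarrow> P \<noteq> [] \<and> distinct P \<and> set P \<subseteq> verts G \<and>
     (\<forall>i<length P. \<forall>j<length P. adj G (P!i) (P!j) \<longleftrightarrow> (j = Suc i \<or> i = Suc j))"

definition is_antipath :: "'a graph \<Rightarrow> 'a list \<Rightarrow> bool" where
  "is_antipath G P \<longleftrightarrow> is_path (compl G) P"

definition is_hole :: "'a graph \<Rightarrow> 'a list \<Rightarrow> bool" where
  "is_hole G C \<longleftrightarrow> length C \<ge> 4 \<and> distinct C \<and> set C \<subseteq> verts G \<and>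
     (\<forall>i<length C. \<forall>j<length C. adj G (C!i) (C!j) \<longleftrightarrow>
        (j = Suc i mod length C \<or> i = Suc j mod length C))"

definition is_antihole :: "'a graph \<Rightarrow> 'a list \<Rightarrow> bool" where
  "is_antihole G C \<longleftrightarrow> is_hole (compl G) C"

definition berge :: "'a graph \<Rightarrow> bool" where
  "berge G \<longleftrightarrow> (\<forall>C. is_hole G C \<longrightarrow> even (length C)) \<and>
                (\<forall>C. is_antihole G C \<longrightarrow> even (length C))"

definition has_long_prism :: "'a graph \<Rightarrow> bool" where
  "has_long_prism G \<longleftrightarrow> (\<exists>P :: nat \<Rightarrow> 'a list.
     (\<forall>i<3. is_path G (P i) \<and> length (P i) \<ge> 2) \<and>
     (\<forall>i<3. \<forall>j<3. i \<noteq> j \<longrightarrow> set (P i) \<inter> set (P j) = {} \<and>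
        (\<forall>u\<in>set (P i). \<forall>v\<in>set (P j). adj G u v \<longleftrightarrow>
           (u = hd (P i) \<and> v = hd (P j)) \<or> (u = last (P i) \<and> v = last (P j)))) \<and>
     (\<exists>i<3. length (P i) > 2))"

definition subdivision_K4 :: "'b graph \<Rightarrow> bool" where
  "subdivision_K4 H \<longleftrightarrow> (\<exists>(x :: nat \<Rightarrow> 'b) (Q :: nat \<Rightarrow> nat \<Rightarrow> 'b list).
     inj_on x {0..<4} \<and>
     (\<forall>i j. i < j \<and> j < 4 \<longrightarrow> length (Q i j) \<ge> 2 \<and> distinct (Q i j) \<and>
        hd (Q i j) = x i \<and> last (Q i j) = x j) \<and>
     (\<forall>i j k l. i < j \<and> j < 4 \<and> k < l \<and> l < 4 \<and> (i, j) \<noteq> (k, l) \<longrightarrow>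
        set (Q i j) \<inter> set (Q k l) \<subseteq> {x i, x j} \<inter> {x k, x l}) \<and>
     verts H = (\<Union>i\<in>{0..<4}. \<Union>j\<in>{i<..<4}. set (Q i j)) \<and>
     (\<forall>u v. adj H u v \<longleftrightarrow> (\<exists>i j k. i < j \<and> j < 4 \<and> Suc k < length (Q i j) \<and>
        {u, v} = {Q i j ! k, Q i j ! Suc k})))"

definition bipartite :: "'b graph \<Rightarrow> bool" where
  "bipartite H \<longleftrightarrow> (\<exists>c :: 'b \<Rightarrow> bool. \<forall>u v. adj H u v \<longrightarrow> c u \<noteq> c v)"

definition line_graph :: "'b graph \<Rightarrow> 'b set graph" where
  "line_graph H = \<lparr> verts = {{u, v} | u v. adj H u v},
     adj = (\<lambda>e f. e \<in> {{u, v} | u v. adj H u v} \<and> f \<in> {{u, v} | u v. adj H u v} \<and>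
                  e \<noteq> f \<and> e \<inter> f \<noteq> {}) \<rparr>"

text \<open>Double diamond on vertices 0..7: a_i = i-1, b_i = i+3 (i = 1..4).\<close>
definition double_diamond :: "nat graph" where
  "double_diamond = \<lparr> verts = {0..<8},
     adj = (\<lambda>u v. u < 8 \<and> v < 8 \<and> u \<noteq> v \<and>
        ((u < 4 \<and> v < 4 \<and> {u, v} \<noteq> {2, 3}) \<or>
         (4 \<le> u \<and> 4 \<le> v \<and> {u, v} \<noteq> {6, 7}) \<or>
         u = v + 4 \<or> v = u + 4)) \<rparr>"

text \<open>Every finite graph is isomorphic to one with vertices in nat, so quantifying
  over nat graphs H covers all bipartite subdivisions of K4.\<close>
definition F5 :: "'a graph \<Rightarrow> bool" where
  "F5 G \<longleftrightarrow> berge G \<and>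
     (\<forall>H :: nat graph. graph H \<and> subdivision_K4 H \<and> bipartite H \<longrightarrow>
        \<not> contains_induced G (line_graph H) \<and> \<not> contains_induced (compl G) (line_graph H)) \<and>
     \<not> has_long_prism G \<and> \<not> has_long_prism (compl G)"

definition F6 :: "'a graph \<Rightarrow> bool" where
  "F6 G \<longleftrightarrow> F5 G \<and> \<not> contains_induced G double_diamond"

definition disconnected_on :: "'a graph \<Rightarrow> 'a set \<Rightarrow> bool" where
  "disconnected_on G S \<longleftrightarrow> (\<exists>X Y. X \<noteq> {} \<and> Y \<noteq> {} \<and> X \<union> Y = S \<and> X \<inter> Y = {} \<and>
     (\<forall>x\<in>X. \<forall>y\<in>Y. \<not> adj G x y))"

definition skew_partition :: "'a graph \<Rightarrow> 'a set \<Rightarrow> 'a set \<Rightarrow> bool" where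
  "skew_partition G A B \<longleftrightarrow> A \<union> B = verts G \<and> A \<inter> B = {} \<and>
     disconnected_on G A \<and> disconnected_on (compl G) B"

definition balanced_skew_partition :: "'a graph \<Rightarrow> 'a set \<Rightarrow> 'a set \<Rightarrow> bool" where
  "balanced_skew_partition G A B \<longleftrightarrow> skew_partition G A B \<and>
     \<not> (\<exists>P. is_path G P \<and> odd (length P - 1) \<and> hd P \<in> B \<and> last P \<in> B \<and>
            \<not> adj G (hd P) (last P) \<and> set (butlast (tl P)) \<subseteq> A) \<and>
     \<not> (\<exists>P. is_antipath G P \<and> odd (length P - 1) \<and> hd P \<in> A \<and> last P \<in> A \<and>
            adj G (hd P) (last P) \<and> set (butlast (tl P)) \<subseteq> B)"

end

theory Submission
  imports Defs
begin

text \<open>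
  A skew partition is loose if some vertex of \<open>B\<close> has no neighbour in some component of \<open>A\<close>, or dually. A loose skew
  partition is turned into a balanced one by shrinking the component and an anticomponent complete to that vertex
  until they can serve as the core of a new partition, whose balancedness then follows from the Roussel--Rubio lemma.
  Excluding long prisms removes the leap outcome from that lemma. If the partition is not loose, an odd path through a
  component \<open>A\<^sub>1\<close> has length 3 by Roussel--Rubio, its inner vertices are joined by an odd antipath through another
  anticomponent, which also has length 3, and the ends of the path are joined by a path of length 3 through a second component
  \<open>A\<^sub>2\<close>. These eight vertices induce a double diamond or the line graph of \<open>K\<^sub>3\<^sub>,\<^sub>3\<close> minus an edge.
\<close>

section \<open>Complements, connectivity and induced paths\<close>

text \<open>All graph classes used here are closed under complementation, the double diamond being
  self-complementary, so components of \<open>A\<close> and anticomponents of \<open>B\<close> share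
  one argument, applied to the graph and to its complement. The obstacle for loose partitions is
  that removing a vertex from a component does not leave a partition of the same kind. The induction
  therefore forgets the partition and keeps a connected set, a disjoint anticonnected set and a
  witness vertex, a condition that survives both shrinking and complementation. The Roussel--Rubio
  lemma is proved by induction on the anticonnected set \<open>X\<close>. For a vertex
  \<open>t\<close> whose removal leaves \<open>X\<close> anticonnected, a parity count along a long
  path forces its second or its second-to-last vertex to be complete to \<open>X - {t}\<close>. One
  such vertex cannot serve two choices of \<open>t\<close>, so three choices are contradictory, and
  two choices are excluded by a further parity count. Prism-freeness enters when \<open>X\<close> is
  a nonadjacent pair.\<close>

lemma verts_compl [simp]: "verts (compl G) = verts G"
  by (simp add: compl_def)

lemma adj_compl: "adj (compl G) u v \<longleftrightarrow> u \<in> verts G \<and> v \<in> verts G \<and> u \<noteq> v \<and> \<not> adj G u v"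
  by (simp add: compl_def)

lemma adj_sym: "graph G \<Longrightarrow> adj G u v \<longleftrightarrow> adj G v u"
  unfolding graph_def by blast

lemma adj_irrefl: "graph G \<Longrightarrow> \<not> adj G u u"
  unfolding graph_def by blast

lemma adj_verts: "graph G \<Longrightarrow> adj G u v \<Longrightarrow> u \<in> verts G \<and> v \<in> verts G"
  unfolding graph_def by blast

lemma finite_verts: "graph G \<Longrightarrow> finite (verts G)"
  unfolding graph_def by blast

lemma graph_compl: "graph G \<Longrightarrow> graph (compl G)"
  unfolding graph_def compl_def by auto

lemma compl_compl [simp]:
  assumes "graph G" shows "compl (compl G) = G"
proof -
  have "adj (compl (compl G)) = adj G"
    using assms by (intro ext) (auto simp: adj_compl graph_def)
  then show ?thesis by (simp add: compl_def)
qed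

lemma adj_compl_compl: "graph G \<Longrightarrow> adj G u v \<longleftrightarrow> u \<in> verts G \<and> v \<in> verts G \<and> u \<noteq> v \<and> \<not> adj (compl G) u v"
  by (metis adj_compl compl_compl verts_compl)

section \<open>Completeness to a set and connectivity\<close>

definition complete :: "'a graph \<Rightarrow> 'a \<Rightarrow> 'a set \<Rightarrow> bool" where
  "complete G v X \<longleftrightarrow> (\<forall>x\<in>X. adj G v x)"

definition anticomplete :: "'a graph \<Rightarrow> 'a \<Rightarrow> 'a set \<Rightarrow> bool" where
  "anticomplete G v X \<longleftrightarrow> (\<forall>x\<in>X. \<not> adj G v x)"

lemma complete_compl:
  "v \<in> verts G \<Longrightarrow> X \<subseteq> verts G \<Longrightarrow> v \<notin> X \<Longrightarrow> complete (compl G) v X \<longleftrightarrow> anticomplete G v X"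
  unfolding complete_def anticomplete_def adj_compl by blast

lemma anticomplete_compl:
  "v \<in> verts G \<Longrightarrow> X \<subseteq> verts G \<Longrightarrow> v \<notin> X \<Longrightarrow> anticomplete (compl G) v X \<longleftrightarrow> complete G v X"
  unfolding complete_def anticomplete_def adj_compl by blast

text \<open>Phrased by cuts rather than by paths: on nonempty sets this is the negation of
  \<open>disconnected_on\<close>, and unions need no concatenation of paths. Induced paths are
  recovered from it in \<open>conn_path\<close>.\<close>

definition conn :: "'a graph \<Rightarrow> 'a set \<Rightarrow> bool" where
  "conn G S \<longleftrightarrow> S \<noteq> {} \<and> (\<forall>X. X \<subseteq> S \<and> X \<noteq> {} \<and> X \<noteq> S \<longrightarrow> (\<exists>x\<in>X. \<exists>y\<in>S - X. adj G x y))"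

lemma conn_iff_not_disconnected: "conn G S \<longleftrightarrow> S \<noteq> {} \<and> \<not> disconnected_on G S"
proof (cases "S = {}")
  case False
  have "(\<forall>X. X \<subseteq> S \<and> X \<noteq> {} \<and> X \<noteq> S \<longrightarrow> (\<exists>x\<in>X. \<exists>y\<in>S - X. adj G x y)) \<longleftrightarrow> \<not> disconnected_on G S"
  proof
    assume L: "\<forall>X. X \<subseteq> S \<and> X \<noteq> {} \<and> X \<noteq> S \<longrightarrow> (\<exists>x\<in>X. \<exists>y\<in>S - X. adj G x y)"
    show "\<not> disconnected_on G S"
    proof
      assume "disconnected_on G S"
      then obtain X Y where XY: "X \<noteq> {}" "Y \<noteq> {}" "X \<union> Y = S" "X \<inter> Y = {}" "\<forall>x\<in>X. \<forall>y\<in>Y. \<not> adj G x y"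
        unfolding disconnected_on_def by blast
      then have "X \<subseteq> S \<and> X \<noteq> {} \<and> X \<noteq> S" "S - X = Y" by auto
      then show False using L XY by metis
    qed
  next
    assume R: "\<not> disconnected_on G S"
    show "\<forall>X. X \<subseteq> S \<and> X \<noteq> {} \<and> X \<noteq> S \<longrightarrow> (\<exists>x\<in>X. \<exists>y\<in>S - X. adj G x y)"
    proof (intro allI impI)
      fix X assume X: "X \<subseteq> S \<and> X \<noteq> {} \<and> X \<noteq> S"
      show "\<exists>x\<in>X. \<exists>y\<in>S - X. adj G x y"
      proof (rule ccontr)
        assume "\<not> ?thesis"
        then have "disconnected_on G S" unfolding disconnected_on_def
          using X by (intro exI[of _ X] exI[of _ "S - X"]) blast
        then show False using R by simp
      qed
    qed
  qed
  then show ?thesis using False unfolding conn_def by simp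
qed (simp add: conn_def)

lemma conn_singleton: "conn G {v}"
  unfolding conn_def by blast

lemma conn_subset_cases:
  assumes "conn G S" "S \<subseteq> X \<union> Y" "X \<inter> Y = {}" "\<And>x y. x \<in> X \<Longrightarrow> y \<in> Y \<Longrightarrow> \<not> adj G x y"
  shows "S \<subseteq> X \<or> S \<subseteq> Y"
proof (rule ccontr)
  assume n: "\<not> ?thesis"
  let ?X = "S \<inter> X"
  have "?X \<subseteq> S \<and> ?X \<noteq> {} \<and> ?X \<noteq> S" using n assms(2) by blast
  then obtain x y where "x \<in> ?X" "y \<in> S - ?X" "adj G x y"
    using assms(1) unfolding conn_def by metis
  then show False using assms by blast
qed

lemma conn_Un:
  assumes "graph G" "conn G S" "conn G T" "S \<inter> T \<noteq> {} \<or> (\<exists>s\<in>S. \<exists>t\<in>T. adj G s t)"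
  shows "conn G (S \<union> T)"
proof (rule ccontr)
  assume "\<not> ?thesis"
  then have "disconnected_on G (S \<union> T)"
    using assms(2) unfolding conn_iff_not_disconnected by blast
  then obtain X Y where XY: "X \<noteq> {}" "Y \<noteq> {}" "X \<union> Y = S \<union> T" "X \<inter> Y = {}" "\<forall>x\<in>X. \<forall>y\<in>Y. \<not> adj G x y"
    unfolding disconnected_on_def by blast
  have "S \<subseteq> X \<or> S \<subseteq> Y" by (rule conn_subset_cases[OF assms(2)]) (use XY in blast)+
  moreover have "T \<subseteq> X \<or> T \<subseteq> Y" by (rule conn_subset_cases[OF assms(3)]) (use XY in blast)+
  ultimately consider "S \<subseteq> X" "T \<subseteq> Y" | "S \<subseteq> Y" "T \<subseteq> X"
    using XY(1-4) by blast
  then show False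
  proof cases
    case 1
    then show False using assms(4) XY(4,5) by blast
  next
    case 2
    then have "\<exists>s\<in>S. \<exists>t\<in>T. adj G s t" using assms(4) XY(4) by blast
    then show False using 2 XY(5) adj_sym[OF assms(1)] by blast
  qed
qed

lemma conn_insert:
  assumes "graph G" "conn G S" "s \<in> S" "adj G v s"
  shows "conn G (insert v S)"
  using conn_Un[OF assms(1) conn_singleton[of G v] assms(2)] assms(3,4) by auto

lemma conn_nbr:
  assumes "conn G S" "s \<in> S" "S \<noteq> {s}"
  shows "\<exists>y\<in>S. y \<noteq> s \<and> adj G s y"
proof -
  have "{s} \<subseteq> S \<and> {s} \<noteq> {} \<and> {s} \<noteq> S" using assms by auto
  then obtain x y where "x \<in> {s}" "y \<in> S - {s}" "adj G x y"
    using assms(1) unfolding conn_def by metis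
  then show ?thesis by blast
qed

text \<open>A connected set between \<open>C\<close> and \<open>S\<close> of greatest size has no
  edge to the rest of \<open>S\<close>, since adding the far end would keep it connected.\<close>

lemma component_exists:
  assumes "graph G" "finite S" "conn G C" "C \<subseteq> S"
  obtains D where "C \<subseteq> D" "D \<subseteq> S" "conn G D" "\<And>x y. x \<in> D \<Longrightarrow> y \<in> S - D \<Longrightarrow> \<not> adj G x y"
proof -
  let ?F = "\<lambda>D. C \<subseteq> D \<and> D \<subseteq> S \<and> conn G D"
  have "\<exists>D. ?F D \<and> (\<forall>E. ?F E \<longrightarrow> card E \<le> card D)"
    by (rule ex_has_greatest_nat[of ?F C card "Suc (card S)"])
      (use assms in \<open>auto intro: card_mono simp: less_Suc_eq_le\<close>)
  then obtain D where D: "?F D" and mx: "\<And>E. ?F E \<Longrightarrow> card E \<le> card D" by blast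
  show ?thesis
  proof (rule that)
    fix x y assume xy: "x \<in> D" "y \<in> S - D"
    show "\<not> adj G x y"
    proof
      assume "adj G x y"
      then have "conn G (insert y D)" using conn_insert[of G D x y] D xy assms(1) adj_sym[OF assms(1)] by blast
      then have "card (insert y D) \<le> card D" using D xy by (intro mx) auto
      moreover have "finite D" "y \<notin> D" using xy D assms(2) finite_subset by auto
      ultimately show False by simp
    qed
  qed (use D in auto)
qed

text \<open>A largest connected proper subset of \<open>S\<close> containing \<open>C\<close> misses
  just one vertex: it sends an edge to some \<open>v\<close> in \<open>S\<close>, and adding
  \<open>v\<close> keeps it connected, so gives all of \<open>S\<close>. Forcing \<open>v\<close>
  outside \<open>C\<close> is what later produces second and third deletable vertices different from
  those already chosen.\<close>

lemma conn_noncut: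
  assumes "graph G" "finite S" "conn G S" "conn G C" "C \<subset> S"
  obtains v where "v \<in> S - C" "conn G (S - {v})"
proof -
  let ?F = "\<lambda>D. C \<subseteq> D \<and> D \<subset> S \<and> conn G D"
  have "\<exists>D. ?F D \<and> (\<forall>E. ?F E \<longrightarrow> card E \<le> card D)"
    by (rule ex_has_greatest_nat[of ?F C card "Suc (card S)"])
      (use assms in \<open>auto intro: card_mono simp: less_Suc_eq_le\<close>)
  then obtain D where D: "?F D" and mx: "\<And>E. ?F E \<Longrightarrow> card E \<le> card D" by blast
  have "D \<subseteq> S \<and> D \<noteq> {} \<and> D \<noteq> S" using D unfolding conn_def by blast
  then obtain x v where xv: "x \<in> D" "v \<in> S - D" "adj G x v" using assms(3) unfolding conn_def by metis
  have c: "conn G (insert v D)"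
    using conn_insert[of G D x v] D xv assms(1) adj_sym[OF assms(1)] by blast
  have "insert v D = S"
  proof (rule ccontr)
    assume "insert v D \<noteq> S"
    then have "card (insert v D) \<le> card D" using D xv c by (intro mx) auto
    moreover have "finite D" "v \<notin> D" using xv D assms(2) finite_subset by auto
    ultimately show False by simp
  qed
  then have "S - {v} = D" using xv by blast
  then show ?thesis using that[of v] xv D by auto
qed

section \<open>Induced paths as vertex lists\<close>

lemma is_path_singleton [simp]: "graph G \<Longrightarrow> is_path G [x] \<longleftrightarrow> x \<in> verts G"
  unfolding is_path_def using adj_irrefl by fastforce

lemma is_path_Cons:
  assumes "graph G" "xs \<noteq> []"
  shows "is_path G (x # xs) \<longleftrightarrow> x \<in> verts G \<and> x \<notin> set xs \<and> is_path G xs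
    \<and> (\<forall>z\<in>set xs. adj G x z \<longleftrightarrow> z = hd xs)"
proof (cases "distinct xs")
  case True
  have hd0: "hd xs = xs ! 0" using assms by (simp add: hd_conv_nth)
  have eq: "(\<forall>z\<in>set xs. adj G x z \<longleftrightarrow> z = hd xs) \<longleftrightarrow> (\<forall>j<length xs. adj G x (xs!j) \<longleftrightarrow> j = 0)"
    unfolding all_set_conv_all_nth hd0 using nth_eq_iff_index_eq[OF True] assms(2) by auto
  show ?thesis
    unfolding is_path_def eq using True assms(2)
    by (simp add: All_less_Suc2 adj_irrefl[OF assms(1)] adj_sym[OF assms(1), of "xs ! _" x]) blast
qed (simp add: is_path_def)

lemma is_path_append:
  assumes "graph G" "ys \<noteq> []"
  shows "xs \<noteq> [] \<Longrightarrow> is_path G (xs @ ys) \<longleftrightarrow> is_path G xs \<and> is_path G ys \<and> set xs \<inter> set ys = {}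
    \<and> (\<forall>x\<in>set xs. \<forall>y\<in>set ys. adj G x y \<longleftrightarrow> x = last xs \<and> y = hd ys)"
proof (induction xs)
  case (Cons a xs)
  show ?case
  proof (cases "xs = []")
    case True
    then show ?thesis using assms by (auto simp: is_path_Cons)
  next
    case False
    have hx: "hd xs \<in> set xs" and lx: "last xs \<in> set xs" using False by auto
    have key: "set xs \<inter> set ys = {} \<Longrightarrow> (\<forall>z\<in>set ys. adj G a z \<longleftrightarrow> z = hd xs) \<longleftrightarrow> (\<forall>z\<in>set ys. \<not> adj G a z)"
      by (rule ball_cong) (use hx in auto)
    have "is_path G (a # xs @ ys) \<longleftrightarrow> a \<in> verts G \<and> a \<notin> set xs \<and> a \<notin> set ys \<and> is_path G (xs @ ys)
      \<and> (\<forall>z\<in>set xs. adj G a z \<longleftrightarrow> z = hd xs) \<and> (\<forall>z\<in>set ys. adj G a z \<longleftrightarrow> z = hd xs)"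
      using is_path_Cons[OF assms(1), of "xs @ ys" a] False by auto
    also have "\<dots> \<longleftrightarrow> is_path G (a # xs) \<and> is_path G ys \<and> (a \<notin> set ys \<and> set xs \<inter> set ys = {})
      \<and> (\<forall>z\<in>set ys. \<not> adj G a z) \<and> (\<forall>x\<in>set xs. \<forall>y\<in>set ys. adj G x y \<longleftrightarrow> x = last xs \<and> y = hd ys)"
      unfolding Cons.IH[OF False] is_path_Cons[OF assms(1) False] using key by argo
    also have "\<dots> \<longleftrightarrow> is_path G (a # xs) \<and> is_path G ys \<and> set (a # xs) \<inter> set ys = {}
      \<and> (\<forall>x\<in>set (a # xs). \<forall>y\<in>set ys. adj G x y \<longleftrightarrow> x = last (a # xs) \<and> y = hd ys)"
      using False lx by (auto simp: is_path_Cons[OF assms(1) False])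
    finally show ?thesis by simp
  qed
qed simp

lemma is_path_rev:
  assumes "is_path G P" shows "is_path G (rev P)"
proof -
  have "adj G (rev P ! i) (rev P ! j) \<longleftrightarrow> j = Suc i \<or> i = Suc j" if ij: "i < length P" "j < length P" for i j
  proof -
    have "length P - Suc i < length P" "length P - Suc j < length P" using ij by auto
    then have "adj G (P ! (length P - Suc i)) (P ! (length P - Suc j)) \<longleftrightarrow>
        length P - Suc j = Suc (length P - Suc i) \<or> length P - Suc i = Suc (length P - Suc j)"
      using assms unfolding is_path_def by blast
    moreover have "length P - Suc j = Suc (length P - Suc i) \<longleftrightarrow> i = Suc j" "length P - Suc i = Suc (length P - Suc j) \<longleftrightarrow> j = Suc i"
      using ij by linarith+
    ultimately show ?thesis using ij by (simp add: rev_nth disj_commute)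
  qed
  then show ?thesis using assms unfolding is_path_def by simp
qed

lemma is_path_rev_iff [simp]: "is_path G (rev P) \<longleftrightarrow> is_path G P"
  using is_path_rev[of G P] is_path_rev[of G "rev P"] by auto

lemma is_path_set_conn:
  assumes "graph G"
  shows "is_path G P \<Longrightarrow> conn G (set P)"
proof (induction P)
  case (Cons a P)
  show ?case
  proof (cases "P = []")
    case False
    then have "conn G (set P)" "adj G a (hd P)" "hd P \<in> set P"
      using Cons is_path_Cons[OF assms False] by auto
    then show ?thesis using conn_insert[OF assms] by simp
  qed (simp add: conn_singleton)
qed (simp add: is_path_def)

text \<open>Jumping from \<open>x\<close> to its last neighbour on \<open>P\<close> leaves no chord;
  if \<open>x\<close> already lies on \<open>P\<close>, the tail from \<open>x\<close> is taken
  instead.\<close>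

lemma path_Cons_shortcut:
  assumes "graph G" "is_path G P" "x \<in> verts G" "adj G x (hd P)"
  obtains R where "is_path G R" "hd R = x" "last R = last P" "set R \<subseteq> insert x (set P)"
proof (cases "x \<in> set P")
  case True
  then obtain as bs where P: "P = as @ x # bs" by (meson split_list)
  have "is_path G (x # bs)" using assms(2) P is_path_append[OF assms(1), of "x # bs" as] by (cases "as = []") auto
  then show ?thesis using that[of "x # bs"] P by auto
next
  case False
  have "P \<noteq> []" using assms(2) unfolding is_path_def by simp
  then have "\<exists>z\<in>set P. adj G x z" using assms(4) hd_in_set by blast
  then obtain as z bs where P: "P = as @ z # bs" and z: "adj G x z" and bs: "\<forall>y\<in>set bs. \<not> adj G x y"
    using split_list_last_prop[of P "adj G x"] by blast
  have p: "is_path G (z # bs)" using assms(2) P is_path_append[OF assms(1), of "z # bs" as] by (cases "as = []") auto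
  have "z \<notin> set bs" using p unfolding is_path_def by simp
  then have "is_path G (x # z # bs)"
    unfolding is_path_Cons[OF assms(1), of "z # bs" x, simplified] using p False P z bs assms(3) by auto
  then show ?thesis using that[of "x # z # bs"] P by auto
qed

text \<open>The vertices of \<open>S\<close> that reach \<open>b\<close> by an induced path inside
  \<open>S\<close> are closed under taking neighbours in \<open>S\<close>, so no edge leaves them
  and they fill the connected set \<open>S\<close>.\<close>

lemma conn_path:
  assumes "graph G" "conn G S" "S \<subseteq> verts G" "a \<in> S" "b \<in> S"
  obtains P where "is_path G P" "hd P = a" "last P = b" "set P \<subseteq> S"
proof -
  define R where "R = {s\<in>S. \<exists>P. is_path G P \<and> hd P = s \<and> last P = b \<and> set P \<subseteq> S}"
  have "is_path G [b]" using assms by auto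
  then have bR: "b \<in> R" using assms unfolding R_def by fastforce
  have "R = S"
  proof (rule ccontr)
    assume "R \<noteq> S"
    then have "R \<subseteq> S \<and> R \<noteq> {} \<and> R \<noteq> S" using bR R_def by blast
    then obtain r s where rs: "r \<in> R" "s \<in> S - R" "adj G r s" using assms(2) unfolding conn_def by metis
    then obtain P where P: "is_path G P" "hd P = r" "last P = b" "set P \<subseteq> S" unfolding R_def by blast
    have "adj G s (hd P)" using rs P adj_sym[OF assms(1)] by blast
    then obtain T where "is_path G T" "hd T = s" "last T = last P" "set T \<subseteq> insert s (set P)"
      using path_Cons_shortcut[OF assms(1) P(1), of s] rs assms(3) by blast
    then have "s \<in> R" unfolding R_def using rs P by blast
    then show False using rs by blast
  qed
  then show ?thesis using assms(4) that unfolding R_def by blast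
qed

lemma list_ends: "length P \<ge> 2 \<Longrightarrow> P = hd P # butlast (tl P) @ [last P]"
  by (cases P) auto

lemma conn_path_through:
  assumes "graph G" "conn G S" "S \<subseteq> verts G" "u \<in> verts G" "v \<in> verts G" "u \<noteq> v" "\<not> adj G u v"
    "\<not> anticomplete G u S" "\<not> anticomplete G v S"
  obtains Q where "Q \<noteq> []" "set Q \<subseteq> S" "is_path G (u # Q @ [v])"
proof -
  obtain s t where st: "s \<in> S" "adj G u s" "t \<in> S" "adj G v t"
    using assms(8,9) unfolding anticomplete_def by blast
  have "conn G (insert v S)" by (rule conn_insert[OF assms(1,2)]) (use st in auto)
  then have c: "conn G (insert u (insert v S))" by (rule conn_insert[OF assms(1)]) (use st in auto)
  obtain P where P: "is_path G P" "hd P = u" "last P = v" "set P \<subseteq> insert u (insert v S)"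
    using conn_path[OF assms(1) c, of u v] assms by auto
  have ne: "P \<noteq> []" using P(1) unfolding is_path_def by simp
  have "length P \<ge> 2"
  proof (rule ccontr)
    assume "\<not> length P \<ge> 2"
    then have "hd P = last P" using ne by (cases P) (auto simp: Suc_le_eq)
    then show False using P assms by simp
  qed
  then have eq: "P = u # butlast (tl P) @ [v]" using list_ends P by metis
  let ?Q = "butlast (tl P)"
  have "is_path G (u # ?Q @ [v])" using P eq by simp
  then have "distinct (u # ?Q @ [v])" unfolding is_path_def by blast
  then have "u \<notin> set ?Q" "v \<notin> set ?Q" by auto
  moreover have "set ?Q \<subseteq> insert u (insert v S)"
    using P(4) eq by (metis Un_subset_iff set_append set_subset_Cons subset_trans)
  ultimately have "set ?Q \<subseteq> S" by blast
  moreover have "?Q \<noteq> []"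
  proof
    assume "?Q = []"
    then have "is_path G [u, v]" using P eq by simp
    then show False using assms(1,7) is_path_Cons[of G "[v]" u] by simp
  qed
  moreover have "is_path G (u # ?Q @ [v])" using P eq by simp
  ultimately show ?thesis using that by blast
qed

section \<open>Closing paths to holes; odd paths and balancedness\<close>

lemma is_hole_append:
  assumes "is_path G xs" "is_path G ys" "set xs \<inter> set ys = {}" "length xs + length ys \<ge> 4" "graph G"
    and cross: "\<And>x y. x \<in> set xs \<Longrightarrow> y \<in> set ys \<Longrightarrow> adj G x y \<longleftrightarrow> (x = last xs \<and> y = hd ys) \<or> (x = hd xs \<and> y = last ys)"
  shows "is_hole G (xs @ ys)"
proof -
  let ?n = "length xs" and ?m = "length ys"
  have ne: "xs \<noteq> []" "ys \<noteq> []" and d: "distinct xs" "distinct ys" using assms unfolding is_path_def by auto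
  have n0: "?n > 0" "?m > 0" using ne by auto
  have ax: "\<And>i j. i < ?n \<Longrightarrow> j < ?n \<Longrightarrow> adj G (xs!i) (xs!j) \<longleftrightarrow> j = Suc i \<or> i = Suc j"
    using assms(1) unfolding is_path_def by blast
  have ay: "\<And>i j. i < ?m \<Longrightarrow> j < ?m \<Longrightarrow> adj G (ys!i) (ys!j) \<longleftrightarrow> j = Suc i \<or> i = Suc j"
    using assms(2) unfolding is_path_def by blast
  have axy: "adj G (xs!i) (ys!j) \<longleftrightarrow> (i = ?n - 1 \<and> j = 0) \<or> (i = 0 \<and> j = ?m - 1)" if "i < ?n" "j < ?m" for i j
    using cross[of "xs!i" "ys!j"] that d ne n0
    by (simp add: hd_conv_nth last_conv_nth nth_eq_iff_index_eq)
  have mod: "Suc i mod (?n + ?m) = (if Suc i = ?n + ?m then 0 else Suc i)" if "i < ?n + ?m" for i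
    using that by auto
  have "adj G ((xs@ys)!i) ((xs@ys)!j) \<longleftrightarrow> (j = Suc i mod (?n+?m) \<or> i = Suc j mod (?n+?m))"
    if ij: "i < ?n + ?m" "j < ?n + ?m" for i j
  proof -
    consider "i < ?n" "j < ?n" | "i \<ge> ?n" "j \<ge> ?n" | "i < ?n" "j \<ge> ?n" | "i \<ge> ?n" "j < ?n" by linarith
    then show ?thesis
    proof cases
      case 1
      then have "Suc i < ?n + ?m" "Suc j < ?n + ?m" using n0 by linarith+
      then have "Suc i mod (?n+?m) = Suc i" "Suc j mod (?n+?m) = Suc j" by auto
      then show ?thesis using 1 ax[of i j] by (simp add: nth_append)
    next
      case 2
      then have "adj G ((xs@ys)!i) ((xs@ys)!j) \<longleftrightarrow> j - ?n = Suc (i - ?n) \<or> i - ?n = Suc (j - ?n)"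
        using ay[of "i - ?n" "j - ?n"] ij by (auto simp: nth_append)
      then show ?thesis using 2 ij n0 by (auto simp: mod)
    next
      case 3
      then have "adj G ((xs@ys)!i) ((xs@ys)!j) \<longleftrightarrow> (i = ?n - 1 \<and> j - ?n = 0) \<or> (i = 0 \<and> j - ?n = ?m - 1)"
        using axy[of i "j - ?n"] ij by (auto simp: nth_append)
      then show ?thesis using 3 ij n0 assms(4) by (auto simp: mod)
    next
      case 4
      then have "adj G ((xs@ys)!i) ((xs@ys)!j) \<longleftrightarrow> (j = ?n - 1 \<and> i - ?n = 0) \<or> (j = 0 \<and> i - ?n = ?m - 1)"
        using axy[of j "i - ?n"] ij adj_sym[OF assms(5)] by (auto simp: nth_append)
      then show ?thesis using 4 ij n0 assms(4) by (auto simp: mod)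
    qed
  qed
  moreover have "distinct (xs @ ys)" "set (xs @ ys) \<subseteq> verts G" using assms d unfolding is_path_def by auto
  ultimately show ?thesis unfolding is_hole_def using assms(4) by simp
qed

lemma berge_compl: "graph G \<Longrightarrow> berge (compl G) \<longleftrightarrow> berge G"
  unfolding berge_def is_antihole_def by auto

text \<open>The two lists together run once around a hole, so the sum of their vertex counts is its
  length.\<close>

lemma berge_close:
  assumes "berge G" "graph G" "is_path G xs" "is_path G ys" "set xs \<inter> set ys = {}" "length xs + length ys \<ge> 4"
    and "\<And>x y. x \<in> set xs \<Longrightarrow> y \<in> set ys \<Longrightarrow> adj G x y \<longleftrightarrow> (x = last xs \<and> y = hd ys) \<or> (x = hd xs \<and> y = last ys)"
  shows "even (length xs + length ys)"
proof -
  have "is_hole G (xs @ ys)" by (rule is_hole_append) (use assms in auto)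
  then show ?thesis using assms(1) unfolding berge_def by fastforce
qed

lemma berge_close1:
  assumes "berge G" "graph G" "z \<in> verts G" "is_path G ys" "z \<notin> set ys" "length ys \<ge> 3"
    and "\<And>y. y \<in> set ys \<Longrightarrow> adj G z y \<longleftrightarrow> y = hd ys \<or> y = last ys"
  shows "odd (length ys)"
proof -
  have "even (length [z] + length ys)" by (rule berge_close[OF assms(1,2)]) (use assms in auto)
  then show ?thesis by simp
qed

text \<open>Only the interior is confined to \<open>S\<close>; an even number of interior vertices
  means odd length. A nonempty interior makes the ends nonadjacent, and for \<open>compl G\<close>
  adjacent in \<open>G\<close>, so both conditions in balancedness are instances of this one
  predicate.\<close>

definition oddp :: "'a graph \<Rightarrow> 'a \<Rightarrow> 'a \<Rightarrow> 'a set \<Rightarrow> bool" where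
  "oddp G u v S \<longleftrightarrow> (\<exists>Q. Q \<noteq> [] \<and> set Q \<subseteq> S \<and> even (length Q) \<and> is_path G (u # Q @ [v]))"

lemma is_path_ends:
  assumes "graph G" "Q \<noteq> []"
  shows "is_path G (u # Q @ [v]) \<longleftrightarrow> is_path G Q \<and> u \<in> verts G \<and> v \<in> verts G \<and> u \<noteq> v \<and> \<not> adj G u v
    \<and> u \<notin> set Q \<and> v \<notin> set Q \<and> (\<forall>q\<in>set Q. adj G u q \<longleftrightarrow> q = hd Q) \<and> (\<forall>q\<in>set Q. adj G v q \<longleftrightarrow> q = last Q)"
  using assms is_path_Cons[of G "Q @ [v]" u] is_path_append[of G "[v]" Q] adj_sym[OF assms(1), of _ v]
  by (auto; metis hd_in_set last_in_set)

lemma oddp_iff: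
  assumes "graph G"
  shows "oddp G u v S \<longleftrightarrow> (\<exists>P. is_path G P \<and> odd (length P - 1) \<and> hd P = u \<and> last P = v \<and> u \<in> verts G \<and> v \<in> verts G
    \<and> \<not> adj G u v \<and> set (butlast (tl P)) \<subseteq> S)" (is "?L \<longleftrightarrow> ?R")
proof
  assume ?L
  then obtain Q where Q: "Q \<noteq> []" "set Q \<subseteq> S" "even (length Q)" "is_path G (u # Q @ [v])"
    unfolding oddp_def by blast
  then show ?R using is_path_ends[OF assms Q(1)]
    by (intro exI[of _ "u # Q @ [v]"]) auto
next
  assume ?R
  then obtain P where P: "is_path G P" "odd (length P - 1)" "hd P = u" "last P = v" "\<not> adj G u v" "set (butlast (tl P)) \<subseteq> S"
    by blast
  then have "length P \<ge> 2" by (cases "length P \<ge> 2") (auto simp: not_le less_2_cases_iff)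
  then have eq: "P = u # butlast (tl P) @ [v]" using list_ends P by metis
  have "butlast (tl P) \<noteq> []"
  proof
    assume "butlast (tl P) = []"
    then have "is_path G [u, v]" using P eq by simp
    then show False using assms P(5) is_path_Cons[of G "[v]" u] by simp
  qed
  moreover have "even (length (butlast (tl P)))" using P(2) \<open>length P \<ge> 2\<close> by auto
  ultimately show ?L unfolding oddp_def using P eq by metis
qed

text \<open>The parity half of balancedness, separated from the partition property so that it also
  makes sense for a component and an anticomponent that do not cover the graph.\<close>

definition good :: "'a graph \<Rightarrow> 'a set \<Rightarrow> 'a set \<Rightarrow> bool" where
  "good G A B \<longleftrightarrow> (\<forall>u\<in>B. \<forall>v\<in>B. \<not> oddp G u v A) \<and> (\<forall>x\<in>A. \<forall>y\<in>A. \<not> oddp (compl G) x y B)"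

lemma good_compl: "graph G \<Longrightarrow> good (compl G) B A \<longleftrightarrow> good G A B"
  unfolding good_def by auto

lemma skew_partition_compl: "graph G \<Longrightarrow> skew_partition (compl G) B A \<longleftrightarrow> skew_partition G A B"
  unfolding skew_partition_def by auto

lemma balanced_iff_good:
  assumes "graph G"
  shows "balanced_skew_partition G A B \<longleftrightarrow> skew_partition G A B \<and> good G A B"
proof (cases "skew_partition G A B")
  case True
  then have V: "A \<subseteq> verts G" "B \<subseteq> verts G" "A \<inter> B = {}" unfolding skew_partition_def by auto
  have 1: "(\<exists>P. is_path G P \<and> odd (length P - 1) \<and> hd P \<in> B \<and> last P \<in> B \<and>
            \<not> adj G (hd P) (last P) \<and> set (butlast (tl P)) \<subseteq> A) \<longleftrightarrow> (\<exists>u\<in>B. \<exists>v\<in>B. oddp G u v A)"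
    unfolding oddp_iff[OF assms] using V by blast
  \<comment> \<open>The ends of a path of odd length are distinct. This is needed because
    nonadjacency in the complement means adjacency in \<open>G\<close> only for distinct
    vertices.\<close>
  have "odd (length P - 1) \<Longrightarrow> is_path G' P \<Longrightarrow> hd P \<noteq> last P" for P and G' :: "'a graph"
    by (cases P) (auto simp: is_path_def split: if_splits)
  then have 2: "(\<exists>P. is_antipath G P \<and> odd (length P - 1) \<and> hd P \<in> A \<and> last P \<in> A \<and>
            adj G (hd P) (last P) \<and> set (butlast (tl P)) \<subseteq> B) \<longleftrightarrow> (\<exists>u\<in>A. \<exists>v\<in>A. oddp (compl G) u v B)"
    unfolding oddp_iff[OF graph_compl[OF assms]] is_antipath_def adj_compl using V adj_irrefl[OF assms] by auto blast+
  show ?thesis unfolding balanced_skew_partition_def 1 2 good_def using True by blast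
qed (simp add: balanced_skew_partition_def)

lemma balanced_exists_compl:
  "graph G \<Longrightarrow> (\<exists>A B. balanced_skew_partition (compl G) A B) \<longleftrightarrow> (\<exists>A B. balanced_skew_partition G A B)"
  using balanced_iff_good graph_compl skew_partition_compl good_compl by metis

text \<open>\<open>z\<close> sees exactly the two ends of the odd path, so it completes it to an odd
  hole.\<close>

lemma oddp_close:
  assumes "berge G" "graph G" "oddp G x y X" "z \<in> verts G"
    "adj G z x" "adj G z y" "\<And>q. q \<in> X \<Longrightarrow> \<not> adj G z q" "z \<notin> X"
  shows False
proof -
  obtain Q where Q: "Q \<noteq> []" "set Q \<subseteq> X" "even (length Q)" "is_path G (x # Q @ [y])"
    using assms(3) unfolding oddp_def by blast
  have "odd (length (x # Q @ [y]))"
    by (rule berge_close1[OF assms(1,2,4) Q(4)]) (use Q assms adj_irrefl[OF assms(2)] in \<open>auto simp: Suc_le_eq\<close>)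
  then show False using Q by simp
qed

section \<open>The Roussel--Rubio lemma\<close>

definition seg :: "'a list \<Rightarrow> nat \<Rightarrow> nat \<Rightarrow> 'a list" where
  "seg P a b = map (nth P) [a..<Suc b]"

lemma length_seg [simp]: "length (seg P a b) = Suc b - a"
  by (simp add: seg_def del: upt_Suc)

lemma set_seg: "set (seg P a b) = nth P ` {a..b}"
  by (simp add: seg_def atLeastLessThanSuc_atLeastAtMost del: upt_Suc)

lemma seg_nth: "i < Suc b - a \<Longrightarrow> seg P a b ! i = P ! (a + i)"
  by (simp add: seg_def del: upt_Suc)

lemma seg_not_Nil: "a \<le> b \<Longrightarrow> seg P a b \<noteq> []"
  by (simp add: seg_def)

lemma hd_seg: "a \<le> b \<Longrightarrow> hd (seg P a b) = P ! a"
  using seg_nth[of 0 b a P] by (simp add: hd_conv_nth seg_not_Nil)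

lemma last_seg: "a \<le> b \<Longrightarrow> last (seg P a b) = P ! b"
  by (simp add: seg_def)

lemma is_path_adj:
  "is_path G P \<Longrightarrow> i < length P \<Longrightarrow> j < length P \<Longrightarrow> adj G (P!i) (P!j) \<longleftrightarrow> j = Suc i \<or> i = Suc j"
  unfolding is_path_def by blast

lemma is_path_nth_eq:
  "is_path G P \<Longrightarrow> i < length P \<Longrightarrow> j < length P \<Longrightarrow> P!i = P!j \<longleftrightarrow> i = j"
  unfolding is_path_def using nth_eq_iff_index_eq by blast

lemma is_path_nth_verts: "is_path G P \<Longrightarrow> i < length P \<Longrightarrow> P!i \<in> verts G"
  unfolding is_path_def by force

lemma is_path_seg:
  assumes "is_path G P" "a \<le> b" "b < length P"
  shows "is_path G (seg P a b)"
proof -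
  have "distinct (seg P a b)"
    unfolding seg_def distinct_map using assms is_path_nth_eq[OF assms(1)]
    by (auto simp: inj_on_def simp del: upt_Suc)
  moreover have "adj G (seg P a b ! i) (seg P a b ! j) \<longleftrightarrow> j = Suc i \<or> i = Suc j"
    if "i < Suc b - a" "j < Suc b - a" for i j
    using that assms(2,3) is_path_adj[OF assms(1), of "a + i" "a + j"] by (simp add: seg_nth)
  moreover have "set (seg P a b) \<subseteq> verts G"
    unfolding set_seg using is_path_nth_verts[OF assms(1)] assms(3) by auto
  ultimately show ?thesis unfolding is_path_def using seg_not_Nil[OF assms(2)] by simp
qed

lemma is_path_join:
  assumes "graph G" "is_path G xs" "is_path G ys" "t \<in> verts G" "t \<notin> set xs" "t \<notin> set ys"
    "set xs \<inter> set ys = {}"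
    "\<And>x. x \<in> set xs \<Longrightarrow> adj G t x \<longleftrightarrow> x = last xs" "\<And>y. y \<in> set ys \<Longrightarrow> adj G t y \<longleftrightarrow> y = hd ys"
    "\<And>x y. x \<in> set xs \<Longrightarrow> y \<in> set ys \<Longrightarrow> \<not> adj G x y"
  shows "is_path G (xs @ t # ys)"
proof -
  have ne: "xs \<noteq> []" "ys \<noteq> []" using assms unfolding is_path_def by auto
  have "is_path G (t # ys)" using is_path_Cons[OF assms(1) ne(2)] assms by blast
  then show ?thesis
    using is_path_append[OF assms(1), of "t # ys" xs] ne assms adj_sym[OF assms(1), of _ t] hd_in_set[OF ne(2)]
    by auto
qed

text \<open>The conclusion of the Roussel--Rubio lemma for \<open>X\<close>, with the leap left out.
  \<open>length\<close> counts vertices: an even count is odd path length, and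
  \<open>length P = 4\<close> is length 3. The second alternative is an odd antipath through
  \<open>X\<close> between the two inner vertices.\<close>

definition rr :: "'a graph \<Rightarrow> 'a set \<Rightarrow> bool" where
  "rr G X \<longleftrightarrow> (\<forall>P. is_path G P \<and> even (length P) \<and> set P \<inter> X = {} \<and> complete G (hd P) X \<and> complete G (last P) X
     \<longrightarrow> (\<exists>i. Suc i < length P \<and> complete G (P!i) X \<and> complete G (P!Suc i) X)
       \<or> (length P = 4 \<and> oddp (compl G) (P!1) (P!2) X))"

lemma rr_odd:
  assumes "rr G T" "is_path G R" "even (length R)" "length R \<ge> 4" "set R \<inter> T = {}"
    "complete G (hd R) T" "complete G (last R) T"
    "\<And>z. z \<in> set R \<Longrightarrow> complete G z T \<Longrightarrow> z = hd R \<or> z = last R"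
  shows "length R = 4 \<and> oddp (compl G) (R!1) (R!2) T"
proof (rule ccontr)
  assume "\<not> ?thesis"
  then obtain i where i: "Suc i < length R" "complete G (R!i) T" "complete G (R!Suc i) T"
    using assms unfolding rr_def by blast
  have "R \<noteq> []" using assms(4) by auto
  then have "hd R = R ! 0" "last R = R ! (length R - 1)" by (simp_all add: hd_conv_nth last_conv_nth)
  then have "R!k = R!0 \<or> R!k = R!(length R - 1)" if "k < length R" "complete G (R!k) T" for k
    using assms(8)[OF nth_mem] that by metis
  then have "k = 0 \<or> k = length R - 1" if "k < length R" "complete G (R!k) T" for k
    using is_path_nth_eq[OF assms(2), of k 0] is_path_nth_eq[OF assms(2), of k "length R - 1"] that \<open>R \<noteq> []\<close> by auto
  then have "i = 0 \<or> i = length R - 1" "Suc i = 0 \<or> Suc i = length R - 1" using i by auto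
  then show False using i assms(4) by linarith
qed

lemma anti_close:
  assumes "berge G" "graph G" "oddp (compl G) x y X" "z \<in> verts G" "z \<noteq> x" "z \<noteq> y" "\<not> adj G z x" "\<not> adj G z y"
    "complete G z X" "x \<in> verts G" "y \<in> verts G"
  shows False
proof (rule oddp_close[of "compl G" x y X z])
  show "z \<notin> X" using assms(2,9) adj_irrefl unfolding complete_def by fastforce
qed (use assms in \<open>auto simp: berge_compl graph_compl adj_compl complete_def\<close>)

text \<open>With no complete vertices except its ends, \<open>R\<close> must fall under the
  exceptional alternative of \<open>rr\<close>. The vertex \<open>z\<close> is complete to
  \<open>T\<close> and misses both inner vertices of \<open>R\<close>, so it closes the resulting
  odd antipath to an odd antihole.\<close>

lemma rr_contra:
  assumes "graph G" "berge G" "rr G T" "is_path G R" "even (length R)" "length R \<ge> 4" "set R \<inter> T = {}"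
    "complete G (hd R) T" "complete G (last R) T"
    "\<And>z. z \<in> set R \<Longrightarrow> complete G z T \<Longrightarrow> z = hd R \<or> z = last R"
    and z: "z \<in> verts G" "complete G z T" "\<And>r. r \<in> set R \<Longrightarrow> r \<noteq> hd R \<Longrightarrow> r \<noteq> last R \<Longrightarrow> r \<noteq> z \<and> \<not> adj G z r"
  shows False
proof -
  have o: "length R = 4" "oddp (compl G) (R!1) (R!2) T" using rr_odd[of G T R] assms by blast+
  have "R \<noteq> []" using assms(6) by auto
  then have h: "hd R = R ! 0" "last R = R ! 3" using o by (simp_all add: hd_conv_nth last_conv_nth)
  have "R!1 \<noteq> hd R" "R!1 \<noteq> last R" "R!2 \<noteq> hd R" "R!2 \<noteq> last R"
    unfolding h using is_path_nth_eq[OF assms(4)] o(1) by simp_all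
  moreover have "R!1 \<in> set R" "R!2 \<in> set R" using o(1) by simp_all
  ultimately show False
    using anti_close[OF assms(2,1) o(2) z(1)] z(2) z(3)[of "R!1"] z(3)[of "R!2"] assms(4)
    unfolding is_path_def by blast
qed

section \<open>Gaps between marked positions\<close>

lemma last_below:
  fixes Q :: "nat \<Rightarrow> bool"
  assumes "Q a" "a < b"
  obtains k where "a \<le> k" "k < b" "Q k" "\<And>j. k < j \<Longrightarrow> j < b \<Longrightarrow> \<not> Q j"
proof -
  let ?S = "{k. Q k \<and> k < b}"
  have f: "finite ?S" by simp
  have "Max ?S \<in> ?S" by (rule Max_in[OF f]) (use assms in auto)
  moreover have "j \<le> Max ?S" if "Q j" "j < b" for j by (rule Max_ge[OF f]) (use that in auto)
  ultimately show ?thesis using that[of "Max ?S"] assms leD by blast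
qed

lemma first_above:
  fixes Q :: "nat \<Rightarrow> bool"
  assumes "Q b" "a < b"
  obtains k where "a < k" "k \<le> b" "Q k" "\<And>j. a < j \<Longrightarrow> j < k \<Longrightarrow> \<not> Q j"
proof -
  let ?k = "LEAST k. a < k \<and> Q k"
  have "a < ?k \<and> Q ?k" by (rule LeastI[of "\<lambda>k. a < k \<and> Q k" b]) (use assms in auto)
  moreover have "?k \<le> b" by (rule Least_le) (use assms in auto)
  moreover have "\<not> Q j" if "a < j" "j < ?k" for j using not_less_Least[OF that(2)] that(1) by blast
  ultimately show ?thesis using that by blast
qed

text \<open>Distances add, so a marked point inside an odd interval splits it into two parts of
  which one is again odd.\<close>

lemma odd_gap:
  fixes D :: "nat \<Rightarrow> bool"
  assumes "D a" "D b" "a < b" "odd (b - a)"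
  shows "\<exists>c d. a \<le> c \<and> c < d \<and> d \<le> b \<and> D c \<and> D d \<and> odd (d - c) \<and> (\<forall>k. c < k \<and> k < d \<longrightarrow> \<not> D k)"
  using assms
proof (induction "b - a" arbitrary: a b rule: less_induct)
  case less
  show ?case
  proof (cases "\<exists>k. a < k \<and> k < b \<and> D k")
    case True
    then obtain k where k: "a < k" "k < b" "D k" by blast
    have "b - a = (b - k) + (k - a)" using k by simp
    then consider "odd (k - a)" | "odd (b - k)" using less.prems(4) by (metis even_add)
    then show ?thesis
    proof cases
      case 1
      then obtain c d where "a \<le> c \<and> c < d \<and> d \<le> k \<and> D c \<and> D d \<and> odd (d - c) \<and> (\<forall>k. c < k \<and> k < d \<longrightarrow> \<not> D k)"
        using less.hyps[of k a] k less.prems by (metis diff_less_mono less_imp_le)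
      then show ?thesis using k by (intro exI[of _ c] exI[of _ d]) simp
    next
      case 2
      then obtain c d where "k \<le> c \<and> c < d \<and> d \<le> b \<and> D c \<and> D d \<and> odd (d - c) \<and> (\<forall>k. c < k \<and> k < d \<longrightarrow> \<not> D k)"
        using less.hyps[of b k] k less.prems by (metis diff_less_mono2 less_trans)
      then show ?thesis using k by (intro exI[of _ c] exI[of _ d]) simp
    qed
  next
    case False
    then show ?thesis using less.prems by blast
  qed
qed

section \<open>Paths of length at least 5 whose inner vertices are not complete to
  \<open>X\<close>\<close>

locale rr_path =
  fixes G :: "'a graph" and P :: "'a list" and X :: "'a set"
  assumes gr: "graph G" and bg: "berge G" and path: "is_path G P" and even_len: "even (length P)"
    and len: "length P \<ge> 6" and disj: "set P \<inter> X = {}" and XV: "X \<subseteq> verts G"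
    and ends: "complete G (P!0) X" "complete G (P!(length P - 1)) X"
    and inner: "\<And>i. 0 < i \<Longrightarrow> i < length P - 1 \<Longrightarrow> \<not> complete G (P!i) X"
begin

abbreviation "n \<equiv> length P"

lemma nth_notin: "i < n \<Longrightarrow> P!i \<notin> X"
  using disj nth_mem by blast

lemmas adjP = is_path_adj[OF path]
lemmas eqP = is_path_nth_eq[OF path]
lemmas inV = is_path_nth_verts[OF path]

text \<open>The exceptional outcome of \<open>rr\<close> would need a stretch of four vertices. As
  \<open>P\<close> has at least six, one end of \<open>P\<close> lies beyond that stretch; it is
  complete to \<open>T\<close> and misses the two inner vertices, so it turns the odd antipath into
  an odd antihole.\<close>

lemma complete_edge:
  assumes "T \<subseteq> X" "rr G T" "c < d" "d < n" "complete G (P!c) T" "complete G (P!d) T" "odd (d - c)"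
  obtains e where "c \<le> e" "e < d" "complete G (P!e) T" "complete G (P!Suc e) T"
proof -
  let ?R = "seg P c d"
  have R: "is_path G ?R" by (rule is_path_seg[OF path]) (use assms in auto)
  have "even (length ?R)" using assms by simp
  moreover have "set ?R \<inter> T = {}" using assms nth_notin unfolding set_seg by auto
  moreover have "complete G (hd ?R) T" "complete G (last ?R) T" using assms by (simp_all add: hd_seg last_seg)
  ultimately have "(\<exists>i. Suc i < length ?R \<and> complete G (?R!i) T \<and> complete G (?R!Suc i) T)
      \<or> (length ?R = 4 \<and> oddp (compl G) (?R!1) (?R!2) T)"
    using R assms(2) unfolding rr_def by blast
  then show ?thesis
  proof
    assume "\<exists>i. Suc i < length ?R \<and> complete G (?R!i) T \<and> complete G (?R!Suc i) T"
    then obtain i where "Suc i < Suc d - c" "complete G (P!(c+i)) T" "complete G (P!Suc (c+i)) T"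
      by (auto simp: seg_nth)
    then show ?thesis using that[of "c + i"] by auto
  next
    assume "length ?R = 4 \<and> oddp (compl G) (?R!1) (?R!2) T"
    then have d: "d = c + 3" and o: "oddp (compl G) (P!(c+1)) (P!(c+2)) T" by (auto simp: seg_nth)
    have mono: "complete G (P!0) T" "complete G (P!(n-1)) T" using ends assms(1) unfolding complete_def by auto
    obtain z where z: "z = 0 \<or> z = n - 1" "z < c \<or> d < z" using d len by (cases "c = 0") auto
    then have "z < n" using len by auto
    then have False
      using anti_close[OF bg gr o inV[of z]] adjP[of z] eqP[of z] z mono assms(4) d inV by auto
    then show ?thesis ..
  qed
qed

lemma complete_gap_even:
  assumes "T \<subseteq> X" "rr G T" "c < d" "d < n" "complete G (P!c) T" "complete G (P!d) T"
    "\<And>k. c < k \<Longrightarrow> k < d \<Longrightarrow> \<not> complete G (P!k) T" "d \<noteq> Suc c"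
  shows "even (d - c)"
proof (rule ccontr)
  assume "odd (d - c)"
  then obtain e where e: "c \<le> e" "e < d" "complete G (P!e) T" "complete G (P!Suc e) T"
    using complete_edge[OF assms(1-6)] by blast
  then show False using assms(7)[of e] assms(7)[of "Suc e"] assms(8) by (cases "e = c") auto
qed

lemma ne: "P \<noteq> []"
  using len by auto

lemma t_notin: "t \<in> X \<Longrightarrow> t \<notin> set P"
  using disj by blast

lemma complete_inner:
  assumes "t \<in> X" "0 < i" "i < n - 1" "complete G (P!i) (X - {t})"
  shows "\<not> adj G t (P!i)"
  using inner[OF assms(2,3)] assms(1,4) adj_sym[OF gr] unfolding complete_def by blast

lemma ends_adj: "t \<in> X \<Longrightarrow> adj G t (P!0)" "t \<in> X \<Longrightarrow> adj G t (P!(n-1))"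
  using ends adj_sym[OF gr] unfolding complete_def by blast+

lemma ends_complete: "T \<subseteq> X \<Longrightarrow> complete G (P!0) T" "T \<subseteq> X \<Longrightarrow> complete G (P!(n-1)) T"
  using ends unfolding complete_def by blast+

text \<open>Here \<open>a\<close>, \<open>b\<close> are consecutive neighbours of \<open>t\<close>
  on \<open>P\<close>, and \<open>c\<close>, \<open>d\<close> the first and last positions between
  them that are complete to \<open>X - {t}\<close>. If \<open>d - c\<close> were odd, a detour
  through \<open>t\<close> would be a path of odd length with only its ends complete to
  \<open>X - {t}\<close>, and a complete vertex off the detour would contradict
  \<open>rr_contra\<close>.\<close>

lemma gap_even:
  assumes t: "t \<in> X" "rr G (X - {t})" "\<not> complete G t (X - {t})"
    and p: "\<not> complete G (P!1) (X - {t})" "\<not> complete G (P!(n-2)) (X - {t})"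
    and ab: "a < b" "b < n" "adj G t (P!a)" "adj G t (P!b)" "\<And>k. a < k \<Longrightarrow> k < b \<Longrightarrow> \<not> adj G t (P!k)"
    and cd: "a \<le> c" "c \<le> d" "d \<le> b" "complete G (P!c) (X - {t})" "complete G (P!d) (X - {t})"
      "\<And>k. a \<le> k \<Longrightarrow> k < c \<Longrightarrow> \<not> complete G (P!k) (X - {t})"
      "\<And>k. d < k \<Longrightarrow> k \<le> b \<Longrightarrow> \<not> complete G (P!k) (X - {t})"
  shows "even (d - c)"
proof (rule ccontr)
  assume odd: "odd (d - c)"
  let ?T = "X - {t}"
  have TX: "?T \<subseteq> X" by blast
  have c_d: "c < d" using odd by (cases "c < d") auto
  have tV: "t \<in> verts G" using t XV by blast
  have nb: "adj G t (P!i) \<longleftrightarrow> i = a \<or> i = b" if "a \<le> i" "i \<le> b" for i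
    using that ab by (metis le_neq_implies_less)
  have both: "i = 0 \<or> i = n - 1" if "complete G (P!i) ?T" "adj G t (P!i)" "i < n" for i
    using complete_inner[OF t(1)] that by (cases "0 < i \<and> i < n - 1") auto
  have notS: "b \<noteq> Suc a"
  proof
    assume s: "b = Suc a"
    then have "c = a" "d = b" using cd c_d by auto
    then have "a = 0 \<or> a = n - 1" "b = 0 \<or> b = n - 1" using both[of a] both[of b] cd ab by auto
    then show False using s ab len by linarith
  qed
  \<comment> \<open>\<open>t\<close> closes the stretch from \<open>a\<close> to \<open>b\<close> to
    a hole, which makes \<open>b - a\<close> even.\<close>
  have "odd (length (seg P a b))"
    by (rule berge_close1[OF bg gr tV is_path_seg[OF path]])
      (use ab notS nb t_notin[OF t(1)] eqP in \<open>auto simp: hd_seg last_seg set_seg\<close>)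
  then have evab: "even (b - a)" using ab by (simp add: Suc_diff_le)
  show False
  proof (cases "d = Suc c")
    case False
    then have d3: "c + 3 \<le> d" using c_d odd by (cases "d = c + 2") auto
    obtain e where e: "c < e" "e < d" "complete G (P!e) ?T"
    proof -
      obtain e where "c \<le> e" "e < d" "complete G (P!e) ?T" "complete G (P!Suc e) ?T"
        using complete_edge[OF TX t(2) c_d _ cd(4,5) odd] ab cd by auto
      then show ?thesis using that[of e] that[of "Suc e"] d3 by (cases "e = c") auto
    qed
    \<comment> \<open>The detour goes from \<open>P!c\<close> back to \<open>P!a\<close>, through
      \<open>t\<close> to \<open>P!b\<close>, and back to \<open>P!d\<close>. It avoids everything
      strictly between \<open>c\<close> and \<open>d\<close>, where \<open>P!e\<close> serves as the
      extra complete vertex.\<close>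
    let ?xs = "rev (seg P a c)" and ?ys = "rev (seg P d b)"
    let ?R = "?xs @ t # ?ys"
    have h: "hd ?xs = P!c" "last ?xs = P!a" "hd ?ys = P!b" "last ?ys = P!d"
      using cd by (simp_all add: hd_rev last_rev hd_seg last_seg)
    have ne: "?xs \<noteq> []" "?ys \<noteq> []" using cd by (simp_all add: seg_not_Nil)
    have R: "is_path G ?R"
    proof (rule is_path_join[OF gr _ _ tV])
      show "is_path G ?xs" "is_path G ?ys" using cd ab is_path_seg[OF path] by simp_all
      show "t \<notin> set ?xs" "t \<notin> set ?ys" using t_notin[OF t(1)] cd ab by (auto simp: set_seg)
      show "set ?xs \<inter> set ?ys = {}" using eqP cd ab d3 by (auto simp: set_seg)
      show "adj G t x \<longleftrightarrow> x = last ?xs" if "x \<in> set ?xs" for x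
        using that nb cd ab d3 eqP unfolding h by (auto simp: set_seg)
      show "adj G t x \<longleftrightarrow> x = hd ?ys" if "x \<in> set ?ys" for x
        using that nb cd ab d3 eqP unfolding h by (auto simp: set_seg)
      show "\<not> adj G x y" if "x \<in> set ?xs" "y \<in> set ?ys" for x y
        using that adjP cd ab d3 by (auto simp: set_seg)
    qed
    have hR: "hd ?R = P!c" "last ?R = P!d" using h ne by (simp_all del: rev_is_Nil_conv)
    have setR: "set ?R = insert t (nth P ` ({a..c} \<union> {d..b}))" by (auto simp: set_seg)
    have lR: "length ?R = (b - a) + 3 - (d - c)" using cd ab by simp
    have "(d - c) + length ?R = (b - a) + 3" using cd lR by linarith
    then have evR: "even (length ?R)" using evab odd by (metis even_add even_numeral odd_numeral)
    have "length ?R \<ge> 3" using cd by simp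
    then have l4: "length ?R \<ge> 4" using evR by (cases "length ?R = 3") (simp_all del: length_append length_rev length_seg)
    show False
    proof (rule rr_contra[OF gr bg t(2) R evR l4])
      show "set ?R \<inter> ?T = {}" unfolding setR using nth_notin cd ab by auto
      show "complete G (hd ?R) ?T" "complete G (last ?R) ?T" unfolding hR using cd by simp_all
      show "z = hd ?R \<or> z = last ?R" if "z \<in> set ?R" "complete G z ?T" for z
        using that cd t(3) unfolding hR setR by (auto; metis le_neq_implies_less)
      show "P!e \<in> verts G" "complete G (P!e) ?T" using e inV cd ab by auto
      show "r \<noteq> P!e \<and> \<not> adj G (P!e) r" if r: "r \<in> set ?R" "r \<noteq> hd ?R" "r \<noteq> last ?R" for r
      proof (cases "r = t")
        case True
        have "e < n" using e cd ab by simp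
          then have "t \<noteq> P!e" using t_notin[OF t(1)] nth_mem by blast
          moreover have "\<not> adj G t (P!e)" using nb[of "e"] e cd ab by simp
          ultimately show ?thesis using True adj_sym[OF gr, of t "P!e"] by simp
      next
        case False
        then obtain i where i: "r = P!i" "i \<in> {a..c} \<union> {d..b}" using r(1) setR by auto
        then have "i < c \<or> i > d" using r unfolding hR by (auto simp: le_less)
        then show ?thesis using i adjP[of e i] eqP[of e i] e cd ab by auto
      qed
    qed
  next
    case d: True
    have "c \<noteq> 0" using cd(5) d p(1) by (intro notI) simp
    moreover have "Suc c \<noteq> n - 1"
    proof
      assume "Suc c = n - 1"
      then have "c = n - 2" by simp
      then show False using cd p by simp
    qed
    ultimately have c: "0 < c" "Suc c < n - 1" using cd ab d by auto
    have ac: "a < c" using complete_inner[OF t(1), of c] c cd ab by (cases "a = c") auto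
    have cb: "Suc c < b" using complete_inner[OF t(1), of "Suc c"] c cd ab d by (cases "Suc c = b") auto
    have only: "k = c \<or> k = Suc c" if "a \<le> k" "k \<le> b" "complete G (P!k) ?T" for k
      using cd(6)[of k] cd(7)[of k] that d by (metis not_less_eq not_less_less_Suc_eq)
    have bn: "b < n - 1" using only[of b] ends_complete[OF TX] cb ab by (cases "b = n - 1") auto
    have "(b - a) + 3 = (c - a + 3) + (b - c)" using ac cb by simp
    then consider "even (c - a + 3)" | "even (b - c + 2)" using evab by fastforce
    then show False
    proof cases
      case 1
      let ?xs = "rev (seg P a c)" and ?ys = "[P!(n-1)]"
      let ?R = "?xs @ t # ?ys"
      have h: "hd ?xs = P!c" "last ?xs = P!a" using cd by (simp_all add: hd_rev last_rev hd_seg last_seg)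
      have R: "is_path G ?R"
      proof (rule is_path_join[OF gr _ _ tV])
        show "is_path G ?xs" using c ac is_path_seg[OF path] by simp
        show "is_path G ?ys" using gr inV[of "n - 1"] len by simp
        show "t \<notin> set ?xs" "t \<notin> set ?ys" using t_notin[OF t(1)] c len by (auto simp: set_seg)
        show "set ?xs \<inter> set ?ys = {}" using eqP c by (auto simp: set_seg)
        show "adj G t x \<longleftrightarrow> x = last ?xs" if "x \<in> set ?xs" for x
          using that nb c cb eqP unfolding h by (auto simp: set_seg)
        show "adj G t x \<longleftrightarrow> x = hd ?ys" if "x \<in> set ?ys" for x
          using that ends_adj[OF t(1)] by auto
        show "\<not> adj G x y" if "x \<in> set ?xs" "y \<in> set ?ys" for x y
          using that adjP c by (auto simp: set_seg)
      qed
      have hR: "hd ?R = P!c" "last ?R = P!(n-1)" using h ac by (simp_all add: seg_not_Nil)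
      have setR: "set ?R = insert t (insert (P!(n-1)) (nth P ` {a..c}))" by (auto simp: set_seg)
      have lR: "length ?R = c - a + 3" using ac by simp
      show False
      proof (rule rr_contra[OF gr bg t(2) R])
        show "even (length ?R)" "length ?R \<ge> 4" using lR 1 ac by auto
        show "set ?R \<inter> ?T = {}" unfolding setR using nth_notin c by auto
        show "complete G (hd ?R) ?T" "complete G (last ?R) ?T" unfolding hR using cd ends_complete[OF TX] by simp_all
        show "z = hd ?R \<or> z = last ?R" if "z \<in> set ?R" "complete G z ?T" for z
        proof -
          consider "z = t" | "z = P!(n-1)" | i where "z = P!i" "a \<le> i" "i \<le> c"
            using \<open>z \<in> set ?R\<close> unfolding setR by auto
          then show ?thesis
          proof cases
            case (3 i)
            then have "i = c" using only[of i] that cb by auto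
            then show ?thesis using 3 hR by simp
          qed (use that t(3) hR in auto)
        qed
        show "P!Suc c \<in> verts G" "complete G (P!Suc c) ?T" using c inV cd d by auto
        show "r \<noteq> P!Suc c \<and> \<not> adj G (P!Suc c) r" if r: "r \<in> set ?R" "r \<noteq> hd ?R" "r \<noteq> last ?R" for r
        proof (cases "r = t")
          case True
          have "Suc c < n" using c ac cb by simp
          then have "t \<noteq> P!Suc c" using t_notin[OF t(1)] nth_mem by blast
          moreover have "\<not> adj G t (P!Suc c)" using nb[of "Suc c"] c ac cb by simp
          ultimately show ?thesis using True adj_sym[OF gr, of t "P!Suc c"] by simp
        next
          case False
          then obtain i where i: "r = P!i" "i \<in> {a..c}" using r unfolding hR setR by blast
          then have "i \<noteq> c" using r(2) unfolding hR by auto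
          then have i: "r = P!i" "a \<le> i" "i < c" using i by auto
          have l: "Suc c < n" "i < n" using c i by auto
          show ?thesis unfolding i(1) using adjP[OF l] eqP[OF l(2,1)] i(2-) by auto
        qed
      qed
    next
      case 2
      let ?xs = "seg P (Suc c) b" and ?ys = "[P!0]"
      let ?R = "?xs @ t # ?ys"
      have e0: "P!i \<noteq> P!0 \<and> \<not> adj G (P!i) (P!0)" if "Suc c \<le> i" "i \<le> b" for i
        using eqP[of i 0] adjP[of i 0] c bn ne that by simp
      have h: "hd ?xs = P!Suc c" "last ?xs = P!b" using cb by (simp_all add: hd_seg last_seg)
      have R: "is_path G ?R"
      proof (rule is_path_join[OF gr _ _ tV])
        show "is_path G ?xs" using cb bn is_path_seg[OF path] by simp
        show "is_path G ?ys" using gr inV[of 0] ne by simp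
        show "t \<notin> set ?xs" "t \<notin> set ?ys" using t_notin[OF t(1)] bn nth_mem[of 0 P] ne by (auto simp: set_seg)
        show "set ?xs \<inter> set ?ys = {}" using e0 by (force simp: set_seg)
        show "adj G t x \<longleftrightarrow> x = last ?xs" if "x \<in> set ?xs" for x
          using that nb ac cb bn eqP unfolding h by (auto simp: set_seg)
        show "adj G t x \<longleftrightarrow> x = hd ?ys" if "x \<in> set ?ys" for x
          using that ends_adj[OF t(1)] by auto
        show "\<not> adj G x y" if "x \<in> set ?xs" "y \<in> set ?ys" for x y
          using that e0 by (auto simp: set_seg)
      qed
      have hR: "hd ?R = P!Suc c" "last ?R = P!0" using h cb by (simp_all add: seg_not_Nil)
      have setR: "set ?R = insert t (insert (P!0) (nth P ` {Suc c..b}))" by (auto simp: set_seg)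
      have lR: "length ?R = b - c + 2" using cb by simp
      show False
      proof (rule rr_contra[OF gr bg t(2) R])
        show "even (length ?R)" "length ?R \<ge> 4" using lR 2 cb by auto
        show "set ?R \<inter> ?T = {}" unfolding setR using nth_notin nth_notin[of 0] ne bn by auto
        show "complete G (hd ?R) ?T" "complete G (last ?R) ?T" unfolding hR using cd d ends_complete[OF TX] by simp_all
        show "z = hd ?R \<or> z = last ?R" if "z \<in> set ?R" "complete G z ?T" for z
        proof -
          consider "z = t" | "z = P!0" | i where "z = P!i" "Suc c \<le> i" "i \<le> b"
            using \<open>z \<in> set ?R\<close> unfolding setR by auto
          then show ?thesis
          proof cases
            case (3 i)
            then have "i = Suc c" using only[of i] that ac by auto
            then show ?thesis using 3 hR by simp
          qed (use that t(3) hR in auto)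
        qed
        show "P!c \<in> verts G" "complete G (P!c) ?T" using c inV cd by auto
        show "r \<noteq> P!c \<and> \<not> adj G (P!c) r" if r: "r \<in> set ?R" "r \<noteq> hd ?R" "r \<noteq> last ?R" for r
        proof (cases "r = t")
          case True
          have "c < n" using c ac cb bn by simp
          then have "t \<noteq> P!c" using t_notin[OF t(1)] nth_mem by blast
          moreover have "\<not> adj G t (P!c)" using nb[of "c"] c ac cb by simp
          ultimately show ?thesis using True adj_sym[OF gr, of t "P!c"] by simp
        next
          case False
          then obtain i where i: "r = P!i" "i \<in> {Suc c..b}" using r unfolding hR setR by blast
          then have "i \<noteq> Suc c" using r(2) unfolding hR by auto
          then have i: "r = P!i" "Suc c < i" "i \<le> b" using i by auto
          have l: "c < n" "i < n" using c bn i by auto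
          show ?thesis unfolding i(1) using adjP[OF l] eqP[OF l(2,1)] i(2-) by auto
        qed
      qed
    qed
  qed
qed

text \<open>If both fail, \<open>gap_even\<close> applies to every pair of consecutive neighbours of
  \<open>t\<close>. Its even stretches, and the even gaps between complete vertices across a
  neighbour of \<open>t\<close>, add up from one end of \<open>P\<close> to the other, contradicting
  the odd length of \<open>P\<close>.\<close>

lemma hat:
  assumes t: "t \<in> X" "rr G (X - {t})" "\<not> complete G t (X - {t})"
  shows "complete G (P!1) (X - {t}) \<or> complete G (P!(n-2)) (X - {t})"
proof (rule ccontr)
  let ?T = "X - {t}"
  assume "\<not> ?thesis"
  then have p: "\<not> complete G (P!1) ?T" "\<not> complete G (P!(n-2)) ?T" by auto
  have TX: "?T \<subseteq> X" by blast
  define C where "C i \<longleftrightarrow> complete G (P!i) ?T" for i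
  define N where "N i \<longleftrightarrow> adj G t (P!i)" for i
  have C0: "C 0" "C (n-1)" unfolding C_def using ends_complete[OF TX] by auto
  have N0: "N 0" "N (n-1)" unfolding N_def using ends_adj[OF t(1)] by auto
  have CN: "\<not> C i" if "N i" "0 < i" "i < n - 1" for i
    using complete_inner[OF t(1), of i] that unfolding C_def N_def by blast
  have gap: "even (d - c)" if "a < b" "b < n" "N a" "N b" "\<And>k. a < k \<Longrightarrow> k < b \<Longrightarrow> \<not> N k"
    "a \<le> c" "c \<le> d" "d \<le> b" "C c" "C d" "\<And>k. a \<le> k \<Longrightarrow> k < c \<Longrightarrow> \<not> C k" "\<And>k. d < k \<Longrightarrow> k \<le> b \<Longrightarrow> \<not> C k"
    for a b c d
    using gap_even[OF t p, of a b c d] that unfolding C_def N_def by blast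
  have ev: "even (d - c)" if "c < d" "d < n" "C c" "C d" "\<And>k. c < k \<Longrightarrow> k < d \<Longrightarrow> \<not> C k" "d \<noteq> Suc c" for c d
    using complete_gap_even[OF TX t(2), of c d] that unfolding C_def by blast
  \<comment> \<open>The invariant of the count: the last complete position before any inner
    neighbour of \<open>t\<close> is even. A gap running across a neighbour of \<open>t\<close> has
    size at least 2, so \<open>ev\<close> applies to it.\<close>
  have main: "\<exists>d<b. C d \<and> even d \<and> (\<forall>k. d < k \<and> k \<le> b \<longrightarrow> \<not> C k)" if "N b" "0 < b" "b < n - 1" for b
    using that
  proof (induction b rule: less_induct)
    case (less b)
    have nCb: "\<not> C b" using CN less.prems by blast
    obtain a where a: "a < b" "N a" "\<And>k. a < k \<Longrightarrow> k < b \<Longrightarrow> \<not> N k"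
      using last_below[of N 0 b] N0 less.prems by blast
    show ?case
    proof (cases "a = 0")
      case True
      obtain d where d: "d < b" "C d" "\<And>k. d < k \<Longrightarrow> k < b \<Longrightarrow> \<not> C k"
        using last_below[of C 0 b] C0 less.prems by blast
      have dl: "\<not> C k" if "d < k" "k \<le> b" for k using d(3) nCb that by (cases "k = b") auto
      have "even (d - 0)" by (rule gap[of a b 0 d]) (use True a d less.prems C0 N0 dl in auto)
      then show ?thesis using d dl by auto
    next
      case False
      then obtain d0 where d0: "d0 < a" "C d0" "even d0" "\<forall>k. d0 < k \<and> k \<le> a \<longrightarrow> \<not> C k"
        using less.IH[of a] a less.prems by auto
      show ?thesis
      proof (cases "\<exists>k. a < k \<and> k < b \<and> C k")
        case True
        then obtain k where k: "a < k" "k < b" "C k" by blast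
        obtain c where c: "a < c" "c \<le> k" "C c" "\<And>j. a < j \<Longrightarrow> j < c \<Longrightarrow> \<not> C j"
          using first_above[of C k a] k by blast
        obtain d where d: "c \<le> d" "d < b" "C d" "\<And>k. d < k \<Longrightarrow> k < b \<Longrightarrow> \<not> C k"
          using last_below[of C c b] c k by auto
        have dl: "\<not> C k" if "d < k" "k \<le> b" for k using d(4) nCb that by (cases "k = b") auto
        have cl: "\<not> C j" if "d0 < j" "j < c" for j using d0 c(4) that by (cases "j \<le> a") auto
        have "even (d - c)" by (rule gap[of a b c d]) (use a c d less.prems dl cl d0 in auto)
        moreover have "even (c - d0)" by (rule ev) (use a c d d0 less.prems cl in auto)
        moreover have "d = (d - c) + (c - d0) + d0" using c d d0 by simp
        ultimately have "even d" using d0(3) by (metis even_add)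
        then show ?thesis using d dl by auto
      next
        case False
        then have "\<not> C k" if "d0 < k" "k \<le> b" for k
          using d0 nCb that by (metis le_neq_implies_less not_le)
        then show ?thesis using d0 a by (intro exI[of _ d0]) auto
      qed
    qed
  qed
  have n1: "0 < n - 1" using len by simp
  obtain a where a: "a < n - 1" "N a" "\<And>k. a < k \<Longrightarrow> k < n - 1 \<Longrightarrow> \<not> N k"
    using last_below[of N 0 "n - 1"] N0 n1 by blast
  have "even (n - 1)"
  proof (cases "a = 0")
    case True
    have "even (n - 1 - 0)" by (rule gap[of a "n-1" 0 "n-1"]) (use True a C0 N0 len in auto)
    then show ?thesis by simp
  next
    case False
    then obtain d0 where d0: "d0 < a" "C d0" "even d0" "\<forall>k. d0 < k \<and> k \<le> a \<longrightarrow> \<not> C k"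
      using main[of a] a by auto
    obtain c where c: "a < c" "c \<le> n - 1" "C c" "\<And>j. a < j \<Longrightarrow> j < c \<Longrightarrow> \<not> C j"
      using first_above[of C "n-1" a] C0 a by blast
    have cl: "\<not> C j" if "d0 < j" "j < c" for j using d0 c(4) that by (cases "j \<le> a") auto
    have "even (n - 1 - c)" by (rule gap[of a "n-1" c "n-1"]) (use a c C0 N0 cl d0 len in auto)
    moreover have "even (c - d0)" by (rule ev) (use a c d0 cl in auto)
    moreover have "n - 1 = (n - 1 - c) + (c - d0) + d0" using c d0 by simp
    ultimately show ?thesis using d0(3) by (metis even_add)
  qed
  then show False using even_len len by simp
qed

end

text \<open>Let \<open>h\<close> be the last \<open>B\<close>-mark before \<open>i\<close>. Then
  \<open>j - h\<close> is a \<open>B\<close>-gap of size at least 2, hence even, and so is the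
  colour change \<open>j - i\<close>; thus \<open>i\<close> and \<open>h\<close> have equal parity.
  Either \<open>h = 0\<close>, or a colour change starts at \<open>h\<close> with the roles of
  \<open>A\<close> and \<open>B\<close> exchanged, and induction applies.\<close>

lemma two_colour_aux:
  fixes A B :: "nat \<Rightarrow> bool"
  assumes "A 0" "B 0"
    and "\<And>i. 0 < i \<Longrightarrow> i < m \<Longrightarrow> \<not> (A i \<and> B i)"
    and "\<And>i j. i < j \<Longrightarrow> j \<le> m \<Longrightarrow> A i \<Longrightarrow> A j \<Longrightarrow> (\<And>k. i < k \<Longrightarrow> k < j \<Longrightarrow> \<not> A k) \<Longrightarrow> j \<noteq> Suc i \<Longrightarrow> even (j - i)"
    and "\<And>i j. i < j \<Longrightarrow> j \<le> m \<Longrightarrow> B i \<Longrightarrow> B j \<Longrightarrow> (\<And>k. i < k \<Longrightarrow> k < j \<Longrightarrow> \<not> B k) \<Longrightarrow> j \<noteq> Suc i \<Longrightarrow> even (j - i)"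
    and "\<And>i j. 0 < i \<Longrightarrow> i < j \<Longrightarrow> j < m \<Longrightarrow> A i \<and> B j \<or> B i \<and> A j \<Longrightarrow> (\<And>k. i < k \<Longrightarrow> k < j \<Longrightarrow> \<not> A k \<and> \<not> B k) \<Longrightarrow> even (j - i)"
    and "0 < i" "i < j" "j < m" "A i" "B j" "\<And>k. i < k \<Longrightarrow> k < j \<Longrightarrow> \<not> A k \<and> \<not> B k"
  shows "even i"
  using assms
proof (induction i arbitrary: A B j rule: less_induct)
  case (less i A B j)
  note AB = less.prems
  obtain h where h: "h < i" "B h" "\<And>k. h < k \<Longrightarrow> k < i \<Longrightarrow> \<not> B k"
    using last_below[of B 0 i, OF AB(2,7)] by blast
  have nB: "\<not> B k" if "h < k" "k < j" for k
  proof -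
    consider "k < i" | "k = i" | "i < k" by linarith
    then show ?thesis
    proof cases
      case 1 then show ?thesis using h(3) that by blast
    next
      case 2 then show ?thesis using AB(3)[of i] AB(7-10) by auto
    next
      case 3 then show ?thesis using AB(12) that by blast
    qed
  qed
  have "even (j - h)" by (rule AB(5)) (use h AB nB in auto)
  moreover have "even (j - i)" by (rule AB(6)) (use AB in auto)
  moreover have "j - h = (j - i) + (i - h)" using h AB by simp
  ultimately have ih: "even (i - h)" by (metis even_add)
  have "even h"
  proof (cases "h = 0")
    case False
    obtain i' where i': "h < i'" "i' \<le> i" "A i'" "\<And>k. h < k \<Longrightarrow> k < i' \<Longrightarrow> \<not> A k"
      using first_above[of A i h] h AB by blast
    show ?thesis
    proof (rule less.IH[of h B A i'])
      show "even (j - i)" if "0 < i" "i < j" "j < m" "B i \<and> A j \<or> A i \<and> B j" "\<And>k. i < k \<Longrightarrow> k < j \<Longrightarrow> \<not> B k \<and> \<not> A k" for i j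
        by (rule AB(6)) (use that in auto)
      show "h < i" "B 0" "A 0" "0 < h" "h < i'" "i' < m" "B h" "A i'" using AB(1,2,8,9) h False i' by auto
      show "\<not> (B k \<and> A k)" if "0 < k" "k < m" for k using AB(3)[OF that] by blast
      show "\<not> B k \<and> \<not> A k" if "h < k" "k < i'" for k using i'(4)[OF that] h(3)[of k] that i'(2) by auto
    qed (fact AB(4) AB(5))+
  qed simp
  then show ?case using ih h by (metis even_add le_add_diff_inverse less_imp_le)
qed

text \<open>Of the last inner marks of the two colours take the earlier, \<open>i\<close>. A colour
  change starts there, so \<open>i\<close> is even, and the gap from \<open>i\<close> to
  \<open>m\<close> in its own colour contains a mark of the other colour, so it has size at least 2
  and is even as well. Then \<open>m\<close> would be even.\<close>

lemma two_colour:
  fixes A B :: "nat \<Rightarrow> bool"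
  assumes "odd m" "A 0" "B 0" "A m" "B m"
    and dis: "\<And>i. 0 < i \<Longrightarrow> i < m \<Longrightarrow> \<not> (A i \<and> B i)"
    and eA: "\<And>i j. i < j \<Longrightarrow> j \<le> m \<Longrightarrow> A i \<Longrightarrow> A j \<Longrightarrow> (\<And>k. i < k \<Longrightarrow> k < j \<Longrightarrow> \<not> A k) \<Longrightarrow> j \<noteq> Suc i \<Longrightarrow> even (j - i)"
    and eB: "\<And>i j. i < j \<Longrightarrow> j \<le> m \<Longrightarrow> B i \<Longrightarrow> B j \<Longrightarrow> (\<And>k. i < k \<Longrightarrow> k < j \<Longrightarrow> \<not> B k) \<Longrightarrow> j \<noteq> Suc i \<Longrightarrow> even (j - i)"
    and tr: "\<And>i j. 0 < i \<Longrightarrow> i < j \<Longrightarrow> j < m \<Longrightarrow> A i \<and> B j \<or> B i \<and> A j \<Longrightarrow> (\<And>k. i < k \<Longrightarrow> k < j \<Longrightarrow> \<not> A k \<and> \<not> B k) \<Longrightarrow> even (j - i)"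
    and i0: "0 < i0" "i0 < m" "A i0" and j0: "0 < j0" "j0 < m" "B j0"
  shows False
proof -
  have key: False if "A 0" "B 0" "A m" "B m" and dis: "\<And>i. 0 < i \<Longrightarrow> i < m \<Longrightarrow> \<not> (A i \<and> B i)"
    and eA: "\<And>i j. i < j \<Longrightarrow> j \<le> m \<Longrightarrow> A i \<Longrightarrow> A j \<Longrightarrow> (\<And>k. i < k \<Longrightarrow> k < j \<Longrightarrow> \<not> A k) \<Longrightarrow> j \<noteq> Suc i \<Longrightarrow> even (j - i)"
    and eB: "\<And>i j. i < j \<Longrightarrow> j \<le> m \<Longrightarrow> B i \<Longrightarrow> B j \<Longrightarrow> (\<And>k. i < k \<Longrightarrow> k < j \<Longrightarrow> \<not> B k) \<Longrightarrow> j \<noteq> Suc i \<Longrightarrow> even (j - i)"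
    and tr: "\<And>i j. 0 < i \<Longrightarrow> i < j \<Longrightarrow> j < m \<Longrightarrow> A i \<and> B j \<or> B i \<and> A j \<Longrightarrow> (\<And>k. i < k \<Longrightarrow> k < j \<Longrightarrow> \<not> A k \<and> \<not> B k) \<Longrightarrow> even (j - i)"
    and i: "0 < i" "i < m" "A i" "\<And>k. i < k \<Longrightarrow> k < m \<Longrightarrow> \<not> A k" and M: "i < M" "M < m" "B M"
    for A B :: "nat \<Rightarrow> bool" and i M
  proof -
    obtain j where j: "i < j" "j \<le> M" "B j" "\<And>k. i < k \<Longrightarrow> k < j \<Longrightarrow> \<not> B k"
      using first_above[of B M i] M by blast
    have none: "\<not> A k \<and> \<not> B k" if "i < k" "k < j" for k using i(4)[of k] j(4)[of k] j(2) M(2) that by simp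
    have "even i"
      by (rule two_colour_aux[of A B m i j])
        (fact that(1) that(2) dis eA eB tr i(1) j(1) i(3) j(3) none | use j M in linarith)+
    moreover have "even (m - i)" by (rule eA) (use i that(3) j M in auto)
    ultimately show False using \<open>odd m\<close> i by (metis even_add le_add_diff_inverse less_imp_le)
  qed
  obtain i where i: "i0 \<le> i" "i < m" "A i" "\<And>k. i < k \<Longrightarrow> k < m \<Longrightarrow> \<not> A k"
    using last_below[of A i0 m] i0 by blast
  obtain j where j: "j0 \<le> j" "j < m" "B j" "\<And>k. j < k \<Longrightarrow> k < m \<Longrightarrow> \<not> B k"
    using last_below[of B j0 m] j0 by blast
  have tr': "even (j - i)" if "0 < i" "i < j" "j < m" "B i \<and> A j \<or> A i \<and> B j" "\<And>k. i < k \<Longrightarrow> k < j \<Longrightarrow> \<not> B k \<and> \<not> A k" for i j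
    by (rule tr) (use that in auto)
  have dis': "\<not> (B i \<and> A i)" if "0 < i" "i < m" for i using dis that by blast
  have "i \<noteq> j" using dis[of i] i j i0 by auto
  then consider "i < j" | "j < i" by linarith
  then show False
  proof cases
    case 1
    show False by (rule key[of A B i j]) (fact assms(2-5) dis eA eB tr i j 1 | use i i0 1 j in auto)+
  next
    case 2
    show False by (rule key[of B A j i]) (fact assms(2-5) dis' eA eB tr' i j 2 | use j j0 2 i in auto)+
  qed
qed

lemma oddp_mono: "oddp G u v S \<Longrightarrow> S \<subseteq> T \<Longrightarrow> oddp G u v T"
  unfolding oddp_def by blast

text \<open>Reduces to paths without complete inner vertices: by \<open>odd_gap\<close> some stretch
  between consecutive complete vertices is odd, and the base case is applied to that
  stretch.\<close>

lemma rrI: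
  assumes "graph G" "berge G"
    and base: "\<And>P. is_path G P \<Longrightarrow> even (length P) \<Longrightarrow> length P \<ge> 4 \<Longrightarrow> set P \<inter> X = {} \<Longrightarrow>
      complete G (P!0) X \<Longrightarrow> complete G (P!(length P - 1)) X \<Longrightarrow>
      (\<And>i. 0 < i \<Longrightarrow> i < length P - 1 \<Longrightarrow> \<not> complete G (P!i) X) \<Longrightarrow>
      length P = 4 \<and> oddp (compl G) (P!1) (P!2) X"
  shows "rr G X"
  unfolding rr_def
proof (intro allI impI, elim conjE)
  fix P assume P: "is_path G P" "even (length P)" "set P \<inter> X = {}" "complete G (hd P) X" "complete G (last P) X"
  let ?n = "length P"
  have ne: "P \<noteq> []" using P(1) unfolding is_path_def by simp
  show "(\<exists>i. Suc i < ?n \<and> complete G (P!i) X \<and> complete G (P!Suc i) X) \<or> (?n = 4 \<and> oddp (compl G) (P!1) (P!2) X)"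
  proof (rule disjCI)
    assume no4: "\<not> (?n = 4 \<and> oddp (compl G) (P!1) (P!2) X)"
    show "\<exists>i. Suc i < ?n \<and> complete G (P!i) X \<and> complete G (P!Suc i) X"
    proof (rule ccontr)
      assume noedge: "\<not> ?thesis"
      have ends: "complete G (P!0) X" "complete G (P!(?n-1)) X" using P(4,5) ne by (simp_all add: hd_conv_nth last_conv_nth)
      have n2: "?n \<ge> 2" using P(2) ne by (cases P) (auto simp: Suc_le_eq)
      have "odd (?n - 1 - 0)" "0 < ?n - 1" using P(2) n2 by auto
      then obtain c d where cd: "c < d" "d \<le> ?n - 1" "complete G (P!c) X" "complete G (P!d) X" "odd (d - c)"
        "\<And>k. c < k \<Longrightarrow> k < d \<Longrightarrow> \<not> complete G (P!k) X"
        using odd_gap[of "\<lambda>i. complete G (P!i) X" 0 "?n - 1"] ends by blast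
      have dn: "d < ?n" using cd n2 by linarith
      have "d \<noteq> Suc c" using noedge cd dn by blast
      then have d3: "c + 3 \<le> d" using cd(1,5) by (cases "d = c + 2") auto
      let ?R = "seg P c d"
      have "length ?R = 4 \<and> oddp (compl G) (?R!1) (?R!2) X"
      proof (rule base)
        show "is_path G ?R" using is_path_seg[OF P(1)] cd dn by simp
        show "even (length ?R)" "length ?R \<ge> 4" using cd d3 by auto
        show "set ?R \<inter> X = {}" using P(3) dn unfolding set_seg by (auto simp: disjoint_iff)
        show "complete G (?R!0) X" "complete G (?R!(length ?R - 1)) X" using cd by (simp_all add: seg_nth)
        show "\<not> complete G (?R!i) X" if "0 < i" "i < length ?R - 1" for i
          using that cd(6)[of "c + i"] by (simp add: seg_nth)
      qed
      then have d: "d = c + 3" and o: "oddp (compl G) (P!(c+1)) (P!(c+2)) X" by (auto simp: seg_nth)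
      \<comment> \<open>If the stretch is not all of \<open>P\<close>, an end of \<open>P\<close>
        lies beyond it and closes the odd antipath to an odd antihole.\<close>
      have "\<exists>z. (z = 0 \<or> z = ?n - 1) \<and> (z < c \<or> d < z)"
      proof (cases "c = 0")
        case True
        then have "?n \<noteq> 4" using no4 o by (auto simp: numeral_2_eq_2)
        then show ?thesis using True d dn by auto
      qed auto
      then obtain z where z: "z = 0 \<or> z = ?n - 1" "z < c \<or> d < z" by blast
      then have zn: "z < ?n" using n2 by auto
      show False
        using anti_close[OF assms(2,1) o is_path_nth_verts[OF P(1) zn]] is_path_adj[OF P(1) zn] is_path_nth_eq[OF P(1) zn]
          z ends d dn is_path_nth_verts[OF P(1)] by auto
    qed
  qed
qed

text \<open>The triangles are \<open>{s, P!0, P!1}\<close> and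
  \<open>{last P, t, P!(length P - 2)}\<close>, written with \<open>last P\<close> for the final
  vertex. They are joined by the edge from \<open>s\<close> to the last vertex, the edge from
  \<open>P!0\<close> to \<open>t\<close>, and the interior of \<open>P\<close>, which has at least
  four vertices and makes the prism long.\<close>

lemma leap_prism:
  assumes "graph G" "is_path G P" "length P \<ge> 6" "s \<in> verts G" "t \<in> verts G" "s \<noteq> t" "\<not> adj G s t"
    "s \<notin> set P" "t \<notin> set P"
    "\<And>i. i < length P \<Longrightarrow> adj G s (P!i) \<longleftrightarrow> i = 0 \<or> i = 1 \<or> i = length P - 1"
    "\<And>i. i < length P \<Longrightarrow> adj G t (P!i) \<longleftrightarrow> i = 0 \<or> i = length P - 2 \<or> i = length P - 1"
  shows "has_long_prism G"
proof -
  let ?n = "length P"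
  let ?p = "P!0" and ?q = "P!(?n-1)" and ?R = "seg P 1 (?n-2)"
  define F where "F i = (if i = 0 then [s, ?q] else if i = 1 then [?p, t] else ?R)" for i :: nat
  have F: "F 0 = [s, ?q]" "F (Suc 0) = [?p, t]" "F 2 = ?R" unfolding F_def by auto
  have ne: "P \<noteq> []" using assms(3) by auto
  have sy: "\<And>u v. adj G u v \<longleftrightarrow> adj G v u" using adj_sym[OF assms(1)] .
  have pV: "?p \<in> verts G" "?q \<in> verts G" using is_path_nth_verts[OF assms(2)] assms(3) ne by auto
  have pq: "?p \<noteq> ?q" "\<not> adj G ?p ?q" using is_path_nth_eq[OF assms(2), of 0 "?n-1"] is_path_adj[OF assms(2), of 0 "?n-1"] assms(3) ne by auto
  have st: "?p \<noteq> s" "?p \<noteq> t" "?q \<noteq> s" "?q \<noteq> t" using assms(8,9) ne nth_mem[of 0 P] nth_mem[of "?n-1" P] by auto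
  have sa: "adj G s ?p" "adj G s ?q" "adj G t ?p" "adj G t ?q" using assms(10,11) ne by auto
  have sb: "adj G ?p s" "adj G ?q s" "adj G ?p t" "adj G ?q t" "\<not> adj G t s" "\<not> adj G ?q ?p"
    using sa pq(2) assms(7) sy[of s ?p] sy[of s ?q] sy[of t ?p] sy[of t ?q] sy[of s t] sy[of ?p ?q] by blast+
  have R: "is_path G ?R" using is_path_seg[OF assms(2), of 1 "?n-2"] assms(3) by auto
  have hR: "hd ?R = P!1" "last ?R = P!(?n-2)" using assms(3) by (simp_all add: hd_seg last_seg)
  have sR: "set ?R = nth P ` {1..?n-2}" by (rule set_seg)
  have RR: "z \<noteq> s" "z \<noteq> t" "z \<noteq> ?p" "z \<noteq> ?q" "adj G s z \<longleftrightarrow> z = P!1" "adj G t z \<longleftrightarrow> z = P!(?n-2)"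
    "adj G ?p z \<longleftrightarrow> z = P!1" "adj G ?q z \<longleftrightarrow> z = P!(?n-2)" if z: "z \<in> set ?R" for z
  proof -
    obtain i where i: "z = P!i" "1 \<le> i" "i \<le> ?n - 2" using z sR by auto
    have l: "i < ?n" using i assms(3) by linarith
    show "z \<noteq> s" "z \<noteq> t" using i l assms(8,9) nth_mem by auto
    note e = is_path_nth_eq[OF assms(2) l]
    note a = is_path_adj[OF assms(2) _ l]
    show "z \<noteq> ?p" "z \<noteq> ?q" using e[of 0] e[of "?n-1"] i l ne by auto
    show "adj G s z \<longleftrightarrow> z = P!1" using assms(10)[OF l] e[of 1] i assms(3) by auto
    show "adj G t z \<longleftrightarrow> z = P!(?n-2)" using assms(11)[OF l] e[of "?n-2"] i assms(3) by auto
    show "adj G ?p z \<longleftrightarrow> z = P!1" using a[of 0] e[of 1] i assms(3) ne by auto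
    have "adj G ?q z \<longleftrightarrow> i = ?n - 2" using a[of "?n-1"] i assms(3) l by auto
    then show "adj G ?q z \<longleftrightarrow> z = P!(?n-2)" using e[of "?n-2"] i assms(3) by auto
  qed
  have two: "is_path G [u, v] \<longleftrightarrow> u \<in> verts G \<and> v \<in> verts G \<and> u \<noteq> v \<and> adj G u v" for u v
    using is_path_Cons[OF assms(1), of "[v]" u] is_path_singleton[OF assms(1), of v] by auto
  have i3: "i < 3 \<Longrightarrow> i = 0 \<or> i = Suc 0 \<or> i = 2" for i :: nat by auto
  show ?thesis unfolding has_long_prism_def
  proof (intro exI[of _ F] conjI allI impI)
    fix i :: nat assume "i < 3"
    then show "is_path G (F i)" "length (F i) \<ge> 2"
      using i3[of i] F two R assms(3,4,5) sa sb st pV by auto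
  next
    fix i j :: nat assume "i < 3" "j < 3" "i \<noteq> j"
    then show "set (F i) \<inter> set (F j) = {}"
      using i3[of i] i3[of j] F RR(1-4) pq st assms(6) by (auto simp del: length_seg)
  next
    fix i j :: nat assume ij: "i < 3" "j < 3" "i \<noteq> j"
    have c1: "\<forall>u\<in>set (F 0). \<forall>v\<in>set (F (Suc 0)). adj G u v \<longleftrightarrow> (u = hd (F 0) \<and> v = hd (F (Suc 0))) \<or> (u = last (F 0) \<and> v = last (F (Suc 0)))"
      using F pq st sa sb assms(6,7) by auto
    have c2: "\<forall>u\<in>set (F 0). \<forall>v\<in>set (F 2). adj G u v \<longleftrightarrow> (u = hd (F 0) \<and> v = hd (F 2)) \<or> (u = last (F 0) \<and> v = last (F 2))"
      unfolding F hR using RR st by auto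
    have c3: "\<forall>u\<in>set (F (Suc 0)). \<forall>v\<in>set (F 2). adj G u v \<longleftrightarrow> (u = hd (F (Suc 0)) \<and> v = hd (F 2)) \<or> (u = last (F (Suc 0)) \<and> v = last (F 2))"
      unfolding F hR using RR st by auto
    consider "i = 0" "j = Suc 0" | "i = 0" "j = 2" | "i = Suc 0" "j = 2" | "i = Suc 0" "j = 0" | "i = 2" "j = 0" | "i = 2" "j = Suc 0"
      using ij i3[of i] i3[of j] by auto
    then show "\<forall>u\<in>set (F i). \<forall>v\<in>set (F j). adj G u v \<longleftrightarrow> (u = hd (F i) \<and> v = hd (F j)) \<or> (u = last (F i) \<and> v = last (F j))"
      using c1 c2 c3 sy by cases (simp only:, metis)+
  next
    have "length (F 2) > 2" using F assms(3) by simp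
    then show "\<exists>i<3. length (F i) > 2" by (intro exI[of _ 2]) simp
  qed
qed

section \<open>Antipaths through \<open>X\<close> extended by vertices of the path\<close>

lemma antipath_ends_path:
  assumes "graph G" "X \<subseteq> verts G" "t \<in> X" "t' \<in> X" "is_path (compl G) Q" "hd Q = t" "last Q = t'" "set Q \<subseteq> X"
    "p \<in> verts G" "q \<in> verts G" "p \<notin> X" "q \<notin> X"
    "complete G p (X - {t})" "\<not> adj G t p" "complete G q (X - {t'})" "\<not> adj G t' q" "adj G p q"
  shows "is_path (compl G) (p # Q @ [q])"
proof -
  have "Q \<noteq> []" using assms(5) unfolding is_path_def by simp
  moreover have "p \<noteq> q" using assms(17) adj_irrefl[OF assms(1)] by auto
  moreover have "adj (compl G) p z \<longleftrightarrow> z = t" "adj (compl G) q z \<longleftrightarrow> z = t'" if "z \<in> set Q" for z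
    using that assms adj_sym[OF assms(1), of _ p] adj_sym[OF assms(1), of _ q] unfolding adj_compl complete_def by blast+
  ultimately show ?thesis using is_path_ends[OF graph_compl[OF assms(1)], of Q p q] assms
    by (auto simp: adj_compl)
qed

text \<open>\<open>Q\<close> followed by the nonadjacent pair \<open>q\<close>, \<open>p\<close> is
  an antihole with \<open>length Q + 2\<close> vertices. Together with \<open>antipath_odd\<close>
  this lets the parity of one fixed antipath decide whether \<open>p\<close> and \<open>q\<close>
  may be adjacent.\<close>

lemma antipath_even:
  assumes "graph G" "berge G" "X \<subseteq> verts G" "t \<in> X" "t' \<in> X" "t \<noteq> t'" "is_path (compl G) Q" "hd Q = t" "last Q = t'" "set Q \<subseteq> X"
    "p \<in> verts G" "q \<in> verts G" "p \<notin> X" "q \<notin> X"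
    "complete G p (X - {t})" "\<not> adj G t p" "complete G q (X - {t'})" "\<not> adj G t' q" "\<not> adj G p q" "p \<noteq> q"
  shows "even (length Q)"
proof -
  note gc = graph_compl[OF assms(1)]
  have ne: "Q \<noteq> []" using assms(7) unfolding is_path_def by simp
  have "length Q \<ge> 2" using assms(6,8,9) ne by (cases Q) (auto simp: Suc_le_eq)
  moreover have "is_path (compl G) [q, p]"
    using is_path_Cons[OF gc, of "[p]" q] is_path_singleton[OF gc, of p] assms(11,12,19,20) adj_sym[OF assms(1), of p q]
    by (auto simp: adj_compl)
  moreover have "adj (compl G) z p \<longleftrightarrow> z = t" "adj (compl G) z q \<longleftrightarrow> z = t'" if "z \<in> set Q" for z
    using that assms adj_sym[OF assms(1), of _ p] adj_sym[OF assms(1), of _ q] unfolding adj_compl complete_def by blast+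
  ultimately have "even (length Q + length [q, p])"
    using berge_close[of "compl G" Q "[q,p]"] assms gc berge_compl[OF assms(1)] by auto
  then show ?thesis by simp
qed

text \<open>For adjacent \<open>p\<close>, \<open>q\<close> the antipath extends to
  \<open>p # Q @ [q]\<close>, and the \<open>X\<close>-complete vertex \<open>z\<close> missing both
  ends closes it to an antihole with \<open>length Q + 3\<close> vertices.\<close>

lemma antipath_odd:
  assumes "graph G" "berge G" "X \<subseteq> verts G" "t \<in> X" "t' \<in> X" "is_path (compl G) Q" "hd Q = t" "last Q = t'" "set Q \<subseteq> X"
    "p \<in> verts G" "q \<in> verts G" "p \<notin> X" "q \<notin> X"
    "complete G p (X - {t})" "\<not> adj G t p" "complete G q (X - {t'})" "\<not> adj G t' q" "adj G p q"
    "z \<in> verts G" "complete G z X" "z \<noteq> p" "z \<noteq> q" "\<not> adj G z p" "\<not> adj G z q"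
  shows "odd (length Q)"
proof (rule ccontr)
  assume ev: "\<not> ?thesis"
  have "is_path (compl G) (p # Q @ [q])" by (rule antipath_ends_path[OF assms(1,3-18)])
  moreover have "Q \<noteq> []" using assms(6) unfolding is_path_def by simp
  ultimately have "oddp (compl G) p q X" unfolding oddp_def using ev assms(9) by blast
  then show False using anti_close[OF assms(2,1), of p q X z] assms by blast
qed

section \<open>Refuting long paths: \<open>X\<close> a nonadjacent pair, or two adjacent deletable
  vertices\<close>

context rr_path
begin

lemma not_both:
  assumes "t \<noteq> t'" "0 < i" "i < n - 1"
  shows "\<not> (complete G (P!i) (X - {t}) \<and> complete G (P!i) (X - {t'}))"
  using inner[OF assms(2,3)] assms(1) unfolding complete_def by blast

text \<open>An end of \<open>P\<close> that misses the stretch from \<open>i\<close> to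
  \<open>j\<close> closes it through \<open>t\<close> and \<open>t'\<close> to a hole with
  \<open>j - i + 4\<close> vertices. No such end exists only for \<open>i = 1\<close> and
  \<open>j = n - 2\<close>, and then an odd change is a leap, so there is a long prism.\<close>

lemma pair_transition_even:
  assumes prism: "\<not> has_long_prism G"
    and X: "X = {t, t'}" "t \<noteq> t'" "\<not> adj G t t'"
    and ij: "0 < i" "i < j" "j < n - 1" "adj G t' (P!i)" "adj G t (P!j)"
    and none: "\<And>k. i < k \<Longrightarrow> k < j \<Longrightarrow> \<not> adj G t (P!k) \<and> \<not> adj G t' (P!k)"
  shows "even (j - i)"
proof (rule ccontr)
  assume odd: "odd (j - i)"
  have sy: "adj G u v \<longleftrightarrow> adj G v u" for u v using adj_sym[OF gr] .
  have tV: "t \<in> verts G" "t' \<in> verts G" using X XV by auto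
  have tX: "t \<in> X" "t' \<in> X" using X by auto
  have both: "\<not> (adj G t (P!k) \<and> adj G t' (P!k))" if "0 < k" "k < n - 1" for k
    using inner[OF that] X(1) sy[of "P!k" t] sy[of "P!k" t'] unfolding complete_def by auto
  have ti: "adj G t (P!k) \<longleftrightarrow> k = j" if "i \<le> k" "k \<le> j" for k
    using none[of k] both[of i] that ij by (metis le_neq_implies_less less_trans)
  have t'i: "adj G t' (P!k) \<longleftrightarrow> k = i" if "i \<le> k" "k \<le> j" for k
    using none[of k] both[of j] that ij by (metis le_neq_implies_less less_trans)
  have no: False if q: "q = 0 \<and> 1 < i \<or> q = n - 1 \<and> j < n - 2" for q
  proof -
    have qn: "q < n" using q ne by auto
    have qt: "adj G t (P!q)" "adj G t' (P!q)" using q ends_adj tX by auto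
    have qt': "P!q \<noteq> t" "P!q \<noteq> t'" using nth_notin[OF qn] tX by auto
    have qk: "P!k \<noteq> P!q \<and> \<not> adj G (P!k) (P!q)" if "i \<le> k" "k \<le> j" for k
      using eqP[of k q] adjP[of k q] q qn that ij by auto
    let ?xs = "seg P i j" and ?ys = "[t, P!q, t']"
    have "is_path G [P!q, t']"
      using is_path_Cons[OF gr, of "[t']" "P!q"] qt qt' sy[of t'] tV inV[OF qn] gr by auto
    then have ys: "is_path G ?ys"
      using is_path_Cons[OF gr, of "[P!q, t']" t] qt qt' X tV by auto
    have xs: "is_path G ?xs" using is_path_seg[OF path] ij by simp
    have h: "hd ?xs = P!i" "last ?xs = P!j" using ij by (simp_all add: hd_seg last_seg)
    have "even (length ?xs + length ?ys)"
    proof (rule berge_close[OF bg gr xs ys])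
      show "set ?xs \<inter> set ?ys = {}" using qk t_notin[OF tX(1)] t_notin[OF tX(2)] ij nth_mem[of _ P]
        by (force simp: set_seg)
      show "length ?xs + length ?ys \<ge> 4" using ij by simp
      fix x y assume x: "x \<in> set ?xs" and y: "y \<in> set ?ys"
      obtain k where k: "x = P!k" "i \<le> k" "k \<le> j" using x by (auto simp: set_seg)
      have e: "P!k = P!i \<longleftrightarrow> k = i" "P!k = P!j \<longleftrightarrow> k = j" using eqP k ij by auto
      show "adj G x y \<longleftrightarrow> (x = last ?xs \<and> y = hd ?ys) \<or> (x = hd ?xs \<and> y = last ?ys)"
        using y ti[OF k(2,3)] t'i[OF k(2,3)] qk[OF k(2,3)] sy[of "P!k" t] sy[of "P!k" t'] X(2) qt' unfolding h k(1) e by auto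
    qed
    then show False using odd ij by (simp add: Suc_diff_le)
  qed
  \<comment> \<open>Otherwise the first or the last vertex of \<open>P\<close> would be a suitable
    \<open>q\<close> for \<open>no\<close>. From here on \<open>t'\<close> and \<open>t\<close> have
    exactly the neighbours that \<open>leap_prism\<close> asks for.\<close>
  have i1: "i = 1" using no[of 0] ij by (cases "1 < i") auto
  have jn: "j = n - 2" using no[of "n - 1"] ij by (cases "j < n - 2") auto
  have tP: "adj G t (P!k) \<longleftrightarrow> k = 0 \<or> k = n - 2 \<or> k = n - 1" if "k < n" for k
    using ti[of k] ends_adj(1)[OF tX(1)] ends_adj(2)[OF tX(1)] that i1 jn ij by (cases "k = 0 \<or> k = n - 1") auto
  have t'P: "adj G t' (P!k) \<longleftrightarrow> k = 0 \<or> k = 1 \<or> k = n - 1" if "k < n" for k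
    using t'i[of k] ends_adj(1)[OF tX(2)] ends_adj(2)[OF tX(2)] that i1 jn ij by (cases "k = 0 \<or> k = n - 1") auto
  have "has_long_prism G"
    by (rule leap_prism[OF gr path len tV(2,1) X(2)[symmetric]])
      (use X(3) sy[of t t'] t_notin tX t'P tP in blast)+
  then show False using prism by simp
qed

text \<open>Complete to \<open>X - {t}\<close> means adjacent to \<open>t'\<close> here, so the two
  colours are the neighbourhoods of \<open>t'\<close> and \<open>t\<close> along \<open>P\<close>;
  \<open>hat\<close> supplies an inner mark of each.\<close>

lemma rr_pair:
  assumes "\<not> has_long_prism G" "X = {t, t'}" "t \<noteq> t'" "\<not> adj G t t'" "rr G {t}" "rr G {t'}"
  shows False
proof -
  have sy: "adj G u v \<longleftrightarrow> adj G v u" for u v using adj_sym[OF gr] .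
  have T: "X - {t} = {t'}" "X - {t'} = {t}" using assms(2,3) by auto
  have tX: "t \<in> X" "t' \<in> X" "{t} \<subseteq> X" "{t'} \<subseteq> X" using assms(2) by auto
  have c: "complete G v {s} \<longleftrightarrow> adj G s v" for v s unfolding complete_def using sy[of v s] by simp
  have h: "adj G t' (P!1) \<or> adj G t' (P!(n-2))" "adj G t (P!1) \<or> adj G t (P!(n-2))"
    using hat[of t] hat[of t'] tX assms(4-6) sy[of t t'] unfolding T c by auto
  have d: "\<not> (adj G t' (P!i) \<and> adj G t (P!i))" if "0 < i" "i < n - 1" for i
    using not_both[OF assms(3) that] unfolding T c .
  have e: "even (j - i)" if "s \<in> X" "rr G {s}" "i < j" "j \<le> n - 1" "adj G s (P!i)" "adj G s (P!j)"
    "\<And>k. i < k \<Longrightarrow> k < j \<Longrightarrow> \<not> adj G s (P!k)" "j \<noteq> Suc i" for s i j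
  proof (rule complete_gap_even[of "{s}"])
    have "n - 1 < n" using ne by simp
    then show "j < n" using that(4) by (rule le_less_trans[rotated])
  qed (use that in \<open>simp_all add: c\<close>)
  have tr: "even (j - i)" if ij: "0 < i" "i < j" "j < n - 1" "adj G t' (P!i) \<and> adj G t (P!j) \<or> adj G t (P!i) \<and> adj G t' (P!j)"
     "\<And>k. i < k \<Longrightarrow> k < j \<Longrightarrow> \<not> adj G t' (P!k) \<and> \<not> adj G t (P!k)" for i j
    using ij(4)
  proof (elim disjE conjE)
    assume a: "adj G t' (P!i)" "adj G t (P!j)"
    show ?thesis by (rule pair_transition_even[OF assms(1-4) ij(1-3) a]) (use ij(5) in blast)
  next
    assume a: "adj G t (P!i)" "adj G t' (P!j)"
    have X': "X = {t', t}" "t' \<noteq> t" "\<not> adj G t' t" using assms(2-4) sy[of t t'] by auto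
    show ?thesis by (rule pair_transition_even[OF assms(1) X' ij(1-3) a]) (use ij(5) in blast)
  qed
  have n1: "0 < (1::nat)" "1 < n - 1" "0 < n - 2" "n - 2 < n - 1" using len by auto
  obtain i0 where i0: "0 < i0" "i0 < n - 1" "adj G t' (P!i0)"
    by (rule disjE[OF h(1)]; rule that[rotated 2], assumption) (use len in linarith)+
  obtain j0 where j0: "0 < j0" "j0 < n - 1" "adj G t (P!j0)"
    by (rule disjE[OF h(2)]; rule that[rotated 2], assumption) (use len in linarith)+
  show False
  proof (rule two_colour[of "n - 1" "\<lambda>i. adj G t' (P!i)" "\<lambda>i. adj G t (P!i)" i0 j0])
    show "odd (n - 1)" using even_len ne by simp
  qed (fact ends_adj(1)[OF tX(1)] ends_adj(1)[OF tX(2)] ends_adj(2)[OF tX(1)] ends_adj(2)[OF tX(2)] d tr i0 j0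
      e[OF tX(1) assms(5)] e[OF tX(2) assms(6)])+
qed

text \<open>The colours are completeness to \<open>X - {t}\<close> and to \<open>X - {t'}\<close>.
  An antipath from \<open>t\<close> to \<open>t'\<close> through the remaining set \<open>Z\<close>
  has a fixed parity, which forces every \<open>Z\<close>-complete inner vertex to carry a colour
  and different colours to be nonadjacent. A colour change is then a gap between consecutive
  \<open>Z\<close>-complete vertices, which is even by \<open>rr\<close> for
  \<open>Z\<close>.\<close>

lemma rr_adjacent:
  assumes X: "t \<in> X" "t' \<in> X" "t \<noteq> t'" "adj G t t'"
    and ac: "conn (compl G) (X - {t, t'})" "\<not> complete G t (X - {t, t'})" "\<not> complete G t' (X - {t, t'})"
    and rrs: "rr G (X - {t})" "rr G (X - {t'})" "rr G (X - {t, t'})"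
  shows False
proof -
  let ?Z = "X - {t, t'}"
  have sy: "adj G u v \<longleftrightarrow> adj G v u" for u v using adj_sym[OF gr] .
  note gc = graph_compl[OF gr]
  have tV: "t \<in> verts G" "t' \<in> verts G" using X XV by auto
  have ZV: "?Z \<subseteq> verts G" using XV by auto
  have "\<not> anticomplete (compl G) t ?Z" "\<not> anticomplete (compl G) t' ?Z"
    using ac tV ZV by (simp_all add: anticomplete_compl)
  then obtain R where R: "R \<noteq> []" "set R \<subseteq> ?Z" "is_path (compl G) (t # R @ [t'])"
    using conn_path_through[OF gc ac(1), of t t'] tV ZV X by (auto simp: adj_compl)
  let ?Q = "t # R @ [t']"
  have Q: "hd ?Q = t" "last ?Q = t'" "set ?Q \<subseteq> X" using R X by auto
  have nc: "\<not> complete G t (X - {t})" "\<not> complete G t' (X - {t'})"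
    using ac(2,3) unfolding complete_def by blast+
  define A where "A i \<longleftrightarrow> complete G (P!i) (X - {t})" for i
  define B where "B i \<longleftrightarrow> complete G (P!i) (X - {t'})" for i
  have An: "\<not> adj G t (P!i)" if "A i" "0 < i" "i < n - 1" for i
    using complete_inner[OF X(1)] that unfolding A_def by blast
  have Bn: "\<not> adj G t' (P!i)" if "B i" "0 < i" "i < n - 1" for i
    using complete_inner[OF X(2)] that unfolding B_def by blast
  have d: "\<not> (A i \<and> B i)" if "0 < i" "i < n - 1" for i
    using not_both[OF X(3) that] unfolding A_def B_def .
  have n1: "0 < (1::nat)" "1 < n - 1" "0 < n - 2" "n - 2 < n - 1" "1 < n" "n - 2 < n" using len by auto
  have h: "A 1 \<or> A (n-2)" "B 1 \<or> B (n-2)" unfolding A_def B_def using hat[OF X(1) rrs(1) nc(1)] hat[OF X(2) rrs(2) nc(2)] by auto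
  have eQ': "even (length ?Q)" if "A i" "B j" "0 < i" "i < n - 1" "0 < j" "j < n - 1" "\<not> adj G (P!i) (P!j)" "i \<noteq> j" for i j
    by (rule antipath_even[OF gr bg XV X(1-3) R(3) Q, of "P!i" "P!j"])
      (use that inV nth_notin An Bn eqP in \<open>auto simp: A_def B_def\<close>)
  \<comment> \<open>\<open>hat\<close> for \<open>t\<close> and for \<open>t'\<close> must use
    different positions among \<open>1\<close> and \<open>n - 2\<close>, since one inner vertex
    cannot carry both colours. These two vertices are nonadjacent, so \<open>antipath_even\<close>
    applies.\<close>
  have eQ: "even (length ?Q)"
  proof (cases "A 1")
    case True
    then have "B (n-2)" using h d[of 1] n1 by auto
    then show ?thesis using eQ'[of 1 "n-2"] True n1 adjP[of 1 "n-2"] len by auto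
  next
    case False
    then have "A (n-2)" "B 1" using h d[of "n-2"] n1 by auto
    then show ?thesis using eQ'[of "n-2" 1] n1 adjP[of "n-2" 1] len by auto
  qed
  \<comment> \<open>Adjacent marks of different colours lie away from at least one end of
    \<open>P\<close>, and with that end \<open>antipath_odd\<close> would make the same antipath
    odd.\<close>
  have noadj: "\<not> adj G (P!i) (P!j)" if ab: "A i" "B j" "0 < i" "i < n - 1" "0 < j" "j < n - 1" for i j
  proof
    assume a: "adj G (P!i) (P!j)"
    have ij: "j = Suc i \<or> i = Suc j" using adjP[of i j] a ab by auto
    obtain q where q: "q = 0 \<and> 1 < i \<and> 1 < j \<or> q = n - 1 \<and> i < n - 2 \<and> j < n - 2"
    proof (cases "1 < i \<and> 1 < j")
      case False
      then have "i < n - 2 \<and> j < n - 2" using ij ab len by auto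
      then show ?thesis using that by blast
    qed (use that in blast)
    then have qn: "q < n" using len by auto
    have "odd (length ?Q)"
    proof (rule antipath_odd[OF gr bg XV X(1,2) R(3) Q, of "P!i" "P!j" "P!q"])
      show "complete G (P!q) X" using q ends by auto
      show "P!q \<noteq> P!i" "P!q \<noteq> P!j" "\<not> adj G (P!q) (P!i)" "\<not> adj G (P!q) (P!j)"
        using eqP[OF qn, of i] eqP[OF qn, of j] adjP[OF qn, of i] adjP[OF qn, of j] q ab by auto
    qed (use a ab qn inV nth_notin An Bn in \<open>auto simp: A_def B_def\<close>)
    then show False using eQ by simp
  qed
  \<comment> \<open>A \<open>Z\<close>-complete vertex without a colour misses both \<open>t\<close>
    and \<open>t'\<close>, so it would close the antipath \<open>?Q\<close>, of even vertex count,
    to an odd antihole.\<close>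
  have Zc: "A i \<or> B i" if i: "complete G (P!i) ?Z" "0 < i" "i < n - 1" for i
  proof (rule ccontr)
    assume nAB: "\<not> ?thesis"
    then have "\<not> adj G (P!i) t" "\<not> adj G (P!i) t'" using i(1) unfolding A_def B_def complete_def by blast+
    then have nt: "\<not> adj G (P!i) t" "\<not> adj G (P!i) t'" "\<not> adj G t (P!i)" "\<not> adj G t' (P!i)" using sy by blast+
    have il: "i < n" using i by simp
    have "odd (length ?Q)"
    proof (rule berge_close1[of "compl G"])
      show "P!i \<in> verts (compl G)" using inV[OF il] by simp
      show "P!i \<notin> set ?Q" using nth_notin[OF il] Q(3) by blast
      show "length ?Q \<ge> 3" using R(1) by (cases R) auto
      show "adj (compl G) (P!i) y \<longleftrightarrow> y = hd ?Q \<or> y = last ?Q" if "y \<in> set ?Q" for y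
        using that i(1) nt inV[OF il] tV nth_notin[OF il] R(2) X unfolding adj_compl complete_def by auto
    qed (use bg gc gr R berge_compl in auto)
    then show False using eQ by simp
  qed
  have Zm: "complete G (P!i) ?Z" if "A i \<or> B i" for i using that unfolding A_def B_def complete_def by blast
  have e1: "even (j - i)" if "i < j" "j \<le> n - 1" "A i" "A j" "\<And>k. i < k \<Longrightarrow> k < j \<Longrightarrow> \<not> A k" "j \<noteq> Suc i" for i j
  proof (rule complete_gap_even[OF _ rrs(1)])
    have "n - 1 < n" using ne by simp
    then show "j < n" using that(2) by (rule le_less_trans[rotated])
  qed (use that in \<open>auto simp: A_def\<close>)
  have e2: "even (j - i)" if "i < j" "j \<le> n - 1" "B i" "B j" "\<And>k. i < k \<Longrightarrow> k < j \<Longrightarrow> \<not> B k" "j \<noteq> Suc i" for i j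
  proof (rule complete_gap_even[OF _ rrs(2)])
    have "n - 1 < n" using ne by simp
    then show "j < n" using that(2) by (rule le_less_trans[rotated])
  qed (use that in \<open>auto simp: B_def\<close>)
  have tr: "even (j - i)" if ij: "0 < i" "i < j" "j < n - 1" "A i \<and> B j \<or> B i \<and> A j"
     "\<And>k. i < k \<Longrightarrow> k < j \<Longrightarrow> \<not> A k \<and> \<not> B k" for i j
  proof (rule complete_gap_even[OF _ rrs(3) ij(2)])
    show "?Z \<subseteq> X" by blast
    show "j < n" using ij by simp
    show "complete G (P!i) ?Z" "complete G (P!j) ?Z" using Zm ij(4) by blast+
    show "\<not> complete G (P!k) ?Z" if "i < k" "k < j" for k using Zc[of k] ij(5)[OF that] that ij by auto
    have "\<not> adj G (P!i) (P!j)" using noadj[of i j] noadj[of j i] ij sy[of "P!i" "P!j"] by auto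
    then show "j \<noteq> Suc i" using adjP[of i j] ij by auto
  qed
  obtain i0 where i0: "0 < i0" "i0 < n - 1" "A i0"
    by (rule disjE[OF h(1)]; rule that[rotated 2], assumption) (use len in linarith)+
  obtain j0 where j0: "0 < j0" "j0 < n - 1" "B j0"
    by (rule disjE[OF h(2)]; rule that[rotated 2], assumption) (use len in linarith)+
  have E: "A 0" "B 0" "A (n - 1)" "B (n - 1)" unfolding A_def B_def using ends_complete by auto
  show False
  proof (rule two_colour[of "n - 1" A B i0 j0])
    show "odd (n - 1)" using even_len ne by simp
  qed (fact E d tr i0 j0 e1 e2)+
qed

end

text \<open>An antipath \<open>Q\<close> from \<open>t\<close> to \<open>t'\<close> in
  \<open>X\<close> extends by \<open>P!1\<close> and \<open>P!2\<close>. If \<open>Q\<close> has an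
  even number of vertices this is the desired odd antipath; if odd, adding the nonadjacent ends
  \<open>P!0\<close>, \<open>P!3\<close> gives an odd antihole.\<close>

lemma rr_length4:
  assumes "graph G" "berge G" "is_path G P" "length P = 4" "set P \<inter> X = {}" "X \<subseteq> verts G"
    "complete G (P!0) X" "complete G (P!3) X" "\<not> complete G (P!1) X" "\<not> complete G (P!2) X"
    "conn (compl G) X" "t \<in> X" "t' \<in> X" "t \<noteq> t'"
    "complete G (P!1) (X - {t})" "complete G (P!2) (X - {t'})"
  shows "oddp (compl G) (P!1) (P!2) X"
proof -
  have sy: "adj G u v \<longleftrightarrow> adj G v u" for u v using adj_sym[OF assms(1)] .
  note gc = graph_compl[OF assms(1)]
  have V: "P!i \<in> verts G" "P!i \<notin> X" if "i < 4" for i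
  proof -
    have "P!i \<in> set P" using that assms(4) by simp
    then show "P!i \<in> verts G" "P!i \<notin> X" using assms(3,5) unfolding is_path_def by blast+
  qed
  have a: "adj G (P!i) (P!j) \<longleftrightarrow> j = Suc i \<or> i = Suc j" if "i < 4" "j < 4" for i j using is_path_adj[OF assms(3)] that assms(4) by simp
  have e: "P!i = P!j \<longleftrightarrow> i = j" if "i < 4" "j < 4" for i j using is_path_nth_eq[OF assms(3)] that assms(4) by simp
  obtain Q where Q: "is_path (compl G) Q" "hd Q = t" "last Q = t'" "set Q \<subseteq> X"
    using conn_path[OF gc assms(11), of t t'] assms(6,12,13) by auto
  have ne: "Q \<noteq> []" using Q(1) unfolding is_path_def by simp
  have nt: "\<not> adj G t (P!1)" "\<not> adj G t' (P!2)"
    using assms(9,10,15,16) sy[of t] sy[of t'] unfolding complete_def by blast+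
  let ?R = "P!1 # Q @ [P!2]"
  have R: "is_path (compl G) ?R"
    by (rule antipath_ends_path[OF assms(1,6,12,13) Q]) (use V a nt assms(15,16) in auto)
  show ?thesis
  proof (cases "even (length Q)")
    case True
    then show ?thesis unfolding oddp_def using R Q ne by blast
  next
    case False
    have S: "is_path (compl G) [P!0, P!3]"
      using is_path_Cons[OF gc, of "[P!3]" "P!0"] is_path_singleton[OF gc, of "P!3"] V a e by (auto simp: adj_compl)
    have "even (length ?R + length [P!0, P!3])"
    proof (rule berge_close[OF _ gc R S])
      show "berge (compl G)" using assms(1,2) berge_compl by blast
      show "set ?R \<inter> set [P!0, P!3] = {}" using e[of 1] e[of 2] e[of 0] e[of 3] V(2)[of 0] V(2)[of 3] Q(4) by auto
      show "length ?R + length [P!0, P!3] \<ge> 4" by simp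
      fix x y assume x: "x \<in> set ?R" and y: "y \<in> set [P!0, P!3]"
      have q: "adj G z (P!0)" "adj G z (P!3)" if "z \<in> set Q" for z
        using that Q(4) assms(7,8) sy[of z] unfolding complete_def by blast+
      have qn: "z \<noteq> P!1 \<and> z \<noteq> P!2" if "z \<in> set Q" for z using that Q(4) V(2)[of 1] V(2)[of 2] by auto
      show "adj (compl G) x y \<longleftrightarrow> (x = last ?R \<and> y = hd [P!0, P!3]) \<or> (x = hd ?R \<and> y = last [P!0, P!3])"
        using x y q qn a[of 1 0] a[of 1 3] a[of 2 0] a[of 2 3] e[of 1 0] e[of 1 2] e[of 1 3] e[of 2 0] e[of 2 3] e[of 0 3] e[of 2 1] V(1)
        unfolding adj_compl by auto
    qed
    then show ?thesis using False by simp
  qed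
qed

text \<open>Induction on the size of \<open>X\<close>, deleting vertices that leave it
  anticonnected. A one-vertex \<open>X\<close> closes \<open>P\<close> to an odd hole; paths on four
  vertices come from \<open>rr_length4\<close>, and longer ones are contradictory by counting which
  deletable vertices can be served by the second and second-to-last vertex of
  \<open>P\<close>.\<close>

theorem rr_anticonnected:
  assumes "graph G" "berge G" "\<not> has_long_prism G" "X \<subseteq> verts G" "conn (compl G) X"
  shows "rr G X"
  using assms(4,5)
proof (induction "card X" arbitrary: X rule: less_induct)
  case (less X)
  note XV = less.prems(1) and ac = less.prems(2)
  note gc = graph_compl[OF assms(1)]
  have fin: "finite X" using XV finite_verts[OF assms(1)] finite_subset by blast
  have IH: "rr G T" if "T \<subset> X" "conn (compl G) T" for T
    using less.hyps[OF psubset_card_mono[OF fin that(1)]] that XV by blast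
  have sy: "adj G u v \<longleftrightarrow> adj G v u" for u v using adj_sym[OF assms(1)] .
  have nbr: "\<exists>y\<in>S. y \<noteq> s \<and> \<not> adj G s y" if "conn (compl G) S" "s \<in> S" "S \<noteq> {s}" for s S
    using conn_nbr[OF that] unfolding adj_compl by blast
  show ?case
  proof (rule rrI[OF assms(1,2)])
    fix P assume P: "is_path G P" "even (length P)" "length P \<ge> 4" "set P \<inter> X = {}"
      "complete G (P!0) X" "complete G (P!(length P - 1)) X"
      "\<And>i. 0 < i \<Longrightarrow> i < length P - 1 \<Longrightarrow> \<not> complete G (P!i) X"
    let ?n = "length P"
    have ne: "P \<noteq> []" using P(3) by auto
    show "length P = 4 \<and> oddp (compl G) (P!1) (P!2) X"
    proof (cases "\<exists>t. X = {t}")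
      case True
      then obtain t where t: "X = {t}" by blast
      have at: "adj G t (P!i) \<longleftrightarrow> i = 0 \<or> i = ?n - 1" if "i < ?n" for i
      proof (cases "i = 0 \<or> i = ?n - 1")
        case True
        then show ?thesis using P(5,6) sy[of t "P!i"] unfolding t complete_def by auto
      next
        case False
        then have "0 < i" "i < ?n - 1" using that by auto
        then show ?thesis using P(7)[of i] False sy[of t "P!i"] unfolding t complete_def by blast
      qed
      have "odd ?n"
      proof (rule berge_close1[OF assms(2,1) _ P(1), of t])
        show "t \<in> verts G" "t \<notin> set P" "?n \<ge> 3" using t XV P(3,4) by auto
        show "adj G t y \<longleftrightarrow> y = hd P \<or> y = last P" if y: "y \<in> set P" for y
        proof -
          obtain i where i: "i < ?n" "y = P!i" using y by (metis in_set_conv_nth)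
          show ?thesis unfolding i(2) at[OF i(1)] hd_conv_nth[OF ne] last_conv_nth[OF ne]
            using is_path_nth_eq[OF P(1) i(1), of 0] is_path_nth_eq[OF P(1) i(1), of "?n - 1"] ne by simp
        qed
      qed
      then show ?thesis using P(2) by simp
    next
      case nsing: False
      have ncomplete: "\<not> complete G t (X - {t})" if "t \<in> X" for t
        using nbr[OF ac that] nsing unfolding complete_def by blast
      obtain x where x: "x \<in> X" using ac unfolding conn_def by blast
      then have xX: "{x} \<subset> X" using nsing by blast
      obtain t where t: "t \<in> X" "conn (compl G) (X - {t})"
        by (rule conn_noncut[OF gc fin ac conn_singleton xX]) (use that in blast)
      then have tX: "{t} \<subset> X" using nsing by blast
      obtain t' where t': "t' \<in> X" "t' \<noteq> t" "conn (compl G) (X - {t'})"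
        by (rule conn_noncut[OF gc fin ac conn_singleton tX]) (use that in blast)
      have rrt: "rr G (X - {s})" if "s \<in> X" "conn (compl G) (X - {s})" for s using IH that by blast
      show ?thesis
      proof (cases "?n = 4")
        case True
        have in4: "\<not> complete G (P!1) X" "\<not> complete G (P!2) X" "complete G (P!3) X" using P(6,7) True by auto
        \<comment> \<open>Without the odd antipath, each deletable \<open>s\<close> makes
          \<open>P!1\<close> or \<open>P!2\<close> complete to \<open>X - {s}\<close>. Neither
          vertex can do this for both \<open>t\<close> and \<open>t'\<close>, so they are divided
          between the two and \<open>rr_length4\<close> applies.\<close>
        have alt: "oddp (compl G) (P!1) (P!2) X \<or> complete G (P!1) (X - {s}) \<or> complete G (P!2) (X - {s})"
          if s: "s \<in> X" "conn (compl G) (X - {s})" for s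
        proof -
          have "complete G (hd P) (X - {s})" "complete G (last P) (X - {s})"
            using P(5,6) unfolding hd_conv_nth[OF ne] last_conv_nth[OF ne] complete_def by auto
          moreover have "set P \<inter> (X - {s}) = {}" using P(4) by blast
          ultimately have "(\<exists>i. Suc i < ?n \<and> complete G (P!i) (X - {s}) \<and> complete G (P!Suc i) (X - {s}))
             \<or> (?n = 4 \<and> oddp (compl G) (P!1) (P!2) (X - {s}))"
            using rrt[OF s] P(1,2) unfolding rr_def by blast
          then show ?thesis
          proof
            assume "\<exists>i. Suc i < ?n \<and> complete G (P!i) (X - {s}) \<and> complete G (P!Suc i) (X - {s})"
            then obtain i where i: "Suc i < 4" "complete G (P!i) (X - {s})" "complete G (P!Suc i) (X - {s})" using True by auto
            then have "i = 0 \<or> i = 1 \<or> i = 2" by auto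
            then show ?thesis using i by (auto simp: numeral_2_eq_2)
          next
            assume "?n = 4 \<and> oddp (compl G) (P!1) (P!2) (X - {s})"
            then show ?thesis using oddp_mono[of _ _ _ "X - {s}" X] by blast
          qed
        qed
        have nb: "\<not> (complete G p (X - {t}) \<and> complete G p (X - {t'}))" if "\<not> complete G p X" for p
          using that t'(2) unfolding complete_def by blast
        note L = rr_length4[OF assms(1,2) P(1) True P(4) XV P(5) in4(3,1,2) ac]
        have "oddp (compl G) (P!1) (P!2) X"
        proof (rule ccontr)
          assume no: "\<not> ?thesis"
          then show False using alt[OF t] alt[OF t'(1,3)] nb[OF in4(1)] nb[OF in4(2)] L[OF t(1) t'(1)] L[OF t'(1) t(1)] t'(2)
            by blast
        qed
        then show ?thesis using True by simp
      next
        case False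
        then have n6: "?n \<ge> 6" using P(2,3) by (cases "?n = 5") auto
        interpret rr_path G P X
          by unfold_locales (use assms(1,2) P n6 XV in auto)
        have hats: "complete G (P!1) (X - {s}) \<or> complete G (P!(?n-2)) (X - {s})" if "s \<in> X" "conn (compl G) (X - {s})" for s
          using hat[OF that(1) rrt[OF that] ncomplete[OF that(1)]] .
        have False
        proof (cases "X = {t, t'}")
          case True
          then have "X - {t} = {t'}" "X - {t'} = {t}" using t'(2) by auto
          then have "rr G {t}" "rr G {t'}" "\<not> adj G t t'" using rrt[OF t] rrt[OF t'(1,3)] ncomplete[OF t(1)]
            unfolding complete_def by auto
          then show False using rr_pair[OF assms(3) True t'(2)[symmetric]] by blast
        next
          case False
          obtain c where c: "c \<in> X" "c \<noteq> t" "\<not> adj G t c" using nbr[OF ac t(1)] nsing by blast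
          have "X - {t} \<noteq> {c}"
          proof
            assume e: "X - {t} = {c}"
            then have "t' = c" using t'(1,2) by blast
            then have "X = {t, t'}" using e t(1) by blast
            then show False using False by simp
          qed
          then have cX: "{c} \<subset> X - {t}" using c by blast
          have fin': "finite (X - {t})" using fin by simp
          \<comment> \<open>Keeping the nonneighbour \<open>c\<close> of \<open>t\<close> makes
            \<open>X - {v}\<close> anticonnected as well as \<open>X - {t, v}\<close>:
            \<open>t\<close> is attached again through \<open>c\<close>.\<close>
          obtain v where v: "v \<in> X" "v \<noteq> t" "v \<noteq> c" "conn (compl G) (X - {t} - {v})"
            by (rule conn_noncut[OF gc fin' t(2) conn_singleton cX]) (use that in blast)
          have Z: "X - {t} - {v} = X - {t, v}" by blast
          have "adj (compl G) t c" unfolding adj_compl using c t XV by auto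
          then have "conn (compl G) (insert t (X - {t} - {v}))"
            using conn_insert[OF gc v(4), of c t] c v by blast
          moreover have "insert t (X - {t} - {v}) = X - {v}" using t v by blast
          ultimately have cv: "conn (compl G) (X - {v})" by simp
          show False
          proof (cases "adj G t v")
            case True
            show False
            proof (rule rr_adjacent[OF t(1) v(1) v(2)[symmetric] True])
              show "conn (compl G) (X - {t, v})" using v(4) Z by simp
              have "c \<in> X - {t, v}" using c v by simp
              then show "\<not> complete G t (X - {t, v})" using c(3) unfolding complete_def by (intro notI) simp
              have "v \<in> X - {t}" "c \<in> X - {t}" using c(1,2) v(1,2) by simp_all
              then have vX: "v \<in> X - {t}" "X - {t} \<noteq> {v}" using v(3) by (simp, metis singletonD)
              obtain y where y: "y \<in> X - {t}" "y \<noteq> v" "\<not> adj G v y" using nbr[OF t(2) vX] by (elim bexE conjE) (rule that)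
              then have "y \<in> X - {t, v}" by simp
              then show "\<not> complete G v (X - {t, v})" using y(3) unfolding complete_def by (intro notI) simp
              show "rr G (X - {t})" "rr G (X - {v})" using rrt t v cv by blast+
              show "rr G (X - {t, v})" using v(4) Z t(1) by (intro IH) auto
            qed
          next
            case nadj: False
            have "adj (compl G) t v" unfolding adj_compl using nadj t v XV by auto
            then have ctv: "conn (compl G) {t, v}" using conn_insert[OF gc conn_singleton, of v v t] by simp
            have "{t, v} \<subseteq> X" "c \<notin> {t, v}" using t(1) v c(2) by auto
            then have tv: "{t, v} \<subset> X" using c(1) by blast
            \<comment> \<open>\<open>{t, v}\<close> is anticonnected, so a third deletable vertex
              exists outside it. Three vertices then compete for the two places \<open>P!1\<close>
              and \<open>P!(?n-2)\<close>, each of which can serve only one.\<close>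
            obtain w where w: "w \<in> X" "w \<noteq> t" "w \<noteq> v" "conn (compl G) (X - {w})"
              by (rule conn_noncut[OF gc fin ac ctv tv]) (use that in blast)
            have n1: "0 < (1::nat)" "1 < ?n - 1" "0 < ?n - 2" "?n - 2 < ?n - 1" using n6 by auto
            show False
              using hats[OF t] hats[OF v(1) cv] hats[OF w(1,4)]
                not_both[OF v(2) n1(1,2)] not_both[OF w(2) n1(1,2)] not_both[OF w(3) n1(1,2)]
                not_both[OF v(2) n1(3,4)] not_both[OF w(2) n1(3,4)] not_both[OF w(3) n1(3,4)] by blast
          qed
        qed
        then show ?thesis ..
      qed
    qed
  qed
qed

section \<open>Balanced skew partitions from loose ones\<close>

text \<open>Prism-freeness is asked of the complement too, so that the Roussel--Rubio lemma is
  available for paths and for antipaths.\<close>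

definition nice :: "'a graph \<Rightarrow> bool" where
  "nice G \<longleftrightarrow> graph G \<and> berge G \<and> \<not> has_long_prism G \<and> \<not> has_long_prism (compl G)"

lemma nice_compl: "nice G \<Longrightarrow> nice (compl G)"
  unfolding nice_def using graph_compl berge_compl by auto

lemma niceD: "nice G \<Longrightarrow> graph G" "nice G \<Longrightarrow> berge G"
  unfolding nice_def by auto

text \<open>The form applied to partitions: as no inner vertex is complete to \<open>X\<close>, two
  consecutive complete vertices cannot occur, so the exceptional outcome holds and the interior
  consists of two vertices.\<close>

lemma rr_oddp:
  assumes "nice G" "X \<subseteq> verts G" "conn (compl G) X" "is_path G (u # Q @ [v])" "Q \<noteq> []" "even (length Q)"
    "set Q \<inter> X = {}" "complete G u X" "complete G v X" "\<And>q. q \<in> set Q \<Longrightarrow> \<not> complete G q X"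
  obtains x y where "Q = [x, y]" "oddp (compl G) x y X"
proof -
  note gr = niceD(1)[OF assms(1)]
  have rr: "rr G X" using rr_anticonnected[OF gr] assms(1-3) unfolding nice_def by blast
  let ?R = "u # Q @ [v]"
  have nX: "z \<notin> X" if "complete G z X" for z using that adj_irrefl[OF gr] unfolding complete_def by blast
  have "length Q \<ge> 2" using assms(5,6) by (cases Q) (auto simp: Suc_le_eq)
  then have "length ?R = 4 \<and> oddp (compl G) (?R!1) (?R!2) X"
    using rr_odd[OF rr assms(4)] assms(6-10) nX[OF assms(8)] nX[OF assms(9)] by auto
  moreover then have "length Q = 2" by simp
  then obtain x y where "Q = [x, y]" by (auto simp: numeral_2_eq_2 length_Suc_conv)
  ultimately show ?thesis using that by simp
qed

text \<open>The first path followed by the reversed interior of the second goes around a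
  hole.\<close>

lemma paths_parity:
  assumes "graph G" "berge G" "is_path G (u # Q @ [v])" "is_path G (u # R @ [v])" "Q \<noteq> []" "R \<noteq> []"
    "set Q \<inter> set R = {}" "\<And>x y. x \<in> set Q \<Longrightarrow> y \<in> set R \<Longrightarrow> \<not> adj G x y"
  shows "even (length Q + length R)"
proof -
  note Q = assms(3)[unfolded is_path_ends[OF assms(1,5)]] and R = assms(4)[unfolded is_path_ends[OF assms(1,6)]]
  have "even (length (u # Q @ [v]) + length (rev R))"
  proof (rule berge_close[OF assms(2,1,3)])
    show "is_path G (rev R)" using R by simp
    show "set (u # Q @ [v]) \<inter> set (rev R) = {}" using Q R assms(7) by auto
    show "4 \<le> length (u # Q @ [v]) + length (rev R)" using assms(5,6) by (cases Q; cases R) auto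
    fix x y assume x: "x \<in> set (u # Q @ [v])" and y: "y \<in> set (rev R)"
    have "x = u \<or> x = v \<or> x \<in> set Q" "y \<in> set R" using x y by auto
    then show "adj G x y \<longleftrightarrow> (x = last (u # Q @ [v]) \<and> y = hd (rev R)) \<or> (x = hd (u # Q @ [v]) \<and> y = last (rev R))"
      using Q R assms(8)[of x y] by (auto simp: hd_rev last_rev)
  qed
  then show ?thesis by simp
qed

lemma inner_conn: "graph G \<Longrightarrow> Q \<noteq> [] \<Longrightarrow> is_path G (u # Q @ [v]) \<Longrightarrow> conn G (set Q)"
  by (simp add: is_path_ends is_path_set_conn)

lemma path_ends_nonadj: "graph G \<Longrightarrow> Q \<noteq> [] \<Longrightarrow> is_path G (u # Q @ [v]) \<Longrightarrow> u \<noteq> v \<and> \<not> adj G u v \<and> u \<in> verts G \<and> v \<in> verts G"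
  by (simp add: is_path_ends)

lemma antipath_ends_adj: "graph G \<Longrightarrow> Q \<noteq> [] \<Longrightarrow> is_path (compl G) (u # Q @ [v]) \<Longrightarrow> u \<noteq> v \<and> adj G u v"
  using path_ends_nonadj[of "compl G" Q u v] graph_compl[of G] unfolding adj_compl by auto

text \<open>By the Roussel--Rubio lemma, an odd path through \<^term>\<open>A1\<close> with ends complete to \<^term>\<open>W\<close> would give an
  odd antipath through \<^term>\<open>W\<close>; every other odd path or antipath is transferred by parity of holes and antiholes.\<close>

lemma good_extend:
  assumes nice: "nice G" and AB: "A \<union> B = verts G" "A \<inter> B = {}"
    and A1: "A1 \<subseteq> A" "conn G A1" "\<And>x y. x \<in> A1 \<Longrightarrow> y \<in> A - A1 \<Longrightarrow> \<not> adj G x y"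
    and W: "W \<subseteq> B" "conn (compl G) W" "\<And>x y. x \<in> W \<Longrightarrow> y \<in> B - W \<Longrightarrow> adj G x y"
    and nbr: "\<And>b. b \<in> B \<Longrightarrow> \<not> anticomplete G b A1" and nonnbr: "\<And>a. a \<in> A1 \<Longrightarrow> \<not> complete G a W"
    and g: "good G A1 W"
  shows "good G A B"
proof -
  note gr = niceD(1)[OF nice] and bg = niceD(2)[OF nice]
  note gc = graph_compl[OF gr]
  have sy: "adj G u v \<longleftrightarrow> adj G v u" for u v using adj_sym[OF gr] .
  have V: "A1 \<subseteq> verts G" "W \<subseteq> verts G" "A \<subseteq> verts G" "B \<subseteq> verts G" using AB A1 W by auto
  have WA: "W \<inter> A = {}" using W AB by blast
  have p1: "\<not> oddp G u v A1" if uv: "u \<in> B" "v \<in> B" for u v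
  proof
    assume "oddp G u v A1"
    then obtain Q where Q: "Q \<noteq> []" "set Q \<subseteq> A1" "even (length Q)" "is_path G (u # Q @ [v])"
      unfolding oddp_def by blast
    have "\<not> adj G u v" "\<not> adj G v u" using path_ends_nonadj[OF gr Q(1,4)] sy[of u v] by blast+
    then consider "u \<in> W" "v \<in> W" | "u \<in> B - W" "v \<in> B - W"
      using W(3)[of u v] W(3)[of v u] uv by blast
    then show False
    proof cases
      case 1
      then show False using g \<open>oddp G u v A1\<close> unfolding good_def by blast
    next
      case 2
      have cu: "complete G u W" "complete G v W" using W(3) 2 sy[of u] sy[of v] unfolding complete_def by blast+
      obtain x y where xy: "Q = [x, y]" "oddp (compl G) x y W"
      proof (rule rr_oddp[OF nice V(2) W(2) Q(4,1,3) _ cu])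
        show "set Q \<inter> W = {}" using Q(2) A1(1) WA by blast
        show "\<not> complete G q W" if "q \<in> set Q" for q using nonnbr that Q(2) by blast
      qed (rule that)
      then have "x \<in> A1" "y \<in> A1" using Q(2) by auto
      then show False using g xy unfolding good_def by blast
    qed
  qed
  have p2: "\<not> oddp G u v A" if uv: "u \<in> B" "v \<in> B" for u v
  proof
    assume "oddp G u v A"
    then obtain Q where Q: "Q \<noteq> []" "set Q \<subseteq> A" "even (length Q)" "is_path G (u # Q @ [v])"
      unfolding oddp_def by blast
    note uvn = path_ends_nonadj[OF gr Q(1,4)]
    have "set Q \<subseteq> A1 \<or> set Q \<subseteq> A - A1"
      by (rule conn_subset_cases[OF inner_conn[OF gr Q(1,4)]]) (use Q A1 in auto)
    then show False
    proof
      assume "set Q \<subseteq> A1"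
      then show False using p1[OF uv] Q unfolding oddp_def by blast
    next
      assume QA: "set Q \<subseteq> A - A1"
      obtain R where R: "R \<noteq> []" "set R \<subseteq> A1" "is_path G (u # R @ [v])"
        by (rule conn_path_through[OF gr A1(2) V(1), of u v]) (use uvn nbr uv that in auto)
      have "odd (length R)" using p1[OF uv] R unfolding oddp_def by blast
      moreover have "even (length Q + length R)"
        by (rule paths_parity[OF gr bg Q(4) R(3) Q(1) R(1)]) (use QA R(2) A1(3) sy in blast)+
      ultimately show False using Q(3) by simp
    qed
  qed
  have p3: "\<not> oddp (compl G) x y B" if xy: "x \<in> A" "y \<in> A" for x y
  proof
    assume "oddp (compl G) x y B"
    then obtain Q where Q: "Q \<noteq> []" "set Q \<subseteq> B" "even (length Q)" "is_path (compl G) (x # Q @ [y])"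
      unfolding oddp_def by blast
    note xyn = antipath_ends_adj[OF gr Q(1,4)]
    have "adj G y x" using xyn sy by blast
    then consider "x \<in> A1" "y \<in> A1" | "x \<in> A - A1" "y \<in> A - A1"
      using A1(3)[of x y] A1(3)[of y x] xy xyn by blast
    then show False
    proof cases
      case 1
      have "set Q \<subseteq> W \<or> set Q \<subseteq> B - W"
        by (rule conn_subset_cases[OF inner_conn[OF gc Q(1,4)]]) (use Q W in \<open>auto simp: adj_compl\<close>)
      then show False
      proof
        assume "set Q \<subseteq> W"
        then have "oddp (compl G) x y W" unfolding oddp_def using Q by blast
        then show False using g 1 unfolding good_def by blast
      next
        assume QB: "set Q \<subseteq> B - W"
        have "x \<in> verts G" "x \<notin> W" "y \<in> verts G" "y \<notin> W" using xy V(3) WA by auto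
        note inV = this
        then have "\<not> anticomplete (compl G) x W" "\<not> anticomplete (compl G) y W"
          using nonnbr 1 anticomplete_compl[of x G W] anticomplete_compl[of y G W] V xy WA by auto
        then obtain R where R: "R \<noteq> []" "set R \<subseteq> W" "is_path (compl G) (x # R @ [y])"
          using conn_path_through[OF gc W(2), of x y] V(2) inV xyn by (auto simp: adj_compl)
        have "\<not> oddp (compl G) x y W" using g 1 unfolding good_def by blast
        then have "odd (length R)" using R unfolding oddp_def by blast
        moreover have "even (length Q + length R)"
        proof (rule paths_parity[OF gc _ Q(4) R(3) Q(1) R(1)])
          show "berge (compl G)" using bg berge_compl[OF gr] by simp
          show "set Q \<inter> set R = {}" using QB R(2) by blast
          show "\<not> adj (compl G) z w" if "z \<in> set Q" "w \<in> set R" for z w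
            using W(3)[of w z] sy[of z w] that QB R(2) unfolding adj_compl by blast
        qed
        ultimately show False using Q(3) by simp
      qed
    next
      case 2
      have c: "complete (compl G) x A1" "complete (compl G) y A1"
      proof -
        have "anticomplete G z A1" "z \<in> verts G" "z \<notin> A1" if "z \<in> A - A1" for z
          using that A1(3)[of _ z] V(3) sy[of z] unfolding anticomplete_def by blast+
        then show "complete (compl G) x A1" "complete (compl G) y A1"
          using 2 V(1) by (simp_all add: complete_compl)
      qed
      \<comment> \<open>The dual use of the Roussel--Rubio lemma: in the complement the ends
        \<open>x\<close>, \<open>y\<close> are complete to \<open>A1\<close>, which is anticonnected
        there. The outcome is an odd path of \<open>G\<close> through \<open>A1\<close> between two
        vertices of \<open>B\<close>, excluded by \<open>p1\<close>.\<close>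
      obtain b b' where b: "Q = [b, b']" "oddp (compl (compl G)) b b' A1"
      proof (rule rr_oddp[OF nice_compl[OF nice] _ _ Q(4,1,3) _ c])
        show "A1 \<subseteq> verts (compl G)" using V by simp
        show "conn (compl (compl G)) A1" using A1(2) gr by simp
        show "set Q \<inter> A1 = {}" using Q(2) A1(1) AB by blast
        show "\<not> complete (compl G) q A1" if "q \<in> set Q" for q
          using nbr[of q] complete_compl[of q G A1] that Q(2) V A1(1) AB by blast
      qed (rule that)
      then have "b \<in> B" "b' \<in> B" "oddp G b b' A1" using Q(2) gr by auto
      then show False using p1 by blast
    qed
  qed
  show ?thesis unfolding good_def using p2 p3 by blast
qed

section \<open>Partitions with an isolated vertex in \<open>A\<close>\<close>

lemma skewI:
  assumes "A \<union> B = verts G" "A \<inter> B = {}" "X \<noteq> {}" "X \<subseteq> A" "X \<noteq> A" "\<And>x y. x \<in> X \<Longrightarrow> y \<in> A - X \<Longrightarrow> \<not> adj G x y"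
    "Y \<noteq> {}" "Y \<subseteq> B" "Y \<noteq> B" "\<And>x y. x \<in> Y \<Longrightarrow> y \<in> B - Y \<Longrightarrow> adj G x y"
  shows "skew_partition G A B"
proof -
  have "disconnected_on G A" unfolding disconnected_on_def
    by (intro exI[of _ X] exI[of _ "A - X"]) (use assms(3-6) in auto)
  moreover have "disconnected_on (compl G) B" unfolding disconnected_on_def
    by (intro exI[of _ Y] exI[of _ "B - Y"]) (use assms(7-10) in \<open>auto simp: adj_compl\<close>)
  ultimately show ?thesis unfolding skew_partition_def using assms(1,2) by blast
qed

text \<open>\<open>a\<close> closes every odd path through \<open>A\<close> to an odd hole and every
  odd antipath through \<open>B\<close> to an odd antihole. A possible nonneighbour \<open>b\<close>
  of \<open>a\<close> in \<open>B\<close> is harmless: it is adjacent to all of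
  \<open>B - {b}\<close>, so it is neither an end of such a path nor an inner vertex of such an
  antipath.\<close>

lemma good_isolated:
  assumes gr: "graph G" and bg: "berge G" and AB: "A \<union> B = verts G" "A \<inter> B = {}"
    and a: "a \<in> A" "\<And>x. x \<in> A \<Longrightarrow> \<not> adj G a x"
    and b: "\<And>v. v \<in> B \<Longrightarrow> \<not> adj G a v \<Longrightarrow> v = b" "\<not> adj G a b \<Longrightarrow> b \<in> B \<Longrightarrow> complete G b (B - {b})"
  shows "good G A B"
proof -
  note gc = graph_compl[OF gr]
  have sy: "adj G u v \<longleftrightarrow> adj G v u" for u v using adj_sym[OF gr] .
  have aV: "a \<in> verts G" using a AB by blast
  have p: "\<not> oddp G u v A" if uv: "u \<in> B" "v \<in> B" for u v
  proof
    assume o: "oddp G u v A"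
    then obtain Q where Q: "Q \<noteq> []" "set Q \<subseteq> A" "even (length Q)" "is_path G (u # Q @ [v])"
      unfolding oddp_def by blast
    note n = path_ends_nonadj[OF gr Q(1,4)]
    have nu: "\<not> adj G v u" using n sy by blast
    have "a \<notin> set Q"
    proof
      assume aQ: "a \<in> set Q"
      have "set Q \<subseteq> {a} \<or> set Q \<subseteq> A - {a}"
        by (rule conn_subset_cases[OF inner_conn[OF gr Q(1,4)]]) (use Q a in auto)
      then have "set Q = {a}" using aQ by blast
      moreover have "distinct Q" using Q(4) unfolding is_path_def by simp
      ultimately have "length Q = 1" using distinct_card by fastforce
      then show False using Q(3) by simp
    qed
    have au: "adj G a u" "adj G a v"
      using b(1)[OF uv(1)] b(1)[OF uv(2)] b(2) uv n nu unfolding complete_def by blast+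
    have "odd (length (u # Q @ [v]))"
    proof (rule berge_close1[OF bg gr aV Q(4)])
      show "a \<notin> set (u # Q @ [v])" using \<open>a \<notin> set Q\<close> uv a AB by auto
      show "3 \<le> length (u # Q @ [v])" using Q(1) by (cases Q) auto
      show "adj G a z \<longleftrightarrow> z = hd (u # Q @ [v]) \<or> z = last (u # Q @ [v])" if "z \<in> set (u # Q @ [v])" for z
        using that au a(2) Q(2) by auto
    qed
    then show False using Q(3) by simp
  qed
  have q: "\<not> oddp (compl G) x y B" if xy: "x \<in> A" "y \<in> A" for x y
  proof
    assume o: "oddp (compl G) x y B"
    then obtain Q where Q: "Q \<noteq> []" "set Q \<subseteq> B" "even (length Q)" "is_path (compl G) (x # Q @ [y])"
      unfolding oddp_def by blast
    note n = antipath_ends_adj[OF gr Q(1,4)]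
    have xa: "x \<noteq> a" "y \<noteq> a" using n a(2) xy sy[of x a] by auto
    have QN: "adj G a z" if z: "z \<in> set Q" for z
    proof (rule ccontr)
      assume na: "\<not> adj G a z"
      then have zb: "z = b" using b(1) z Q(2) by blast
      have cb: "complete G b (B - {b})" using b(2) na zb z Q(2) by blast
      have "set Q \<subseteq> {b} \<or> set Q \<subseteq> B - {b}"
        by (rule conn_subset_cases[OF inner_conn[OF gc Q(1,4)]]) (use Q(2) cb in \<open>auto simp: adj_compl complete_def\<close>)
      then have "set Q = {b}" using z zb by blast
      moreover have "distinct Q" using Q(4) unfolding is_path_def by simp
      ultimately have "length Q = 1" using distinct_card by fastforce
      then show False using Q(3) by simp
    qed
    have "odd (length (x # Q @ [y]))"
    proof (rule berge_close1[OF _ gc _ Q(4)])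
      show "berge (compl G)" using bg berge_compl[OF gr] by simp
      show "a \<in> verts (compl G)" using aV by simp
      show "a \<notin> set (x # Q @ [y])" using xa Q(2) a AB by auto
      show "3 \<le> length (x # Q @ [y])" using Q(1) by (cases Q) auto
      have "adj (compl G) a x" "adj (compl G) a y" using xa a(2) xy aV AB unfolding adj_compl by auto
      then show "adj (compl G) a z \<longleftrightarrow> z = hd (x # Q @ [y]) \<or> z = last (x # Q @ [y])" if "z \<in> set (x # Q @ [y])" for z
        using that QN unfolding adj_compl by auto
    qed
    then show False using Q(3) by simp
  qed
  show ?thesis unfolding good_def using p q by blast
qed

text \<open>Taking all neighbours of \<open>a\<close> as the new \<open>B\<close> isolates
  \<open>a\<close> in the rest. \<open>W\<close> is complete to the other neighbours, which
  disconnects the complement of \<open>B\<close>, and \<open>r\<close> disconnects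
  \<open>A\<close>.\<close>

lemma balanced_isolated:
  assumes gr: "graph G" and bg: "berge G" and W: "W \<subseteq> verts G" "W \<noteq> {}"
    and a: "a \<in> verts G" "a \<notin> W" "complete G a W"
    and N: "\<And>v. adj G a v \<Longrightarrow> v \<notin> W \<Longrightarrow> complete G v W"
    and r: "r \<in> verts G" "r \<notin> W" "r \<noteq> a" "\<not> adj G a r"
    and b: "b \<in> verts G" "b \<notin> W" "b \<noteq> a" "complete G b W" "b \<noteq> r"
  shows "\<exists>A B. balanced_skew_partition G A B"
proof -
  have sy: "adj G u v \<longleftrightarrow> adj G v u" for u v using adj_sym[OF gr] .
  let ?N = "{v. adj G a v}"
  have NV: "?N \<subseteq> verts G" using adj_verts[OF gr] by blast
  have WN: "W \<subseteq> ?N" using a unfolding complete_def by blast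
  have irr: "\<not> adj G a a" using adj_irrefl[OF gr] .
  have "\<exists>A B. skew_partition G A B \<and> good G A B"
  proof (cases "?N = W")
    case True
    have nb: "\<not> adj G a b" using True b(2) by blast
    \<comment> \<open>With no neighbours of \<open>a\<close> outside \<open>W\<close>, the
      neighbourhood alone need not be disconnected in the complement; \<open>b\<close>, complete to
      \<open>W\<close>, is added to split it, and \<open>r\<close> stays behind in \<open>A\<close>
      because \<open>b\<close> differs from \<open>r\<close>.\<close>
    let ?B = "insert b W" and ?A = "verts G - insert b W"
    have sk: "skew_partition G ?A ?B"
    proof (rule skewI[of ?A ?B G "{a}" W])
      show "?A \<union> ?B = verts G" using b W by blast
      show "{a} \<subseteq> ?A" using a b by blast
      show "{a} \<noteq> ?A" using r b by blast
      show "\<not> adj G x y" if "x \<in> {a}" "y \<in> ?A - {a}" for x y using that True by blast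
      show "adj G x y" if "x \<in> W" "y \<in> ?B - W" for x y using that b(4) sy[of b x] unfolding complete_def by blast
    qed (use W b in blast)+
    have "good G ?A ?B"
    proof (rule good_isolated[OF gr bg, of _ _ a b])
      show "\<not> adj G a x" if "x \<in> ?A" for x using True that by blast
      show "complete G b (?B - {b})" using b(4) unfolding complete_def by blast
      show "v = b" if "v \<in> ?B" "\<not> adj G a v" for v using that WN by blast
    qed (use a b W in blast)+
    then show ?thesis using sk by blast
  next
    case False
    let ?A = "verts G - ?N"
    have sk: "skew_partition G ?A ?N"
    proof (rule skewI[of ?A ?N G "{a}" W])
      show "?A \<union> ?N = verts G" using NV by blast
      show "{a} \<subseteq> ?A" using a irr by blast
      show "{a} \<noteq> ?A" using r by blast
      show "adj G x y" if "x \<in> W" "y \<in> ?N - W" for x y using that N[of y] sy[of y x] unfolding complete_def by blast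
    qed (use W WN False in blast)+
    have "good G ?A ?N"
      by (rule good_isolated[OF gr bg, of _ _ a a]) (use NV a irr in blast)+
    then show ?thesis using sk by blast
  qed
  then show ?thesis using balanced_iff_good[OF gr] by blast
qed

text \<open>What remains of a loose skew partition when only a component and an anticomponent are
  kept. The definition does not mention the partition, and the complement exchanges \<open>A\<close>
  and \<open>W\<close>. The last clause demands a second vertex outside besides the witness
  \<open>b\<close>, so that there is enough left over to build a new partition.\<close>

definition loose_pair :: "'a graph \<Rightarrow> 'a set \<Rightarrow> 'a set \<Rightarrow> bool" where
  "loose_pair G A W \<longleftrightarrow> A \<subseteq> verts G \<and> W \<subseteq> verts G \<and> A \<inter> W = {} \<and> conn G A \<and> conn (compl G) W \<and>
    (\<forall>v\<in>verts G - (A \<union> W). anticomplete G v A \<or> complete G v W) \<and>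
    (\<exists>b\<in>verts G - (A \<union> W). anticomplete G b A \<and> complete G b W \<and> verts G - (A \<union> W) \<noteq> {b})"

lemma loose_pair_compl:
  assumes "graph G" "loose_pair G A W"
  shows "loose_pair (compl G) W A"
proof -
  have V: "A \<subseteq> verts G" "W \<subseteq> verts G" using assms unfolding loose_pair_def by auto
  have *: "verts G - (A \<union> W) = verts G - (W \<union> A)" by blast
  have 1: "anticomplete (compl G) v W \<longleftrightarrow> complete G v W" "complete (compl G) v A \<longleftrightarrow> anticomplete G v A"
    if "v \<in> verts G - (W \<union> A)" for v
    using that complete_compl[of v G A] anticomplete_compl[of v G W] V by auto
  show ?thesis using assms 1 unfolding loose_pair_def * verts_compl compl_compl[OF assms(1)] Int_commute[of W A]
    by (smt (verit))
qed

section \<open>From loose pairs to balanced skew partitions\<close>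

lemma loose_pair_good:
  assumes "graph G" "berge G" "loose_pair G A W"
  shows "good G A W"
proof -
  have sy: "adj G u v \<longleftrightarrow> adj G v u" for u v using adj_sym[OF assms(1)] .
  have V: "A \<subseteq> verts G" "W \<subseteq> verts G" using assms unfolding loose_pair_def by auto
  obtain b where b: "b \<in> verts G - (A \<union> W)" "anticomplete G b A" "complete G b W"
    using assms unfolding loose_pair_def by blast
  have "\<not> oddp G u v A" if uv: "u \<in> W" "v \<in> W" for u v
  proof
    assume "oddp G u v A"
    then show False
      by (rule oddp_close[OF assms(2,1), of u v A b]) (use b uv in \<open>auto simp: complete_def anticomplete_def\<close>)
  qed
  moreover have "\<not> oddp (compl G) x y W" if xy: "x \<in> A" "y \<in> A" for x y
  proof
    assume "oddp (compl G) x y W"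
    then show False
      by (rule anti_close[OF assms(2,1), of x y W b]) (use b xy V in \<open>auto simp: complete_def anticomplete_def\<close>)
  qed
  ultimately show ?thesis unfolding good_def by blast
qed

text \<open>The new \<open>B\<close> is \<open>W\<close> together with the outside vertices that
  have a neighbour in \<open>A1\<close>; these are complete to \<open>W\<close>. In the new
  \<open>A\<close>, \<open>A1\<close> is a component and the witness \<open>b\<close> lies beside
  it. \<open>good_extend\<close> applies because the witness already makes the pair
  \<open>A1\<close>, \<open>W\<close> good.\<close>

lemma loose_balanced_neighbour:
  assumes "nice G" "loose_pair G A1 W" "\<And>w. w \<in> W \<Longrightarrow> \<not> anticomplete G w A1" "\<And>a. a \<in> A1 \<Longrightarrow> \<not> complete G a W"
    "n0 \<in> verts G - (A1 \<union> W)" "\<not> anticomplete G n0 A1"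
  shows "\<exists>A B. balanced_skew_partition G A B"
proof -
  note gr = niceD(1)[OF assms(1)] and bg = niceD(2)[OF assms(1)]
  have sy: "adj G u v \<longleftrightarrow> adj G v u" for u v using adj_sym[OF gr] .
  note L = assms(2)[unfolded loose_pair_def]
  have V: "A1 \<subseteq> verts G" "W \<subseteq> verts G" "A1 \<inter> W = {}" "conn G A1" "conn (compl G) W" using L by auto
  have ne: "A1 \<noteq> {}" "W \<noteq> {}" using V unfolding conn_def by auto
  obtain b where b: "b \<in> verts G - (A1 \<union> W)" "anticomplete G b A1" "complete G b W" using L by blast
  define N where "N = {v \<in> verts G - (A1 \<union> W). \<not> anticomplete G v A1}"
  have NW: "complete G v W" if "v \<in> N" for v using that L unfolding N_def by blast
  have n0: "n0 \<in> N" using assms(5,6) unfolding N_def by blast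
  have bN: "b \<notin> N" using b unfolding N_def by blast
  let ?B = "W \<union> N" and ?A = "verts G - (W \<union> N)"
  have NV: "N \<subseteq> verts G" "N \<inter> A1 = {}" "N \<inter> W = {}" unfolding N_def by auto
  have AB: "?A \<union> ?B = verts G" "?A \<inter> ?B = {}" using V NV by auto
  have A1A: "A1 \<subseteq> ?A" using V NV by blast
  have bA: "b \<in> ?A" "b \<notin> A1" using b bN by auto
  have A1n: "\<not> adj G x y" if "x \<in> A1" "y \<in> ?A - A1" for x y
  proof -
    have "anticomplete G y A1" using that unfolding N_def by blast
    then show ?thesis using that sy[of x y] unfolding anticomplete_def by blast
  qed
  have Wn: "adj G x y" if "x \<in> W" "y \<in> ?B - W" for x y
    using NW[of y] that sy[of x y] unfolding complete_def by blast
  have WB: "W \<subseteq> ?B" by blast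
  have nW: "n0 \<notin> W" using n0 NV by blast
  have "skew_partition G ?A ?B"
    by (rule skewI[OF AB ne(1) A1A _ A1n ne(2) WB _ Wn]) (use bA n0 nW in blast)+
  moreover have "good G ?A ?B"
  proof (rule good_extend[OF assms(1) AB A1A V(4) A1n WB V(5) Wn])
    show "\<not> anticomplete G v A1" if "v \<in> ?B" for v using that assms(3) unfolding N_def by blast
    show "\<not> complete G a W" if "a \<in> A1" for a using assms(4) that by blast
    show "good G A1 W" by (rule loose_pair_good[OF gr bg assms(2)])
  qed
  ultimately show ?thesis using balanced_iff_good[OF gr] by blast
qed

text \<open>Replace \<open>A\<close> by a component of \<open>A - {a}\<close>. The vertex
  \<open>a\<close> moves outside, where it is allowed because it is complete to \<open>W\<close>,
  and the other components are anticomplete to the new set. The old witness remains, with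
  \<open>a\<close> as a second outside vertex.\<close>

lemma loose_pair_shrink:
  assumes gr: "graph G" and L: "loose_pair G A W" and a: "a \<in> A" "complete G a W" "A \<noteq> {a}"
  obtains A' where "A' \<subset> A" "loose_pair G A' W"
proof -
  have sy: "adj G u v \<longleftrightarrow> adj G v u" for u v using adj_sym[OF gr] .
  note L' = L[unfolded loose_pair_def]
  have V: "A \<subseteq> verts G" "W \<subseteq> verts G" "A \<inter> W = {}" using L' by auto
  obtain b where b: "b \<in> verts G - (A \<union> W)" "anticomplete G b A" "complete G b W" "verts G - (A \<union> W) \<noteq> {b}" using L' by blast
  obtain c where c: "c \<in> A - {a}" using a by blast
  then have cc: "{c} \<subseteq> A - {a}" by blast
  have "finite (A - {a})" using V(1) finite_verts[OF gr] finite_subset by blast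
  then obtain D where D: "{c} \<subseteq> D" "D \<subseteq> A - {a}" "conn G D" "\<And>x y. x \<in> D \<Longrightarrow> y \<in> (A - {a}) - D \<Longrightarrow> \<not> adj G x y"
    using component_exists[OF gr _ conn_singleton cc] by blast
  have "anticomplete G v D \<or> complete G v W" if v: "v \<in> verts G - (D \<union> W)" for v
  proof (cases "v \<in> A")
    case True
    then show ?thesis using a v D(4)[of _ v] sy[of v] unfolding anticomplete_def by (cases "v = a") auto
  next
    case False
    then have "anticomplete G v A \<or> complete G v W" using L' v by blast
    then show ?thesis using D(2) unfolding anticomplete_def by blast
  qed
  moreover have "b \<in> verts G - (D \<union> W)" "anticomplete G b D" using b D(2) unfolding anticomplete_def by blast+
  moreover have "verts G - (D \<union> W) \<noteq> {b}"
  proof -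
    have "a \<in> verts G - (D \<union> W)" "a \<noteq> b" using a b V D(2) by blast+
    then show ?thesis by blast
  qed
  moreover have "D \<subseteq> verts G" "D \<inter> W = {}" using D(2) V by blast+
  moreover have "conn (compl G) W" using L' by blast
  ultimately have "loose_pair G D W" unfolding loose_pair_def
    using V(2) D(3) b(3) by (intro conjI ballI bexI[of _ b]) simp_all
  moreover have "D \<subset> A" using D(2) a by blast
  ultimately show ?thesis using that by blast
qed

text \<open>The single vertex \<open>a\<close> becomes the isolated vertex of a new partition. The
  witness and a second outside vertex serve as the \<open>b\<close> and \<open>r\<close> of
  \<open>balanced_isolated\<close>, in an order depending on whether the second one is adjacent to
  \<open>a\<close>.\<close>

lemma loose_pair_singleton:
  assumes nice: "nice G" and L: "loose_pair G {a} W" and a: "complete G a W"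
  shows "\<exists>A B. balanced_skew_partition G A B"
proof -
  note gr = niceD(1)[OF nice] and bg = niceD(2)[OF nice]
  have sy: "adj G u v \<longleftrightarrow> adj G v u" for u v using adj_sym[OF gr] .
  note L' = L[unfolded loose_pair_def]
  have V: "a \<in> verts G" "W \<subseteq> verts G" "a \<notin> W" "W \<noteq> {}" using L' unfolding conn_def by auto
  obtain b where b: "b \<in> verts G - ({a} \<union> W)" "anticomplete G b {a}" "complete G b W" "verts G - ({a} \<union> W) \<noteq> {b}" using L' by blast
  obtain b' where b': "b' \<in> verts G - ({a} \<union> W)" "b' \<noteq> b" using b by blast
  have ab: "\<not> adj G a b" using b(2) sy[of a b] unfolding anticomplete_def by blast
  have N: "complete G v W" if "adj G a v" "v \<notin> W" for v
  proof -
    have "v \<in> verts G - ({a} \<union> W)" using that adj_verts[OF gr that(1)] adj_irrefl[OF gr, of a] by auto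
    then have "anticomplete G v {a} \<or> complete G v W" using L' by blast
    then show ?thesis using that(1) sy[of a v] unfolding anticomplete_def by blast
  qed
  have "\<not> adj G a b' \<or> complete G b' W" using N b' by blast
  then show ?thesis
  proof
    assume "\<not> adj G a b'"
    then show ?thesis using balanced_isolated[OF gr bg V(2,4,1,3) a N, of b' b] b(1,3) b' by auto
  next
    assume "complete G b' W"
    then show ?thesis using balanced_isolated[OF gr bg V(2,4,1,3) a N, of b b'] b(1) b' ab by auto
  qed
qed

text \<open>Any outside vertex \<open>a\<close> has all its neighbours in \<open>W\<close> or among
  outside vertices, and these are complete to \<open>W\<close>; so \<open>a\<close> can be isolated,
  with a vertex of \<open>A\<close> as the other side.\<close>

lemma loose_pair_separated:
  assumes nice: "nice G" and L: "loose_pair G A W"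
    and R: "\<And>v. v \<in> verts G - (A \<union> W) \<Longrightarrow> anticomplete G v A \<and> complete G v W"
  shows "\<exists>A B. balanced_skew_partition G A B"
proof -
  note gr = niceD(1)[OF nice] and bg = niceD(2)[OF nice]
  have sy: "adj G u v \<longleftrightarrow> adj G v u" for u v using adj_sym[OF gr] .
  note L' = L[unfolded loose_pair_def]
  have V: "A \<subseteq> verts G" "W \<subseteq> verts G" "A \<inter> W = {}" "W \<noteq> {}" "A \<noteq> {}" using L' unfolding conn_def by auto
  obtain b where b: "b \<in> verts G - (A \<union> W)" "verts G - (A \<union> W) \<noteq> {b}" using L' by blast
  obtain a where a: "a \<in> verts G - (A \<union> W)" "a \<noteq> b" using b by blast
  obtain r where r: "r \<in> A" using V by blast
  have "\<not> adj G a r" using R[OF a(1)] r unfolding anticomplete_def by blast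
  moreover have "complete G v W" if "adj G a v" "v \<notin> W" for v
  proof -
    have "v \<notin> A" using R[OF a(1)] that unfolding anticomplete_def by blast
    then show ?thesis using R[of v] that adj_verts[OF gr that(1)] by blast
  qed
  ultimately show ?thesis
    using balanced_isolated[OF gr bg V(2,4), of a r b] a b r R[OF a(1)] R[OF b(1)] V by blast
qed

text \<open>Induction on \<open>card A + card W\<close>. The graph is generalised because shrinking
  \<open>W\<close> is shrinking the first component of the pair in the complement. When neither set
  can shrink, an outside vertex either breaks the separation, and
  \<open>loose_balanced_neighbour\<close> applies in \<open>G\<close> or its complement, or no such
  vertex exists.\<close>

theorem loose_pair_balanced:
  fixes G :: "'a graph"
  assumes "nice G" "loose_pair G A W"
  shows "\<exists>A B. balanced_skew_partition G A B"
  using assms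
proof (induction "card A + card W" arbitrary: G A W rule: less_induct)
  case (less A W G)
  have step: "\<exists>A B. balanced_skew_partition H A B"
    if H: "nice H" "loose_pair H C D" "card C + card D = card A + card W" and c: "c \<in> C" "complete H c D"
    for H :: "'a graph" and C D c
  proof (cases "C = {c}")
    case True
    have "loose_pair H {c} D" using H(2) unfolding True .
    then show ?thesis by (rule loose_pair_singleton[OF H(1) _ c(2)])
  next
    case False
    obtain C' where C': "C' \<subset> C" "loose_pair H C' D"
      using loose_pair_shrink[OF niceD(1)[OF H(1)] H(2) c False] by blast
    have "finite C" using H(2) finite_verts[OF niceD(1)[OF H(1)]] finite_subset unfolding loose_pair_def by blast
    then have "card C' < card C" using C'(1) psubset_card_mono by blast
    then show ?thesis using less.hyps[of C' D H] H C' by simp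
  qed
  note gr = niceD(1)[OF less.prems(1)]
  note nc = nice_compl[OF less.prems(1)] and lc = loose_pair_compl[OF gr less.prems(2)]
  have V: "A \<subseteq> verts G" "W \<subseteq> verts G" "A \<inter> W = {}" using less.prems(2) unfolding loose_pair_def by auto
  have tr: "complete (compl G) v A \<longleftrightarrow> anticomplete G v A" if "v \<in> verts G" "v \<notin> A" for v
    using complete_compl[of v G A] that V by auto
  have tr': "anticomplete (compl G) v W \<longleftrightarrow> complete G v W" if "v \<in> verts G" "v \<notin> W" for v
    using anticomplete_compl[of v G W] that V by auto
  show ?case
  proof (cases "\<exists>a\<in>A. complete G a W")
    case True
    then show ?thesis using step[OF less.prems refl] by blast
  next
    case nA: False
    show ?thesis
    proof (cases "\<exists>w\<in>W. anticomplete G w A")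
      case True
      then obtain w where w: "w \<in> W" "complete (compl G) w A" using tr V by blast
      show ?thesis using step[OF nc lc add.commute w] balanced_exists_compl[OF gr] by blast
    next
      case nW: False
      show ?thesis
      proof (cases "\<forall>v\<in>verts G - (A \<union> W). anticomplete G v A \<and> complete G v W")
        case True
        then show ?thesis using loose_pair_separated[OF less.prems] by blast
      next
        case False
        then obtain v where v: "v \<in> verts G - (A \<union> W)" "\<not> anticomplete G v A \<or> \<not> complete G v W" by blast
        from v(2) show ?thesis
        proof
          assume "\<not> anticomplete G v A"
          then show ?thesis using loose_balanced_neighbour[OF less.prems _ _ v(1)] nA nW by blast
        next
          assume "\<not> complete G v W"
          then have "\<not> anticomplete (compl G) v W" using tr' v(1) by blast
          moreover have "v \<in> verts (compl G) - (W \<union> A)" using v(1) by auto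
          moreover have "\<not> anticomplete (compl G) a W" if "a \<in> A" for a using tr'[of a] nA that V by blast
          moreover have "\<not> complete (compl G) w A" if "w \<in> W" for w using tr[of w] nW that V by blast
          ultimately show ?thesis
            using loose_balanced_neighbour[OF nc lc] balanced_exists_compl[OF gr] by blast
        qed
      qed
    qed
  qed
qed

section \<open>Skew partitions that are not loose\<close>

lemma less_8: "i < 8 \<longleftrightarrow> i = 0 \<or> i = 1 \<or> i = 2 \<or> i = 3 \<or> i = 4 \<or> i = 5 \<or> i = 6 \<or> i = (7::nat)"
  by auto

lemma atLeastLessThan_8: "{0..<8} = {0, 1, 2, 3, 4, 5, 6, 7::nat}"
  by auto

lemma double_diamond_compl:
  assumes "graph G" "contains_induced (compl G) double_diamond"
  shows "contains_induced G double_diamond"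
proof -
  obtain f where f: "inj_on f {0..<8}" "f ` {0..<8} \<subseteq> verts G"
    "\<And>u v. u < 8 \<Longrightarrow> v < 8 \<Longrightarrow> adj (compl G) (f u) (f v) \<longleftrightarrow> adj double_diamond u v"
    using assms(2) unfolding contains_induced_def double_diamond_def by auto
  \<comment> \<open>An isomorphism of the double diamond to its complement: the
    \<open>a\<close>-side goes to \<open>a3, a4, b1, b2\<close>, in the complement a complete graph
    minus \<open>b1 b2\<close>, and the \<open>b\<close>-side to
    \<open>b4, b3, a2, a1\<close>.\<close>
  define h :: "nat \<Rightarrow> nat" where "h i = [2, 3, 4, 5, 7, 6, 1, 0] ! i" for i
  have h8: "h i < 8" if "i < 8" for i using that unfolding less_8 h_def by auto
  have inj: "inj_on h {0..<8}" unfolding atLeastLessThan_8 h_def by (simp add: inj_on_def)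
  have hh: "adj double_diamond i j \<longleftrightarrow> i \<noteq> j \<and> \<not> adj double_diamond (h i) (h j)" if "i < 8" "j < 8" for i j
    using that unfolding less_8 h_def double_diamond_def by (elim disjE) (simp_all add: doubleton_eq_iff)
  have "adj G (f (h i)) (f (h j)) \<longleftrightarrow> adj double_diamond i j" if ij: "i < 8" "j < 8" for i j
  proof -
    have "f (h i) \<in> verts G" "f (h j) \<in> verts G" using f(2) h8 ij by auto
    moreover have "f (h i) = f (h j) \<longleftrightarrow> i = j"
      using inj_onD[OF f(1), of "h i" "h j"] inj_onD[OF inj, of i j] h8 ij by auto
    ultimately show ?thesis
      using f(3)[OF h8 h8, OF ij] hh[OF ij] adj_compl_compl[OF assms(1), of "f (h i)" "f (h j)"] by auto
  qed
  moreover have "inj_on (f \<circ> h) {0..<8}"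
  proof (rule comp_inj_on[OF inj inj_on_subset[OF f(1)]])
    show "h ` {0..<8} \<subseteq> {0..<8}" using h8 by auto
  qed
  moreover have "(f \<circ> h) ` {0..<8} \<subseteq> verts G" using f(2) h8 by auto
  ultimately show ?thesis unfolding contains_induced_def
    by (intro exI[of _ "f \<circ> h"]) (auto simp: double_diamond_def)
qed

text \<open>\<open>K\<^sub>3\<^sub>,\<^sub>3\<close> minus the edge \<open>{2, 5}\<close>, a subdivision of \<open>K\<^sub>4\<close> with branch vertices 0, 1, 3, 4.\<close>

definition K33e_edges :: "nat set set" where
  "K33e_edges = {{0, 3}, {0, 4}, {0, 5}, {1, 3}, {1, 4}, {1, 5}, {2, 3}, {2, 4}}"

definition K33e :: "nat graph" where
  "K33e = \<lparr> verts = {0..<6}, adj = (\<lambda>u v. {u, v} \<in> K33e_edges) \<rparr>"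

lemma graph_K33e: "graph K33e"
  unfolding graph_def K33e_def K33e_edges_def by (auto simp: doubleton_eq_iff)

lemma bipartite_K33e: "bipartite K33e"
  unfolding bipartite_def K33e_def K33e_edges_def
  by (intro exI[of _ "\<lambda>v. v < 3"]) (auto simp: doubleton_eq_iff)

lemma less_4_pairs: "i < j \<and> j < (4::nat) \<longleftrightarrow> (i, j) \<in> {(0,1), (0,2), (0,3), (1,2), (1,3), (2,3)}"
  by auto

lemma subdivision_K33e: "subdivision_K4 K33e"
proof -
  define x :: "nat \<Rightarrow> nat" where "x i = [0, 1, 3, 4] ! i" for i
  \<comment> \<open>Two opposite edges of \<open>K4\<close> are subdivided, one by vertex 5 and one
    by vertex 2; the other four stay edges.\<close>
  define Q :: "nat \<Rightarrow> nat \<Rightarrow> nat list" where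
    "Q i j = (if (i, j) = (0, 1) then [0, 5, 1] else if (i, j) = (2, 3) then [3, 2, 4] else [x i, x j])" for i j
  have xs: "x 0 = 0" "x (Suc 0) = 1" "x 2 = 3" "x 3 = 4" unfolding x_def by simp_all
  have Qs: "Q 0 (Suc 0) = [0, 5, 1]" "Q 0 2 = [0, 3]" "Q 0 3 = [0, 4]" "Q (Suc 0) 2 = [1, 3]" "Q (Suc 0) 3 = [1, 4]" "Q 2 3 = [3, 2, 4]"
    unfolding Q_def by (simp_all add: xs)
  have inj: "inj_on x {0..<4}"
  proof -
    have "{0..<4} = {0, 1, 2, 3::nat}" by auto
    then show ?thesis by (simp add: xs)
  qed
  have p1: "length (Q i j) \<ge> 2 \<and> distinct (Q i j) \<and> hd (Q i j) = x i \<and> last (Q i j) = x j" if "i < j \<and> j < 4" for i j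
    using that unfolding less_4_pairs by (auto simp: Qs xs)
  have p2: "set (Q i j) \<inter> set (Q k l) \<subseteq> {x i, x j} \<inter> {x k, x l}"
    if "i < j \<and> j < 4 \<and> k < l \<and> l < 4 \<and> (i, j) \<noteq> (k, l)" for i j k l
  proof -
    have "(i, j) \<in> {(0,1), (0,2), (0,3), (1,2), (1,3), (2,3)}" "(k, l) \<in> {(0,1), (0,2), (0,3), (1,2), (1,3), (2,3)}" "(i, j) \<noteq> (k, l)"
      using that less_4_pairs by blast+
    then show ?thesis by (elim insertE emptyE) (simp_all add: Qs xs)
  qed
  have p3: "verts K33e = (\<Union>i\<in>{0..<4}. \<Union>j\<in>{i<..<4}. set (Q i j))"
  proof -
    have "{0..<4} = {0, Suc 0, 2, 3::nat}" "{0<..<4} = {Suc 0, 2, 3::nat}" "{Suc 0<..<4} = {2, 3::nat}" "{2<..<4} = {3::nat}" "{3<..<4} = ({}::nat set)"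
      by auto
    then have "(\<Union>i\<in>{0..<4}. \<Union>j\<in>{i<..<4}. set (Q i j)) = {0, 1, 2, 3, 4, 5}" by (auto simp: Qs)
    also have "\<dots> = {0..<6}" by auto
    finally show ?thesis by (simp add: K33e_def)
  qed
  have p4: "adj K33e u v \<longleftrightarrow> (\<exists>i j k. i < j \<and> j < 4 \<and> Suc k < length (Q i j) \<and> {u, v} = {Q i j ! k, Q i j ! Suc k})" for u v
  proof -
    have "(\<exists>i j k. i < j \<and> j < 4 \<and> Suc k < length (Q i j) \<and> {u, v} = {Q i j ! k, Q i j ! Suc k}) \<longleftrightarrow>
      (\<exists>i j. (i < j \<and> j < 4) \<and> (\<exists>k. Suc k < length (Q i j) \<and> {u, v} = {Q i j ! k, Q i j ! Suc k}))"
      by blast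
    also have "\<dots> \<longleftrightarrow> (\<exists>(i, j)\<in>{(0,1), (0,2), (0,3), (1,2), (1,3), (2,3)}. \<exists>k. Suc k < length (Q i j) \<and> {u, v} = {Q i j ! k, Q i j ! Suc k})"
      unfolding less_4_pairs by blast
    also have "\<dots> \<longleftrightarrow> {u, v} \<in> K33e_edges"
    proof -
      have e3: "(\<exists>k. Suc k < length [a, b, c] \<and> {u, v} = {[a, b, c] ! k, [a, b, c] ! Suc k}) \<longleftrightarrow> {u, v} = {a, b} \<or> {u, v} = {b, c}" for a b c
        by (simp add: less_Suc_eq numeral_2_eq_2 conj_disj_distribR ex_disj_distrib)
      have e2: "(\<exists>k. Suc k < length [a, b] \<and> {u, v} = {[a, b] ! k, [a, b] ! Suc k}) \<longleftrightarrow> {u, v} = {a, b}" for a b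
        by (simp add: less_Suc_eq conj_disj_distribR ex_disj_distrib)
      have c: "{5, 1::nat} = {1, 5}" "{3, 2::nat} = {2, 3}" by auto
      show ?thesis unfolding K33e_edges_def bex_simps prod.case One_nat_def Qs e2 e3 c[unfolded One_nat_def] insert_iff empty_iff
        by (intro iffI; elim disjE; simp only: simp_thms)
    qed
    finally show ?thesis by (simp add: K33e_def)
  qed
  show ?thesis unfolding subdivision_K4_def
    by (intro exI[of _ x] exI[of _ Q] conjI allI impI inj p3 p4) (use p1 p2 in blast)+
qed

lemma line_graph_K33e:
  "verts (line_graph K33e) = K33e_edges"
  "e \<in> K33e_edges \<Longrightarrow> e' \<in> K33e_edges \<Longrightarrow> adj (line_graph K33e) e e' \<longleftrightarrow> e \<noteq> e' \<and> e \<inter> e' \<noteq> {}"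
proof -
  have "\<exists>u v. e = {u, v}" if "e \<in> K33e_edges" for e
    using that unfolding K33e_edges_def by (elim insertE emptyE) (simp_all, blast+)
  moreover have "adj K33e u v \<longleftrightarrow> {u, v} \<in> K33e_edges" for u v by (simp add: K33e_def)
  ultimately have "{{u, v} | u v. adj K33e u v} = K33e_edges" by (auto, metis)
  then show "verts (line_graph K33e) = K33e_edges"
    "e \<in> K33e_edges \<Longrightarrow> e' \<in> K33e_edges \<Longrightarrow> adj (line_graph K33e) e e' \<longleftrightarrow> e \<noteq> e' \<and> e \<inter> e' \<noteq> {}"
    by (simp_all add: line_graph_def)
qed

text \<open>The triangles \<open>u q x\<close>, \<open>p v y\<close>, \<open>u p x'\<close>,
  \<open>q v y'\<close> are the edge stars at the branch vertices 0, 1, 3, 4; the edges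
  \<open>x y\<close> and \<open>x' y'\<close> come from the vertices 5 and 2 of degree two.\<close>

lemma contains_K33e:
  assumes gr: "graph G" and d: "distinct [u, q, x, p, v, y, x', y']" "{u, q, x, p, v, y, x', y'} \<subseteq> verts G"
    and e: "adj G u q" "adj G u x" "adj G q x" "adj G p v" "adj G p y" "adj G v y" "adj G u p" "adj G u x'" "adj G p x'"
      "adj G q v" "adj G q y'" "adj G v y'" "adj G x y" "adj G x' y'"
    and n: "\<not> adj G u v" "\<not> adj G p q" "\<not> adj G u y" "\<not> adj G u y'" "\<not> adj G q y" "\<not> adj G q x'" "\<not> adj G x p" "\<not> adj G x v"
      "\<not> adj G x x'" "\<not> adj G x y'" "\<not> adj G p y'" "\<not> adj G v x'" "\<not> adj G y x'" "\<not> adj G y y'"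
  shows "contains_induced G (line_graph K33e)"
proof -
  define f :: "nat set \<Rightarrow> 'a" where
    "f s = (if s = {0,3} then u else if s = {0,4} then q else if s = {0,5} then x else if s = {1,3} then p
       else if s = {1,4} then v else if s = {1,5} then y else if s = {2,3} then x' else y')" for s
  have sy: "\<And>a b. adj G a b \<Longrightarrow> adj G b a" "\<And>a b. \<not> adj G a b \<Longrightarrow> \<not> adj G b a" using adj_sym[OF gr] by blast+
  have irr: "\<not> adj G a a" for a using adj_irrefl[OF gr] .
  have fs: "f {0,3} = u" "f {0,4} = q" "f {0,5} = x" "f {Suc 0,3} = p" "f {Suc 0,4} = v" "f {Suc 0,5} = y" "f {2,3} = x'" "f {2,4} = y'"
    unfolding f_def by (simp_all add: doubleton_eq_iff)
  have "inj_on f K33e_edges" unfolding inj_on_def K33e_edges_def using d(1) by (simp add: fs) metis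
  moreover have "f ` K33e_edges \<subseteq> verts G" unfolding K33e_edges_def using d(2) by (simp add: fs)
  moreover have "\<forall>s\<in>K33e_edges. \<forall>s'\<in>K33e_edges. adj G (f s) (f s') \<longleftrightarrow> s \<noteq> s' \<and> s \<inter> s' \<noteq> {}"
    unfolding K33e_edges_def using e n e[THEN sy(1)] n[THEN sy(2)] by (simp add: fs irr doubleton_eq_iff)
  ultimately show ?thesis unfolding contains_induced_def line_graph_K33e(1)
    using line_graph_K33e(2) by (intro exI[of _ f]) auto
qed

lemma contains_double_diamond:
  assumes gr: "graph G" and d: "distinct [a1, a2, a3, a4, b1, b2, b3, b4]" "{a1, a2, a3, a4, b1, b2, b3, b4} \<subseteq> verts G"
    and e: "adj G a1 a2" "adj G a1 a3" "adj G a1 a4" "adj G a2 a3" "adj G a2 a4"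
      "adj G b1 b2" "adj G b1 b3" "adj G b1 b4" "adj G b2 b3" "adj G b2 b4"
      "adj G a1 b1" "adj G a2 b2" "adj G a3 b3" "adj G a4 b4"
    and n: "\<not> adj G a3 a4" "\<not> adj G b3 b4" "\<not> adj G a1 b2" "\<not> adj G a1 b3" "\<not> adj G a1 b4" "\<not> adj G a2 b1" "\<not> adj G a2 b3" "\<not> adj G a2 b4"
      "\<not> adj G a3 b1" "\<not> adj G a3 b2" "\<not> adj G a3 b4" "\<not> adj G a4 b1" "\<not> adj G a4 b2" "\<not> adj G a4 b3"
  shows "contains_induced G double_diamond"
proof -
  define f :: "nat \<Rightarrow> 'a" where "f i = [a1, a2, a3, a4, b1, b2, b3, b4] ! i" for i
  have sy: "\<And>a b. adj G a b \<Longrightarrow> adj G b a" "\<And>a b. \<not> adj G a b \<Longrightarrow> \<not> adj G b a" using adj_sym[OF gr] by blast+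
  have irr: "\<not> adj G a a" for a using adj_irrefl[OF gr] .
  have fs: "f 0 = a1" "f (Suc 0) = a2" "f 2 = a3" "f 3 = a4" "f 4 = b1" "f 5 = b2" "f 6 = b3" "f 7 = b4"
    unfolding f_def by simp_all
  have "inj_on f {0..<8}" unfolding atLeastLessThan_8 using d(1) by (simp add: fs)
  moreover have "f ` {0..<8} \<subseteq> verts G" unfolding atLeastLessThan_8 using d(2) by (simp add: fs)
  moreover have "\<forall>i\<in>{0..<8}. \<forall>j\<in>{0..<8}. adj G (f i) (f j) \<longleftrightarrow> adj double_diamond i j"
    unfolding atLeastLessThan_8 double_diamond_def using e n e[THEN sy(1)] n[THEN sy(2)]
    by (simp add: fs irr doubleton_eq_iff)
  moreover have "verts double_diamond = {0..<8}" by (simp add: double_diamond_def)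
  ultimately show ?thesis unfolding contains_induced_def by (intro exI[of _ f]) simp
qed

section \<open>Skew partitions with an odd path\<close>

lemma F5_compl: "graph G \<Longrightarrow> F5 G \<Longrightarrow> F5 (compl G)"
  unfolding F5_def using berge_compl[of G] by auto

lemma F6_compl: "graph G \<Longrightarrow> F6 G \<Longrightarrow> F6 (compl G)"
  unfolding F6_def using F5_compl double_diamond_compl by blast

text \<open>A vertex outside both sets lies in \<open>A\<close> and is then anticomplete to the
  component \<open>C\<close>, or lies in \<open>B\<close> and is complete to the anticomponent
  \<open>D\<close>. Only the witness \<open>b\<close> has to be supplied, and it may come from
  either side.\<close>

lemma component_loose_pair:
  assumes "graph G" "A \<union> B = verts G" "A \<inter> B = {}"
    and C: "C \<subseteq> A" "conn G C" "\<And>x y. x \<in> C \<Longrightarrow> y \<in> A - C \<Longrightarrow> \<not> adj G x y"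
    and D: "D \<subseteq> B" "conn (compl G) D" "\<And>x y. x \<in> D \<Longrightarrow> y \<in> B - D \<Longrightarrow> adj G x y"
    and b: "b \<in> verts G - (C \<union> D)" "anticomplete G b C" "complete G b D"
    and z: "z \<in> verts G - (C \<union> D)" "z \<noteq> b"
  shows "loose_pair G C D"
proof -
  have sy: "adj G u v \<longleftrightarrow> adj G v u" for u v using adj_sym[OF assms(1)] .
  have "anticomplete G v C \<or> complete G v D" if v: "v \<in> verts G - (C \<union> D)" for v
  proof (cases "v \<in> A")
    case True
    then show ?thesis using v C(3)[of _ v] sy[of v] unfolding anticomplete_def by blast
  next
    case False
    then show ?thesis using v assms(2) D(3)[of _ v] sy[of v] unfolding complete_def by blast
  qed
  moreover have "C \<subseteq> verts G" "D \<subseteq> verts G" "C \<inter> D = {}" using assms by blast+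
  moreover have "verts G - (C \<union> D) \<noteq> {b}" using z by blast
  ultimately show ?thesis unfolding loose_pair_def using C(2) D(2) b by blast
qed

lemma two_components:
  assumes gr: "graph G" and fin: "finite A" and dis: "disconnected_on G A" and C: "conn G C" "C \<subseteq> A"
  obtains A1 A2 where "C \<subseteq> A1" "A1 \<subseteq> A" "A2 \<subseteq> A" "A1 \<inter> A2 = {}" "conn G A1" "conn G A2"
    "\<And>x y. x \<in> A1 \<Longrightarrow> y \<in> A - A1 \<Longrightarrow> \<not> adj G x y" "\<And>x y. x \<in> A2 \<Longrightarrow> y \<in> A - A2 \<Longrightarrow> \<not> adj G x y"
proof -
  obtain A1 where A1: "C \<subseteq> A1" "A1 \<subseteq> A" "conn G A1" "\<And>x y. x \<in> A1 \<Longrightarrow> y \<in> A - A1 \<Longrightarrow> \<not> adj G x y"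
    using component_exists[OF gr fin C] by blast
  have "A1 \<noteq> A" using A1(3) dis unfolding conn_iff_not_disconnected by blast
  then obtain c where "c \<in> A - A1" using A1(2) by blast
  then have c: "{c} \<subseteq> A - A1" by blast
  have fin': "finite (A - A1)" using fin by simp
  obtain A2 where A2: "{c} \<subseteq> A2" "A2 \<subseteq> A - A1" "conn G A2" "\<And>x y. x \<in> A2 \<Longrightarrow> y \<in> A - A1 - A2 \<Longrightarrow> \<not> adj G x y"
    using component_exists[OF gr fin' conn_singleton c] by blast
  have "\<not> adj G x y" if "x \<in> A2" "y \<in> A - A2" for x y
  proof (cases "y \<in> A1")
    case True
    then have "\<not> adj G y x" using A1(4)[OF True, of x] that A2(2) by blast
    then show ?thesis using adj_sym[OF gr, of x y] by simp
  next
    case False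
    then show ?thesis using A2(4) that by blast
  qed
  then show ?thesis using that[OF A1(1,2) _ _ A1(3) A2(3) A1(4)] A2(2) by blast
qed

lemma balanced_exists_if_odd_path:
  assumes gr: "graph G" and F6: "F6 G" and skew: "skew_partition G A B" and uv: "u \<in> B" "v \<in> B" and o: "oddp G u v A"
  shows "\<exists>A B. balanced_skew_partition G A B"
proof (rule ccontr)
  assume nbal: "\<not> ?thesis"
  have nice: "nice G" using gr F6 unfolding nice_def F6_def F5_def by blast
  note bg = niceD(2)[OF nice] and gc = graph_compl[OF gr] and nicec = nice_compl[OF nice]
  have sy: "adj G a b \<longleftrightarrow> adj G b a" for a b using adj_sym[OF gr] .
  have noloose: "\<not> loose_pair G C D" for C D using loose_pair_balanced[OF nice] nbal by blast
  have AB: "A \<union> B = verts G" "A \<inter> B = {}" "disconnected_on G A" "disconnected_on (compl G) B"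
    using skew unfolding skew_partition_def by auto
  have V: "A \<subseteq> verts G" "B \<subseteq> verts G" using AB by auto
  have fin: "finite A" "finite B" using V[THEN finite_subset] finite_verts[OF gr] by blast+
  obtain Q where Q: "Q \<noteq> []" "set Q \<subseteq> A" "even (length Q)" "is_path G (u # Q @ [v])"
    using o unfolding oddp_def by blast
  have uvn: "u \<noteq> v" "\<not> adj G u v" using path_ends_nonadj[OF gr Q(1,4)] by auto
  obtain A1 A2 where A: "set Q \<subseteq> A1" "A1 \<subseteq> A" "A2 \<subseteq> A" "A1 \<inter> A2 = {}" "conn G A1" "conn G A2"
    "\<And>x y. x \<in> A1 \<Longrightarrow> y \<in> A - A1 \<Longrightarrow> \<not> adj G x y" "\<And>x y. x \<in> A2 \<Longrightarrow> y \<in> A - A2 \<Longrightarrow> \<not> adj G x y"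
    using two_components[OF gr fin(1) AB(3) inner_conn[OF gr Q(1,4)] Q(2)] by blast
  \<comment> \<open>The ends of the path are nonadjacent, so they belong to one anticomponent
    \<open>B1\<close>, and a further anticomponent \<open>B2\<close> is complete to both.\<close>
  have "adj (compl G) u v" using uvn uv V unfolding adj_compl by blast
  then have cuv: "conn (compl G) {u, v}" using conn_insert[OF gc conn_singleton, of v v u] by simp
  have uvB: "{u, v} \<subseteq> B" using uv by simp
  obtain B1 B2 where B: "{u, v} \<subseteq> B1" "B1 \<subseteq> B" "B2 \<subseteq> B" "B1 \<inter> B2 = {}" "conn (compl G) B1" "conn (compl G) B2"
    and Bn: "\<And>x y. x \<in> B1 \<Longrightarrow> y \<in> B - B1 \<Longrightarrow> \<not> adj (compl G) x y" "\<And>x y. x \<in> B2 \<Longrightarrow> y \<in> B - B2 \<Longrightarrow> \<not> adj (compl G) x y"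
    using two_components[OF gc fin(2) AB(4) cuv uvB] by blast
  have Bc: "adj G x y" if "x \<in> B1" "y \<in> B - B1" for x y
    using Bn(1)[OF that] that B(2) V(2) unfolding adj_compl by blast
  have Bc2: "adj G x y" if "x \<in> B2" "y \<in> B - B2" for x y
    using Bn(2)[OF that] that B(3) V(2) unfolding adj_compl by blast
  note lp = component_loose_pair[OF gr AB(1,2)]
  have uB: "u \<in> verts G" "v \<in> verts G" "u \<notin> A" "v \<notin> A" "u \<notin> B2" "v \<notin> B2" "u \<in> B1" "v \<in> B1"
    using uv V AB(2) B(1,4) by auto
  have out: "x \<notin> B" if "x \<in> A" for x using that AB(2) by blast
  \<comment> \<open>Such an \<open>a\<close> would be a witness making \<open>A2\<close>,
    \<open>B2\<close> a loose pair: it is anticomplete to the other component.\<close>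
  have ncA1: "\<not> complete G a B2" if "a \<in> A1" for a
  proof
    assume c: "complete G a B2"
    have "anticomplete G a A2"
      using A(8)[of _ a] that A(2,4) sy[of a] unfolding anticomplete_def by blast
    moreover have "a \<in> verts G - (A2 \<union> B2)" using that A(2-4) B(3) V out by blast
    moreover have "u \<in> verts G - (A2 \<union> B2)" using uB A(3) by blast
    moreover have "u \<noteq> a" using uB that A(2) by blast
    ultimately show False using lp[OF A(3,6,8) B(3,6) Bc2 _ _ c] noloose by blast
  qed
  have ncA2: "\<not> complete G a B2" if "a \<in> A2" for a
  proof
    assume c: "complete G a B2"
    have "anticomplete G a A1"
      using A(7)[of _ a] that A(3,4) sy[of a] unfolding anticomplete_def by blast
    moreover have "a \<in> verts G - (A1 \<union> B2)" using that A(2-4) B(3) V out by blast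
    moreover have "u \<in> verts G - (A1 \<union> B2)" using uB A(2) by blast
    moreover have "u \<noteq> a" using uB that A(3) by blast
    ultimately show False using lp[OF A(2,5,7) B(3,6) Bc2 _ _ c] noloose by blast
  qed
  \<comment> \<open>Here the witness comes from \<open>B\<close>: \<open>b\<close> is complete to
    the other anticomponent, so \<open>A2\<close>, \<open>B1\<close> would be a loose pair.\<close>
  have nbB2: "\<not> anticomplete G b A2" if b: "b \<in> B2" for b
  proof
    assume c: "anticomplete G b A2"
    have "complete G b B1"
      using Bc[of _ b] b B(3,4) sy[of b] unfolding complete_def by blast
    moreover have "b \<in> verts G - (A2 \<union> B1)" using b A(3) B(3,4) V out by blast
    moreover obtain z where "z \<in> set Q" using Q(1) by (meson last_in_set)
    then have "z \<in> verts G - (A2 \<union> B1)" "z \<noteq> b" using A(1,2,4) V B(2,3) b out by blast+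
    ultimately show False using lp[OF A(3,6,8) B(2,5) Bc _ c] noloose by blast
  qed
  have uc: "complete G w B2" if "w = u \<or> w = v" for w
    using that Bc2[of _ w] uv uB(5,6) sy[of w] unfolding complete_def by blast
  have nuv: "\<not> anticomplete G w A2" if w: "w = u \<or> w = v" for w
  proof
    assume c: "anticomplete G w A2"
    have "u \<in> verts G - (A2 \<union> B2)" "v \<in> verts G - (A2 \<union> B2)" using uB A(3) by blast+
    moreover have "\<exists>z. (z = u \<or> z = v) \<and> z \<noteq> w" using uvn w by blast
    ultimately show False using lp[OF A(3,6,8) B(3,6) Bc2 _ c uc[OF w]] noloose w by blast
  qed
  obtain x y where xy: "Q = [x, y]" "oddp (compl G) x y B2"
  proof (rule rr_oddp[OF nice _ B(6) Q(4,1,3)])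
    show "B2 \<subseteq> verts G" using B(3) V by blast
    show "set Q \<inter> B2 = {}" using Q(2) B(3) AB(2) by blast
    show "complete G u B2" "complete G v B2" using uc by blast+
    show "\<not> complete G q B2" if "q \<in> set Q" for q using ncA1 that A(1) by blast
  qed (rule that)
  have xyA: "x \<in> A1" "y \<in> A1" using A(1) xy(1) by auto
  have xyV: "x \<in> verts G" "y \<in> verts G" "x \<notin> A2" "y \<notin> A2" using xyA A(2,4) V by blast+
  obtain R where R: "R \<noteq> []" "set R \<subseteq> B2" "even (length R)" "is_path (compl G) (x # R @ [y])"
    using xy(2) unfolding oddp_def by blast
  have A2V: "A2 \<subseteq> verts G" using A(3) V by blast
  have xA2: "\<not> adj G w z" "\<not> adj G z w" if "w \<in> A1" "z \<in> A2" for w z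
    using A(7)[of w z] that A(3,4) sy[of w z] by blast+
  \<comment> \<open>In the complement \<open>x\<close> and \<open>y\<close> are complete to
    \<open>A2\<close>, and by \<open>nbB2\<close> no vertex of \<open>B2\<close> is, so the antipath
    through \<open>B2\<close> has only two inner vertices.\<close>
  obtain p q where pq: "R = [p, q]"
  proof (rule rr_oddp[OF nicec _ _ R(4,1,3)])
    show "A2 \<subseteq> verts (compl G)" using A2V by simp
    show "conn (compl (compl G)) A2" using A(6) gr by simp
    show "set R \<inter> A2 = {}" using R(2) B(3) A(3) AB(2) by blast
    show "complete (compl G) x A2" "complete (compl G) y A2"
      using complete_compl[OF xyV(1) A2V xyV(3)] complete_compl[OF xyV(2) A2V xyV(4)] xA2 xyA
      unfolding anticomplete_def by blast+
    show "\<not> complete (compl G) b A2" if "b \<in> set R" for b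
    proof -
      have "b \<in> B2" using that R(2) by blast
      moreover then have "b \<in> verts G" "b \<notin> A2" using B(3) A(3) V AB(2) by blast+
      ultimately show ?thesis using complete_compl[of b G A2] A2V nbB2 by blast
    qed
  qed (rule that)
  have pqB: "p \<in> B2" "q \<in> B2" using R(2) pq by auto
  obtain S where S: "S \<noteq> []" "set S \<subseteq> A2" "is_path G (u # S @ [v])"
    by (rule conn_path_through[OF gr A(6) A2V uB(1,2) uvn]) (use nuv that in blast)+
  have evS: "even (length S)"
  proof -
    have "even (length Q + length S)"
      by (rule paths_parity[OF gr bg Q(4) S(3) Q(1) S(1)]) (use A(1,4) S(2) xA2 in blast)+
    then show ?thesis using Q(3) by simp
  qed
  obtain x' y' where xy': "S = [x', y']"
  proof (rule rr_oddp[OF nice _ B(6) S(3,1) evS])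
    show "B2 \<subseteq> verts G" using B(3) V by blast
    show "set S \<inter> B2 = {}" using S(2) A(3) B(3) AB(2) by blast
    show "complete G u B2" "complete G v B2" using uc by blast+
    show "\<not> complete G s B2" if "s \<in> set S" for s using ncA2 that S(2) by blast
  qed (rule that)
  have xyA': "x' \<in> A2" "y' \<in> A2" using S(2) xy' by auto
  have pV: "p \<in> verts G" "q \<in> verts G" "x' \<in> verts G" "y' \<in> verts G" using pqB B(3) V xyA' A2V by blast+
  have P: "is_path G (u # [x, y] @ [v])" "is_path (compl G) (x # [p, q] @ [y])" "is_path G (u # [x', y'] @ [v])"
    using Q(4) R(4) S(3) xy(1) pq xy' by simp_all
  have p4: "adj H a b \<and> adj H d c \<and> \<not> adj H a c \<and> \<not> adj H d b \<and> adj H b c \<and> b \<noteq> c"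
    if "graph H" "is_path H (a # [b, c] @ [d])" for H :: "'a graph" and a b c d
  proof -
    have "is_path H [b, c]" using is_path_ends[OF that(1), of "[b, c]" a d] that(2) by simp
    then have "adj H b c \<and> b \<noteq> c" using is_path_Cons[OF that(1), of "[c]" b] by simp
    then show ?thesis using is_path_ends[OF that(1), of "[b, c]" a d] that(2) by auto
  qed
  have E1: "adj G u x" "adj G v y" "\<not> adj G u y" "\<not> adj G v x" "adj G x y" "x \<noteq> y"
    using p4[OF gr P(1)] by blast+
  have E3: "adj G u x'" "adj G v y'" "\<not> adj G u y'" "\<not> adj G v x'" "adj G x' y'" "x' \<noteq> y'"
    using p4[OF gr P(3)] by blast+
  have "adj (compl G) x p" "adj (compl G) y q" "\<not> adj (compl G) x q" "\<not> adj (compl G) y p" "adj (compl G) p q" "p \<noteq> q"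
    using p4[OF gc P(2)] by blast+
  moreover have "x \<noteq> p" "x \<noteq> q" "y \<noteq> p" "y \<noteq> q" using pqB xyA A(2) B(3) out by blast+
  ultimately have E2: "\<not> adj G x p" "\<not> adj G y q" "adj G x q" "adj G y p" "\<not> adj G p q" "p \<noteq> q"
    using xyV pV unfolding adj_compl by blast+
  have E4: "adj G u p" "adj G u q" "adj G v p" "adj G v q" using uc pqB unfolding complete_def by blast+
  have E5: "\<not> adj G x x'" "\<not> adj G x y'" "\<not> adj G y x'" "\<not> adj G y y'" using xA2 xyA xyA' by blast+
  have D: "distinct [u, v, p, q, x, y, x', y']"
  proof -
    have "{p, q} \<inter> {u, v} = {}" "{u, v, p, q} \<inter> {x, y, x', y'} = {}" "{x, y} \<inter> {x', y'} = {}"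
      using pqB uB uv B(3) out xyA xyA' A(2-4) by blast+
    then show ?thesis using uvn(1) E1(6) E2(6) E3(6) by auto
  qed
  have C5: False if "distinct [a, b, c, d, e]" "{a, b, c, d, e} \<subseteq> verts G"
    "adj G a b" "adj G b c" "adj G c d" "adj G d e" "adj G e a"
    "\<not> adj G a c" "\<not> adj G a d" "\<not> adj G b d" "\<not> adj G b e" "\<not> adj G c e" for a b c d e
  proof -
    have "is_path G [b, c, d, e]"
      using that by (simp add: is_path_Cons[OF gr] gr) (auto dest: sy[THEN iffD1])
    moreover have "odd (length [b, c, d, e])"
      by (rule berge_close1[OF bg gr _ calculation, of a]) (use that sy[of e a] in auto)
    ultimately show False by simp
  qed
  have s: "\<And>a b. adj G a b \<Longrightarrow> adj G b a" "\<And>a b. \<not> adj G a b \<Longrightarrow> \<not> adj G b a" using sy by blast+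
  note pos = E1(1,2,5) E2(3,4) E3(1,2,5) E4 and neg = uvn(2) E1(3,4) E2(1,2,5) E3(3,4) E5
  note all = pos pos[THEN s(1)] neg neg[THEN s(2)]
  have VV: "u \<in> verts G" "v \<in> verts G" "p \<in> verts G" "q \<in> verts G" "x \<in> verts G" "y \<in> verts G" "x' \<in> verts G" "y' \<in> verts G"
    using uB xyV pV by auto
  \<comment> \<open>Otherwise \<open>p\<close>, \<open>u\<close>, \<open>x'\<close>,
    \<open>y'\<close>, \<open>v\<close> would induce a hole of length 5.\<close>
  have p1: "adj G p x' \<or> adj G p y'"
  proof (rule ccontr)
    assume "\<not> ?thesis"
    then show False using C5[of p u x' y' v] D VV all s(2)[of p x'] s(2)[of p y'] by auto
  qed
  have q1: "adj G q x' \<or> adj G q y'"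
  proof (rule ccontr)
    assume "\<not> ?thesis"
    then show False using C5[of q u x' y' v] D VV all s(2)[of q x'] s(2)[of q y'] by auto
  qed
  \<comment> \<open>A common neighbour \<open>z\<close> of \<open>p\<close> and \<open>q\<close> in
    \<open>{x', y'}\<close> would give the hole \<open>z\<close>, \<open>p\<close>,
    \<open>y\<close>, \<open>x\<close>, \<open>q\<close> of length 5. So \<open>p\<close> and
    \<open>q\<close> are matched to \<open>x'\<close> and \<open>y'\<close>, and the two possible
    matchings give the two forbidden configurations.\<close>
  have nb: "\<not> (adj G p z \<and> adj G q z)" if z: "z = x' \<or> z = y'" for z
  proof
    assume "adj G p z \<and> adj G q z"
    then show False using C5[of z p y x q] D VV all s(1)[of p z] s(1)[of q z] z by auto
  qed
  from p1 q1 nb[of x'] nb[of y'] consider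
    "adj G q x'" "adj G p y'" "\<not> adj G p x'" "\<not> adj G q y'" | "adj G p x'" "adj G q y'" "\<not> adj G q x'" "\<not> adj G p y'" by blast
  then show False
  proof cases
    case 1
    have "contains_induced G double_diamond"
      by (rule contains_double_diamond[OF gr, of u q x x' p v y y']) (use D VV all 1 s(1)[OF 1(1)] s(1)[OF 1(2)] s(2)[OF 1(3)] s(2)[OF 1(4)] in auto)
    then show False using F6 unfolding F6_def by blast
  next
    case 2
    have "contains_induced G (line_graph K33e)"
      by (rule contains_K33e[OF gr, of u q x p v y x' y']) (use D VV all 2 s(1)[OF 2(1)] s(1)[OF 2(2)] s(2)[OF 2(3)] s(2)[OF 2(4)] in auto)
    then show False using F6 graph_K33e bipartite_K33e subdivision_K33e unfolding F6_def F5_def by blast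
  qed
qed

theorem theorem15p1:
  fixes G :: "'a graph"
  assumes "graph G" and "F6 G" and "\<exists>A B. skew_partition G A B"
  shows "\<exists>A B. balanced_skew_partition G A B"
proof -
  obtain A B where AB: "skew_partition G A B" using assms(3) by blast
  show ?thesis
  proof (cases "good G A B")
    case True
    then show ?thesis using AB balanced_iff_good[OF assms(1)] by blast
  next
    case False
    then consider u v where "u \<in> B" "v \<in> B" "oddp G u v A" | x y where "x \<in> A" "y \<in> A" "oddp (compl G) x y B"
      unfolding good_def by blast
    then show ?thesis
    proof cases
      case 1
      then show ?thesis using balanced_exists_if_odd_path[OF assms(1,2) AB] by blast
    next
      case 2
      \<comment> \<open>An odd antipath for \<open>A\<close>, \<open>B\<close> is an odd path of the
        complement for the partition with the sides exchanged.\<close>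
      have "skew_partition (compl G) B A" using AB skew_partition_compl[OF assms(1)] by blast
      then have "\<exists>A B. balanced_skew_partition (compl G) A B"
        using balanced_exists_if_odd_path[OF graph_compl[OF assms(1)] F6_compl[OF assms(1,2)]] 2 by blast
      then show ?thesis using balanced_exists_compl[OF assms(1)] by blast
    qed
  qed
qed

end
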